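(* Let $d\ge1$, $s\in(0,1]$, let $m>\frac d2+1$ be an integer, and let $F_1,F_2\in\mathcal{C}^\infty(\mathbb{R}^+)$ with $F_i(0)=0$ and $F_i'>0$ a.e. on $[0,\infty)$. Given two pointwise positive initial data $u_{1,0},u_{2,0}\in H^m(\mathbb{T}^d)$, let $u_i$ ($i=1,2$) be the (global) solution of the Cauchy problem $$\partial_t u_i=F_i(u_i)\,|\nabla|^s u_i-|\nabla|^s\bigl(u_iF_i(u_i)\bigr),\qquad u_i|_{t=0}=u_{i,0}.$$ (1) The following stability estimate holds in $L^2(\mathbb{T}^d)$: $$\forall\,t>0,\qquad \|u_1(t)-u_2(t)\|_{L^2}\le\bigl(\|u_{1,0}-u_{2,0}\|_{L^2}+\|F_1'-F_2'\|_{L^\infty}\bigr)e^{C_0t},$$ with a constant $C_0$ that depends on $d,\|u_1\|_{H^m},\|u_2\|_{H^m}$. (2) In $L^\infty(\mathbb{T}^d)$, there is also an estimate that is independent of the $F_i$: for all $t>0$, $$\|u_1(t)-u_2(t)\|_{L^\infty}\le2\sqrt d\,\pi\bigl(\|\nabla u_1(t)\|_{L^\infty}+\|\nabla u_2(t)\|_{L^\infty}\bigr)+\frac1{\sqrt{|\mathbb{T}^d|}}\Bigl|\,\|u_{1,0}\|_{L^2(\mathbb{T}^d)}-\|u_{2,0}\|_{L^2(\mathbb{T}^d)}\Bigr| .$$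
   Context: $\mathbb{T}^d=(\mathbb{R}/2\pi\mathbb{Z})^d$, $|\mathbb{T}^d|=(2\pi)^d$, $\mathbb{R}^+=[0,\infty)$. $|\nabla|^s=(-\Delta)^{s/2}$ is the Fourier multiplier of symbol $|\xi|^s$. For such data each Cauchy problem has a unique positive global solution $u_i\in\mathcal{C}(\mathbb{R}^+;H^m(\mathbb{T}^d))\cap\mathcal{C}^1(\mathbb{R}^+;H^{m-1}(\mathbb{T}^d))$.
   Formalization: In (1) the constant C_0 may also depend on F_1 (and m), not only on d and the sup-in-time H^m norms of u_1, u_2; without this the claim fails: replacing F_1 = F_2 = F by λF rescales time and would force an L^2 contraction, false for F(z)=z. *)

theory Defs
  imports "HOL-Analysis.Analysis" "HOL-Probability.Essential_Supremum"
begin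

text \<open>
  Functions on the torus \<open>(\<real>/2\<pi>\<int>)^d\<close>, with \<open>d = CARD('n)\<close>, are functions on \<open>real ^ 'n\<close> that are
  \<open>2\<pi>\<close>-periodic in every coordinate.  Integrals and a.e. statements refer to the fundamental cell
  \<open>[0,2\<pi>]^d\<close>, whose total mass is \<open>(2\<pi>)^d\<close>.
\<close>

definition torus :: "(real ^ 'n) measure" where
  "torus = restrict_space lborel (cbox 0 (\<chi> j. 2 * pi))"

definition torus_periodic :: "(real ^ 'n \<Rightarrow> 'a) \<Rightarrow> bool" where
  "torus_periodic f \<longleftrightarrow> (\<forall>x j. f (x + axis j (2 * pi)) = f x)"

definition torus_L2 :: "(real ^ 'n \<Rightarrow> real) \<Rightarrow> bool" where
  "torus_L2 f \<longleftrightarrow> torus_periodic f \<and> f \<in> borel_measurable torus \<and> integrable torus (\<lambda>x. (f x)\<^sup>2)"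

definition L2_norm :: "(real ^ 'n \<Rightarrow> real) \<Rightarrow> real" where
  "L2_norm f = sqrt (LINT x|torus. (f x)\<^sup>2)"

text \<open>Extended-real valued, so that unbounded functions have norm \<open>\<infinity>\<close>.\<close>

definition Linf_norm :: "'a measure \<Rightarrow> ('a \<Rightarrow> 'b::real_normed_vector) \<Rightarrow> ereal" where
  "Linf_norm M f = esssup M (\<lambda>x. ereal (norm (f x)))"

definition freq :: "int ^ 'n \<Rightarrow> real ^ 'n" where
  "freq k = (\<chi> j. real_of_int (k $ j))"

definition fourier_coeff :: "(real ^ 'n \<Rightarrow> real) \<Rightarrow> int ^ 'n \<Rightarrow> complex" where
  "fourier_coeff f k =
     (LINT x|torus. complex_of_real (f x) * cis (- (freq k \<bullet> x))) / of_real ((2 * pi) ^ CARD('n))"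

definition sobolev_space :: "nat \<Rightarrow> (real ^ 'n \<Rightarrow> real) \<Rightarrow> bool" where
  "sobolev_space m f \<longleftrightarrow> torus_L2 f \<and>
     (\<lambda>k. (1 + (norm (freq k))\<^sup>2) ^ m * (cmod (fourier_coeff f k))\<^sup>2) summable_on UNIV"

text \<open>The factor \<open>(2\<pi>)^d\<close> makes the norm of \<open>H^0\<close> agree with \<^const>\<open>L2_norm\<close> (Parseval).\<close>

definition sobolev_norm :: "nat \<Rightarrow> (real ^ 'n \<Rightarrow> real) \<Rightarrow> real" where
  "sobolev_norm m f = sqrt ((2 * pi) ^ CARD('n) *
     (\<Sum>\<^sub>\<infinity>k. (1 + (norm (freq k))\<^sup>2) ^ m * (cmod (fourier_coeff f k))\<^sup>2))"

text \<open>\<open>g = |\<nabla>|^s f\<close> in \<open>L^2\<close>; a relation, since \<open>|\<nabla>|^s f\<close> is only determined up to null sets.\<close>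

definition has_frac_laplacian ::
    "real \<Rightarrow> (real ^ 'n \<Rightarrow> real) \<Rightarrow> (real ^ 'n \<Rightarrow> real) \<Rightarrow> bool" where
  "has_frac_laplacian s f g \<longleftrightarrow> torus_L2 f \<and> torus_L2 g \<and>
     (\<forall>k. fourier_coeff g k = of_real (norm (freq k) powr s) * fourier_coeff f k)"

text \<open>Classical gradient; it is applied only to continuous \<open>f \<in> H^m\<close> with \<open>m > d/2 + 1\<close>, which are \<open>C^1\<close>.\<close>

definition gradient :: "(real ^ 'n \<Rightarrow> real) \<Rightarrow> real ^ 'n \<Rightarrow> real ^ 'n" where
  "gradient f x = (\<chi> j. deriv (\<lambda>h. f (x + axis j h)) 0)"

text \<open>Derivative on \<open>[0,\<infinity>)\<close>, one-sided at \<open>0\<close>; values of \<open>F\<close> on negative arguments play no role.\<close>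

definition half_deriv :: "(real \<Rightarrow> real) \<Rightarrow> real \<Rightarrow> real" where
  "half_deriv F z = vector_derivative F (at z within {0..})"

definition half_line :: "real measure" where
  "half_line = restrict_space lborel {0..}"

definition admissible :: "(real \<Rightarrow> real) \<Rightarrow> bool" where
  "admissible F \<longleftrightarrow> (\<forall>n. (half_deriv ^^ n) F differentiable_on {0..}) \<and> F 0 = 0 \<and>
     (AE z in half_line. 0 < half_deriv F z)"

definition sobolev_continuous :: "nat \<Rightarrow> (real \<Rightarrow> real ^ 'n \<Rightarrow> real) \<Rightarrow> bool" where
  "sobolev_continuous m u \<longleftrightarrow> (\<forall>t\<ge>0. sobolev_space m (u t) \<and>
     ((\<lambda>\<tau>. sobolev_norm m (\<lambda>x. u \<tau> x - u t x)) \<longlongrightarrow> 0) (at t within {0..}))"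

definition sobolev_time_derivative ::
    "nat \<Rightarrow> (real \<Rightarrow> real ^ 'n \<Rightarrow> real) \<Rightarrow> (real \<Rightarrow> real ^ 'n \<Rightarrow> real) \<Rightarrow> bool" where
  "sobolev_time_derivative m u v \<longleftrightarrow> (\<forall>t\<ge>0.
     ((\<lambda>\<tau>. sobolev_norm m (\<lambda>x. (u \<tau> x - u t x) / (\<tau> - t) - v t x)) \<longlongrightarrow> 0) (at t within {0..}))"

text \<open>
  Positive global solutions of \<open>\<partial>\<^sub>t u = F(u) |\<nabla>|^s u - |\<nabla>|^s (u F(u))\<close>, \<open>u(0) = u0\<close>, in
  \<open>C(\<real>\<^sup>+; H^m) \<inter> C^1(\<real>\<^sup>+; H^(m-1))\<close>.  As \<open>m > d/2\<close> in the intended use, \<open>u t \<in> H^m\<close> is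
  represented by its continuous representative, so that positivity is meant at every point.
  \<open>v\<close> is the time derivative of \<open>u\<close>.
\<close>

definition positive_global_solution ::
    "nat \<Rightarrow> real \<Rightarrow> (real \<Rightarrow> real) \<Rightarrow> (real ^ 'n \<Rightarrow> real) \<Rightarrow> (real \<Rightarrow> real ^ 'n \<Rightarrow> real) \<Rightarrow> bool" where
  "positive_global_solution m s F u0 u \<longleftrightarrow>
     sobolev_continuous m u \<and>
     (\<forall>t\<ge>0. continuous_on UNIV (u t) \<and> (\<forall>x. 0 < u t x)) \<and>
     u 0 = u0 \<and>
     (\<exists>v. sobolev_continuous (m - 1) v \<and> sobolev_time_derivative (m - 1) u v \<and>
        (\<forall>t\<ge>0. \<exists>p q.
           has_frac_laplacian s (u t) p \<and>
           has_frac_laplacian s (\<lambda>x. u t x * F (u t x)) q \<and>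
           (AE x in torus. v t x = F (u t x) * p x - q x)))"

definition sobolev_bounded :: "nat \<Rightarrow> real set \<Rightarrow> (real \<Rightarrow> real ^ 'n \<Rightarrow> real) \<Rightarrow> bool" where
  "sobolev_bounded m I u \<longleftrightarrow> bdd_above ((\<lambda>\<tau>. sobolev_norm m (u \<tau>)) ` I)"

text \<open>The norm of \<open>L^\<infinity>(I; H^m)\<close> for \<open>u\<close> continuous in time and bounded on \<open>I\<close> with values in \<open>H^m\<close>.\<close>

definition sobolev_sup_norm :: "nat \<Rightarrow> real set \<Rightarrow> (real \<Rightarrow> real ^ 'n \<Rightarrow> real) \<Rightarrow> real" where
  "sobolev_sup_norm m I u = (SUP \<tau>\<in>I. sobolev_norm m (u \<tau>))"

end

theory Submission
  imports Defs "HOL-Probability.Characteristic_Functions"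
begin

text \<open>
  Write \<open>w = u\<^sub>1 - u\<^sub>2\<close> and \<open>\<Lambda> = |\<nabla>|\<^sup>s\<close>.  Since \<open>\<Lambda>\<close> is symmetric, the worst terms of the energy identity
  cancel and
  \<open>1/2 d/dt \<parallel>w\<parallel>\<^sup>2 = \<integral> (F\<^sub>1(u\<^sub>1) - F\<^sub>2(u\<^sub>2)) (w \<Lambda> u\<^sub>2 - u\<^sub>2 \<Lambda> w)\<close>.
  Split \<open>F\<^sub>1(u\<^sub>1) - F\<^sub>2(u\<^sub>2)\<close> into \<open>F\<^sub>1(u\<^sub>1) - F\<^sub>1(u\<^sub>2)\<close> and \<open>(F\<^sub>1 - F\<^sub>2)(u\<^sub>2)\<close>.  The first part leaves, along the
  segment \<open>v = u\<^sub>2 + \<theta> w\<close>, the term \<open>- \<integral> b w \<Lambda> w\<close> with \<open>b = u\<^sub>2 F\<^sub>1'(v) \<ge> 0\<close>; by the Cordoba-Cordoba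
  inequality \<open>2 w \<Lambda> w \<ge> \<Lambda>(w\<^sup>2)\<close> it is at most a multiple of \<open>\<parallel>w\<parallel>\<^sup>2\<close>, because the second differences of
  \<open>b\<close> are of order \<open>|h|\<close> to the power \<open>5/4 > s\<close>.  In the second part \<open>\<Lambda>\<close> is moved to the Lipschitz
  function \<open>u\<^sub>2 (F\<^sub>1 - F\<^sub>2)(u\<^sub>2)\<close>, which costs only one derivative of \<open>F\<^sub>1 - F\<^sub>2\<close>.  Gronwall's argument
  concludes.  The same symmetry shows that \<open>\<parallel>u(t)\<parallel>\<close> is conserved, so \<open>u(t)\<close> deviates from the constant
  \<open>\<parallel>u(0)\<parallel> / (2\<pi>)\<^sup>d\<^sup>/\<^sup>2\<close> by at most the diameter of the cell times \<open>sup |\<nabla>u(t)|\<close>, which is the second claim.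
\<close>

section \<open>Integration on the torus\<close>

text \<open>The constant may depend on \<open>F1\<close>, but neither on \<open>s\<close> nor on
  \<open>F2\<close>. This dictates the asymmetric splitting: the change of argument is made inside
  \<open>F1\<close>, whose first three derivatives on a compact range may enter the constant, while
  \<open>F2\<close> is met only through \<open>F1 - F2\<close>, which vanishes at 0 and is therefore
  controlled by its first derivative. The second obstacle is that \<open>|\<nabla>|^s\<close> is
  given only as a Fourier multiplier between L2 classes. Everything is tested against functions
  whose Fourier series converges absolutely with a weight: they have point values, the multiplier
  sends them to continuous functions, and L2 representatives survive only under integrals. The
  composite u F(u) is never placed in that class; symmetry moves the multiplier off it. No singular
  kernel on the torus is computed either. Positivity is an elementary fact about finite
  translations, and averaging over translations carries it to \<open>|\<nabla>|^s\<close>.\<close>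

lemma space_torus: "space torus = cbox (0::real^'n) (\<chi> j. 2 * pi)"
  by (simp add: torus_def space_restrict_space)

lemma integral_torus:
  fixes f :: "real ^ 'n \<Rightarrow> 'b::{banach, second_countable_topology}"
  shows "(LINT x|torus. f x) = (LINT x|lborel. indicat_real (cbox 0 (\<chi> j. 2 * pi)) x *\<^sub>R f x)"
  unfolding torus_def by (subst integral_restrict_space) auto

lemma measurable_torus:
  "f \<in> borel_measurable borel \<Longrightarrow> f \<in> borel_measurable (torus :: (real^'n) measure)"
  unfolding torus_def by (intro measurable_restrict_space1) simp

lemma content_torus: "measure lborel (cbox (0::real^'n) (\<chi> j. 2 * pi)) = (2 * pi) ^ CARD('n)"
  by (subst content_cbox_cart) (auto simp: interval_eq_empty_cart intro: order_trans[OF _ pi_ge_zero])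

lemma emeasure_torus: "emeasure (torus :: (real^'n) measure) (space torus) = ennreal ((2 * pi) ^ CARD('n))"
proof -
  have "emeasure (torus :: (real^'n) measure) (space torus) = emeasure lborel (cbox (0::real^'n) (\<chi> j. 2 * pi))"
    unfolding space_torus unfolding torus_def by (subst emeasure_restrict_space) auto
  also have "\<dots> = ennreal (measure lborel (cbox (0::real^'n) (\<chi> j. 2 * pi)))"
    by (intro emeasure_eq_ennreal_measure) (simp add: emeasure_lborel_cbox_eq)
  finally show ?thesis by (simp only: content_torus)
qed

lemma finite_measure_torus: "finite_measure (torus :: (real^'n) measure)"
  by (rule finite_measureI) (simp add: emeasure_torus)

interpretation torus: finite_measure "torus :: (real^'n) measure"
  by (rule finite_measure_torus)

lemma measure_torus: "measure (torus :: (real^'n) measure) (space torus) = (2 * pi) ^ CARD('n)"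
  by (simp add: measure_def emeasure_torus)

lemma continuous_measurable_torus:
  fixes f :: "real ^ 'n \<Rightarrow> 'b::topological_space"
  shows "continuous_on UNIV f \<Longrightarrow> f \<in> borel_measurable torus"
  by (intro measurable_torus borel_measurable_continuous_onI)

lemma integrable_continuous_torus:
  fixes f :: "real ^ 'n \<Rightarrow> 'b::{banach, second_countable_topology}"
  assumes "continuous_on UNIV f"
  shows "integrable torus f"
  unfolding torus_def
  by (subst integrable_restrict_space)
    (auto intro!: borel_integrable_compact[OF compact_cbox] continuous_on_subset[OF assms])

text \<open>Compactness of the closed cell bounds the continuous factor there, and the measure sees
  nothing outside the cell.\<close>

lemma integrable_mult_continuous_torus:
  fixes f g :: "real ^ 'n \<Rightarrow> 'b::{banach, second_countable_topology, real_normed_algebra}"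
  assumes "continuous_on UNIV f" "integrable torus g"
  shows "integrable torus (\<lambda>x. f x * g x)"
proof -
  have "compact (f ` cbox 0 (\<chi> j. 2 * pi))"
    by (intro compact_continuous_image continuous_on_subset[OF assms(1)]) auto
  then have "\<exists>B. \<forall>x\<in>cbox 0 (\<chi> j. 2 * pi). norm (f x) \<le> B"
    by (auto dest!: compact_imp_bounded simp: bounded_iff)
  then obtain B where B: "\<And>x. x \<in> cbox 0 (\<chi> j. 2 * pi) \<Longrightarrow> norm (f x) \<le> B"
    by blast
  show ?thesis
  proof (rule Bochner_Integration.integrable_bound)
    show "integrable torus (\<lambda>x. B * norm (g x))"
      using assms(2) by (intro integrable_mult_right integrable_norm)
    show "(\<lambda>x. f x * g x) \<in> borel_measurable torus"
      using continuous_measurable_torus[OF assms(1)] assms(2) by (intro borel_measurable_times) auto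
    show "AE x in torus. norm (f x * g x) \<le> norm (B * norm (g x))"
    proof (rule AE_I2)
      fix x :: "real^'n" assume "x \<in> space torus"
      then have "norm (f x) \<le> B" by (simp add: space_torus B)
      then have "norm (f x) * norm (g x) \<le> B * norm (g x)" by (simp add: mult_right_mono)
      also have "\<dots> \<le> norm (B * norm (g x))" by simp
      finally show "norm (f x * g x) \<le> norm (B * norm (g x))"
        using norm_mult_ineq order_trans by blast
    qed
  qed
qed

lemma torus_periodicD: "torus_periodic f \<Longrightarrow> f (x + axis j (2 * pi)) = f x"
  by (simp add: torus_periodic_def)

lemma torus_periodic_int:
  assumes "torus_periodic f"
  shows "f (x + axis j (of_int m * (2 * pi))) = f x"
proof -
  have nat: "f (x + axis j (of_nat m * (2 * pi))) = f x" for m :: nat and x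
  proof (induction m)
    case (Suc m)
    have "x + axis j (of_nat (Suc m) * (2 * pi)) = (x + axis j (of_nat m * (2 * pi))) + axis j (2 * pi)"
      by (simp add: vec_eq_iff axis_def algebra_simps)
    then show ?case using Suc torus_periodicD[OF assms] by metis
  qed (simp add: axis_def zero_vec_def[symmetric])
  show ?thesis
  proof (cases "m \<ge> 0")
    case True then show ?thesis using nat[of x "nat m"] by simp
  next
    case False
    have "x = (x + axis j (of_int m * (2 * pi))) + axis j (of_nat (nat (- m)) * (2 * pi))"
      using False by (simp add: vec_eq_iff axis_def algebra_simps)
    then show ?thesis using nat by metis
  qed
qed

lemma torus_periodic_freq:
  fixes k :: "int ^ 'n"
  assumes "torus_periodic f"
  shows "f (x + (2 * pi) *\<^sub>R freq k) = f x"
proof -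
  have *: "finite A \<Longrightarrow> f (x + (\<Sum>j\<in>A. axis j (of_int (k$j) * (2 * pi)))) = f x" for A :: "'n set"
  proof (induction A rule: finite_induct)
    case (insert a A)
    then show ?case
      using torus_periodic_int[OF assms, of "x + (\<Sum>j\<in>A. axis j (of_int (k$j) * (2 * pi)))" a "k$a"]
      by (simp add: ac_simps)
  qed simp
  have "(2 * pi) *\<^sub>R freq k = (\<Sum>j\<in>UNIV. axis j (of_int (k$j) * (2 * pi)))"
    by (simp add: vec_eq_iff freq_def axis_def if_distrib cong: if_cong)
  then show ?thesis using *[of UNIV] by simp
qed

lemma torus_cell_representative:
  fixes x :: "real ^ 'n"
  obtains k :: "int ^ 'n" where "x + (2 * pi) *\<^sub>R freq k \<in> cbox 0 (\<chi> j. 2 * pi)"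
proof -
  have "x + (2 * pi) *\<^sub>R freq (\<chi> j. - \<lfloor>x $ j / (2 * pi)\<rfloor>) \<in> cbox 0 (\<chi> j. 2 * pi)"
  proof -
    have "0 \<le> x $ j + 2 * pi * real_of_int (- \<lfloor>x $ j / (2 * pi)\<rfloor>) \<and>
      x $ j + 2 * pi * real_of_int (- \<lfloor>x $ j / (2 * pi)\<rfloor>) \<le> 2 * pi" for j
    proof -
      have "of_int \<lfloor>x $ j / (2 * pi)\<rfloor> \<le> x $ j / (2 * pi)" "x $ j / (2 * pi) \<le> of_int \<lfloor>x $ j / (2 * pi)\<rfloor> + 1"
        by linarith+
      then have "of_int \<lfloor>x $ j / (2 * pi)\<rfloor> * (2 * pi) \<le> x $ j" "x $ j \<le> (of_int \<lfloor>x $ j / (2 * pi)\<rfloor> + 1) * (2 * pi)"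
        by (simp_all only: pos_le_divide_eq pos_divide_le_eq pi_gt_zero zero_less_mult_iff zero_less_numeral simp_thms)
      then show ?thesis by (simp add: algebra_simps)
    qed
    then show ?thesis by (simp add: mem_box_cart freq_def)
  qed
  then show ?thesis using that by blast
qed

lemma torus_periodic_bound:
  fixes f :: "real ^ 'n \<Rightarrow> 'b"
  assumes "torus_periodic f" "\<And>x. x \<in> cbox 0 (\<chi> j. 2 * pi) \<Longrightarrow> P (f x)"
  shows "P (f x)"
  by (metis assms torus_cell_representative torus_periodic_freq)

lemma torus_periodic_comp: "torus_periodic f \<Longrightarrow> torus_periodic (\<lambda>x. h (f x))"
  by (simp add: torus_periodic_def)

lemma torus_periodic_comp2: "torus_periodic f \<Longrightarrow> torus_periodic g \<Longrightarrow> torus_periodic (\<lambda>x. h (f x) (g x))"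
  by (simp add: torus_periodic_def)

lemma torus_periodic_shift: "torus_periodic f \<Longrightarrow> torus_periodic (\<lambda>x. f (x + h))"
  by (simp add: torus_periodic_def) (metis add.assoc add.commute)

lemma torus_periodic_cis: "torus_periodic (\<lambda>x. cis (freq k \<bullet> x))"
proof -
  have "cis (freq k \<bullet> (x + axis j (2 * pi))) = cis (freq k \<bullet> x)" for x j
  proof -
    have "freq k \<bullet> (x + axis j (2 * pi)) = freq k \<bullet> x + 2 * pi * of_int (k $ j)"
      by (simp add: inner_add_right inner_axis freq_def)
    then show ?thesis by (simp add: cis_mult[symmetric] cis_multiple_2pi)
  qed
  then show ?thesis by (simp add: torus_periodic_def)
qed

section \<open>Translation invariance\<close>

lemma lborel_integral_translation:
  fixes f :: "real ^ 'n \<Rightarrow> 'b::{banach, second_countable_topology}"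
  shows "f \<in> borel_measurable borel \<Longrightarrow> (LINT x|lborel. f (x + a)) = (LINT x|lborel. f x)"
proof -
  assume f: "f \<in> borel_measurable borel"
  have "(LINT x|lborel. f x) = (LINT x|distr lborel borel ((+) a). f x)"
    by (simp only: lborel_distr_plus)
  also have "\<dots> = (LINT x|lborel. f (a + x))"
    using f by (intro integral_distr) simp_all
  finally show ?thesis by (simp add: add.commute)
qed

text \<open>Moving the cell by \<open>a\<close> along axis \<open>j\<close> gains a slab on one side
  and loses one on the other. The two slabs differ by a full period, so they contribute equally.
  Faces are null and may be added or dropped.\<close>

lemma integral_torus_slab_shift:
  fixes f :: "real ^ 'n \<Rightarrow> 'b::{banach, second_countable_topology}"
  assumes f: "continuous_on UNIV f" "torus_periodic f" and a: "0 \<le> a" "a \<le> 2 * pi"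
  shows "(LINT x|torus. f (x + axis j a)) = (LINT x|torus. f x)"
proof -
  \<comment> \<open>\<open>Q\<close> drops the constraint on coordinate \<open>j\<close>. The slabs
    \<open>S p q\<close> are half-open in that coordinate so that adjacent ones tile without
    overlap; the closed cell differs from \<open>S 0 (2 * pi)\<close> by a null face.\<close>
  define Q where "Q = {x::real^'n. \<forall>i. i \<noteq> j \<longrightarrow> 0 \<le> x $ i \<and> x $ i \<le> 2 * pi}"
  define S where "S p q = Q \<inter> {x. p < x $ j \<and> x $ j \<le> q}" for p q :: real
  let ?C = "cbox (0::real^'n) (\<chi> j. 2 * pi)"
  have Qb: "Q \<in> sets borel"
  proof -
    have "closed Q" unfolding Q_def
      by (intro closed_Collect_all closed_Collect_imp closed_Collect_conj closed_Collect_le) (auto intro!: continuous_intros)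
    then show ?thesis by simp
  qed
  have S[measurable]: "S p q \<in> sets borel" for p q
  proof -
    have "{x::real^'n. p < x $ j} \<in> sets borel" "{x::real^'n. x $ j \<le> q} \<in> sets borel"
      by (auto intro!: borel_open borel_closed open_Collect_less closed_Collect_le continuous_intros)
    moreover have "S p q = Q \<inter> ({x. p < x $ j} \<inter> {x. x $ j \<le> q})" by (auto simp: S_def)
    ultimately show ?thesis using Qb by (metis sets.Int)
  qed
  have fm[measurable]: "f \<in> borel_measurable borel" using f by (intro borel_measurable_continuous_onI)
  have sub: "S p q \<subseteq> cbox (\<chi> i. if i = j then p else 0) (\<chi> i. if i = j then q else 2 * pi)" for p q
    by (auto simp: S_def Q_def mem_box_cart)
  have int: "integrable lborel (\<lambda>x. indicat_real (S p q) x *\<^sub>R f x)" for p q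
  proof (rule Bochner_Integration.integrable_bound)
    show "integrable lborel (\<lambda>x. indicat_real (cbox (\<chi> i. if i = j then p else 0) (\<chi> i. if i = j then q else 2 * pi)) x *\<^sub>R f x)"
      by (intro borel_integrable_compact[OF compact_cbox] continuous_on_subset[OF f(1)]) auto
    show "AE x in lborel. norm (indicat_real (S p q) x *\<^sub>R f x) \<le> norm (indicat_real (cbox (\<chi> i. if i = j then p else 0) (\<chi> i. if i = j then q else 2 * pi)) x *\<^sub>R f x)"
      using sub by (intro AE_I2) (auto simp: indicator_def)
  qed measurable
  have null: "AE x::real^'n in lborel. x $ j \<noteq> c" for c
  proof (rule AE_I')
    have "{x::real^'n. axis j 1 \<bullet> x = c} \<in> null_sets lebesgue"
      by (intro negligible_iff_null_sets[THEN iffD1] negligible_hyperplane) (simp add: axis_eq_0_iff)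
    moreover have "{x::real^'n. axis j 1 \<bullet> x = c} \<in> sets borel"
      by (intro borel_closed closed_hyperplane)
    ultimately show "{x::real^'n. axis j 1 \<bullet> x = c} \<in> null_sets lborel"
      by (metis null_sets_completion_iff sets_lborel)
    show "{x \<in> space lborel. \<not> x $ j \<noteq> c} \<subseteq> {x. axis j 1 \<bullet> x = c}"
      by (auto simp: inner_axis')
  qed
  have C_iff: "x \<in> ?C \<longleftrightarrow> x \<in> Q \<and> 0 \<le> x $ j \<and> x $ j \<le> 2 * pi" for x
    by (auto simp: Q_def mem_box_cart)
  have Q_shift: "x + axis j r \<in> Q \<longleftrightarrow> x \<in> Q" for x r
    by (auto simp: Q_def axis_def)
  have cell: "(LINT x|torus. f x) = (LINT x|lborel. indicat_real (S 0 (2*pi)) x *\<^sub>R f x)"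
    unfolding integral_torus
  proof (rule integral_cong_AE)
    show "AE x in lborel. indicat_real ?C x *\<^sub>R f x = indicat_real (S 0 (2*pi)) x *\<^sub>R f x"
      using null[of 0] by eventually_elim (auto simp: S_def indicator_def C_iff)
  qed measurable
  have "(LINT x|torus. f (x + axis j a)) = (LINT x|lborel. indicat_real ?C x *\<^sub>R f (x + axis j a))"
    by (rule integral_torus)
  also have "\<dots> = (LINT x|lborel. indicat_real (S a (2 * pi + a)) (x + axis j a) *\<^sub>R f (x + axis j a))"
  proof (rule integral_cong_AE)
    show "AE x in lborel. indicat_real ?C x *\<^sub>R f (x + axis j a) = indicat_real (S a (2 * pi + a)) (x + axis j a) *\<^sub>R f (x + axis j a)"
      using null[of 0] by eventually_elim (auto simp: S_def indicator_def C_iff Q_shift)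
  qed measurable
  also have "\<dots> = (LINT x|lborel. indicat_real (S a (2 * pi + a)) x *\<^sub>R f x)"
    by (rule lborel_integral_translation[where f="\<lambda>x. indicat_real (S a (2 * pi + a)) x *\<^sub>R f x"]) measurable
  \<comment> \<open>The slab from a to 2 pi + a is the one from 0 to 2 pi with (2 pi, 2 pi + a]
    gained and (0, a] lost; the following equations match these two pieces by one period.\<close>
  also have "\<dots> = (LINT x|lborel. indicat_real (S 0 (2 * pi)) x *\<^sub>R f x + indicat_real (S (2*pi) (2 * pi + a)) x *\<^sub>R f x - indicat_real (S 0 a) x *\<^sub>R f x)"
    using a by (intro Bochner_Integration.integral_cong) (auto simp: S_def indicator_def)
  also have "\<dots> = (LINT x|lborel. indicat_real (S 0 (2 * pi)) x *\<^sub>R f x) + (LINT x|lborel. indicat_real (S (2*pi) (2 * pi + a)) x *\<^sub>R f x) - (LINT x|lborel. indicat_real (S 0 a) x *\<^sub>R f x)"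
    using int by simp
  also have "(LINT x|lborel. indicat_real (S (2*pi) (2 * pi + a)) x *\<^sub>R f x) = (LINT x|lborel. indicat_real (S (2*pi) (2 * pi + a)) (x + axis j (2*pi)) *\<^sub>R f (x + axis j (2*pi)))"
    by (rule lborel_integral_translation[symmetric]) measurable
  also have "\<dots> = (LINT x|lborel. indicat_real (S 0 a) x *\<^sub>R f x)"
    using torus_periodicD[OF f(2)] by (intro Bochner_Integration.integral_cong) (auto simp: S_def Q_def indicator_def axis_def)
  finally show ?thesis by (simp add: cell)
qed

lemma integral_torus_axis_shift:
  fixes f :: "real ^ 'n \<Rightarrow> 'b::{banach, second_countable_topology}"
  assumes f: "continuous_on UNIV f" "torus_periodic f"
  shows "(LINT x|torus. f (x + axis j a)) = (LINT x|torus. f x)"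
proof -
  define m where "m = \<lfloor>a / (2 * pi)\<rfloor>"
  define r where "r = a - of_int m * (2 * pi)"
  have "of_int m \<le> a / (2 * pi)" "a / (2 * pi) \<le> of_int m + 1"
    unfolding m_def by linarith+
  then have r: "0 \<le> r" "r \<le> 2 * pi"
    by (simp_all add: r_def pos_le_divide_eq pos_divide_le_eq algebra_simps)
  have "f (x + axis j a) = f (x + axis j r)" for x
  proof -
    have "x + axis j a = (x + axis j r) + axis j (of_int m * (2 * pi))"
      by (simp add: vec_eq_iff axis_def r_def)
    then show ?thesis by (metis torus_periodic_int[OF f(2)])
  qed
  then show ?thesis using integral_torus_slab_shift[OF f r] by simp
qed

lemma integral_torus_shift:
  fixes f :: "real ^ 'n \<Rightarrow> 'b::{banach, second_countable_topology}"
  assumes f: "continuous_on UNIV f" "torus_periodic f"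
  shows "(LINT x|torus. f (x + h)) = (LINT x|torus. f x)"
proof -
  have *: "finite A \<Longrightarrow> (LINT x|torus. f (x + (\<Sum>j\<in>A. axis j (h$j)))) = (LINT x|torus. f x)" for A :: "'n set"
  proof (induction A rule: finite_induct)
    case (insert a A)
    let ?s = "\<Sum>j\<in>A. axis j (h$j)"
    have "(LINT x|torus. f ((x + axis a (h$a)) + ?s)) = (LINT x|torus. f (x + ?s))"
      by (rule integral_torus_axis_shift[where f="\<lambda>x. f (x + ?s)"])
        (auto intro!: torus_periodic_shift f continuous_on_compose2[OF f(1)] continuous_intros)
    then show ?case using insert by (simp add: ac_simps)
  qed simp
  have "h = (\<Sum>j\<in>UNIV. axis j (h$j))"
    by (simp add: vec_eq_iff axis_def if_distrib cong: if_cong)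
  then show ?thesis using *[of UNIV] by simp
qed

lemma integral_torus_cis:
  fixes k :: "int ^ 'n"
  shows "(LINT x|torus. cis (freq k \<bullet> x)) = (if k = 0 then (2 * pi) ^ CARD('n) else 0)"
proof (cases "k = 0")
  case True
  then have "(LINT x|torus. cis (freq k \<bullet> x)) = (LINT x|(torus::(real^'n) measure). (1::complex))"
    by (intro Bochner_Integration.integral_cong) (auto simp: freq_def inner_vec_def)
  then show ?thesis using True by (simp add: measure_torus scaleR_conv_of_real)
next
  case False
  then obtain j where j: "k $ j \<noteq> 0" by (auto simp: vec_eq_iff)
  \<comment> \<open>Translation by this \<open>h\<close> multiplies the wave by cis pi = -1, so its
    integral is its own negative.\<close>
  define h where "h = (axis j (pi / of_int (k $ j)) :: real^'n)"
  have "freq k \<bullet> h = pi" using j by (simp add: h_def inner_axis freq_def)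
  have "(LINT x|torus. cis (freq k \<bullet> x)) = (LINT x|torus. cis (freq k \<bullet> (x + h)))"
    by (intro integral_torus_shift[symmetric] torus_periodic_cis) (auto intro!: continuous_intros continuous_on_cis)
  also have "\<dots> = (LINT x|torus. - cis (freq k \<bullet> x))"
    using \<open>freq k \<bullet> h = pi\<close> by (simp add: inner_add_right cis_mult[symmetric])
  also have "\<dots> = - (LINT x|torus. cis (freq k \<bullet> x))" by simp
  finally show ?thesis using False by (simp add: equation_minus_iff)
qed

lemma freq_add: "freq (k + l) = freq k + freq l"
  and freq_diff: "freq (k - l) = freq k - freq l"
  and freq_uminus: "freq (- k) = - freq k"
  and freq_zero: "freq 0 = 0"
  by (simp_all add: freq_def vec_eq_iff)

section \<open>Density of trigonometric polynomials\<close>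

text \<open>The free phase \<open>b\<close> covers sines and makes products of two waves sums of waves.\<close>

inductive trig_poly :: "(real ^ 'n \<Rightarrow> real) \<Rightarrow> bool" where
  wave: "trig_poly (\<lambda>x. a * cos (freq k \<bullet> x + b))"
| add: "trig_poly f \<Longrightarrow> trig_poly g \<Longrightarrow> trig_poly (\<lambda>x. f x + g x)"

lemma trig_poly_mult:
  assumes "trig_poly f" "trig_poly g"
  shows "trig_poly (\<lambda>x. f x * g x)"
  using assms(1)
proof (induction rule: trig_poly.induct)
  case (wave a k b)
  show ?case using assms(2)
  proof (induction rule: trig_poly.induct)
    case (wave c l d)
    have "(\<lambda>x. a * cos (freq k \<bullet> x + b) * (c * cos (freq l \<bullet> x + d))) =
      (\<lambda>x. (a * c / 2) * cos (freq (k - l) \<bullet> x + (b - d)) + (a * c / 2) * cos (freq (k + l) \<bullet> x + (b + d)))"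
    proof
      fix x :: "real^'a"
      have "(freq k \<bullet> x + b) - (freq l \<bullet> x + d) = freq (k - l) \<bullet> x + (b - d)"
        "(freq k \<bullet> x + b) + (freq l \<bullet> x + d) = freq (k + l) \<bullet> x + (b + d)"
        by (simp_all add: freq_add freq_diff inner_diff_left inner_add_left)
      then have "cos (freq k \<bullet> x + b) * cos (freq l \<bullet> x + d) =
          (cos (freq (k - l) \<bullet> x + (b - d)) + cos (freq (k + l) \<bullet> x + (b + d))) / 2"
        by (simp only: cos_times_cos)
      then show "a * cos (freq k \<bullet> x + b) * (c * cos (freq l \<bullet> x + d)) =
        (a * c / 2) * cos (freq (k - l) \<bullet> x + (b - d)) + (a * c / 2) * cos (freq (k + l) \<bullet> x + (b + d))"
        by (simp add: field_simps)
    qed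
    then show ?case by (simp only: trig_poly.intros)
  next
    case (add f g)
    then show ?case using trig_poly.add by (simp add: distrib_left)
  qed
next
  case (add f g)
  then show ?case using trig_poly.add by (simp add: distrib_right)
qed

lemma trig_poly_const: "trig_poly (\<lambda>x::real^'n. c)"
  using trig_poly.wave[of c 0 0] by (simp add: freq_zero)

lemma trig_poly_continuous: "trig_poly f \<Longrightarrow> continuous_on S f"
  by (induction rule: trig_poly.induct) (auto intro!: continuous_intros)

text \<open>Stone-Weierstrass on the compact image of \<open>\<phi>\<close>, the embedding x -> (cis
  x_j)_j of the torus into C^d. There \<open>G\<close> becomes a continuous function
  \<open>f\<close>, and the functions that pull back to trigonometric polynomials form a
  point-separating ring.\<close>

lemma trig_poly_dense:
  fixes G :: "real ^ 'n \<Rightarrow> real"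
  assumes G: "continuous_on UNIV G" "torus_periodic G" and "e > 0"
  obtains P where "trig_poly P" "\<And>x. \<bar>G x - P x\<bar> < e"
proof -
  define \<phi> :: "real^'n \<Rightarrow> complex^'n" where "\<phi> x = (\<chi> j. cis (x $ j))" for x
  let ?C = "cbox (0::real^'n) (\<chi> j. 2 * pi)"
  have cont: "continuous_on A \<phi>" for A
    unfolding \<phi>_def by (intro continuous_intros)
  have \<phi>_eq: "\<exists>k. x = y + (2 * pi) *\<^sub>R freq k" if "\<phi> x = \<phi> y" for x y
  proof -
    have "\<exists>n::int. x $ j = y $ j + 2 * pi * n" for j
    proof -
      have "cis (x $ j) = cis (y $ j)" using that by (simp add: \<phi>_def vec_eq_iff)
      then show ?thesis by (subst sin_cos_eq_iff[symmetric]) (simp add: complex_eq_iff)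
    qed
    then obtain n :: "'n \<Rightarrow> int" where "\<And>j. x $ j = y $ j + 2 * pi * n j" by metis
    then have "x = y + (2 * pi) *\<^sub>R freq (\<chi> j. n j)"
      by (simp add: vec_eq_iff freq_def)
    then show ?thesis by blast
  qed
  have \<phi>_per: "\<phi> (x + (2 * pi) *\<^sub>R freq k) = \<phi> x" for x k
    using cis_multiple_2pi by (simp add: \<phi>_def vec_eq_iff freq_def cis_mult[symmetric])
  have range: "range \<phi> = \<phi> ` ?C"
  proof
    show "range \<phi> \<subseteq> \<phi> ` ?C"
    proof (rule image_subsetI)
      fix x
      obtain k where "x + (2 * pi) *\<^sub>R freq k \<in> ?C" by (rule torus_cell_representative)
      then show "\<phi> x \<in> \<phi> ` ?C" using \<phi>_per[of x k] by (metis image_eqI)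
    qed
  qed blast
  \<comment> \<open>Any preimage may be chosen: points with the same image differ by a lattice
    vector, over which \<open>G\<close> is periodic.\<close>
  define f where "f z = G (SOME x. \<phi> x = z)" for z
  have f: "f (\<phi> x) = G x" for x
  proof -
    have "\<phi> (SOME y. \<phi> y = \<phi> x) = \<phi> x" by (rule someI_ex) blast
    then show ?thesis unfolding f_def using \<phi>_eq torus_periodic_freq[OF G(2)] by metis
  qed
  \<comment> \<open>By compactness \<open>\<phi>\<close> maps closed subsets of the cell to closed
    sets, so continuity passes from \<open>G\<close> to the quotient function
    \<open>f\<close>.\<close>
  have fcont: "continuous_on (range \<phi>) f"
    unfolding continuous_on_closed_invariant
  proof (intro allI impI)
    fix B :: "real set" assume "closed B"
    then have "closed (G -` B)"
      using G(1) by (simp add: continuous_closed_vimage continuous_on_eq_continuous_at)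
    then have "compact (?C \<inter> G -` B)" by (intro compact_Int_closed) auto
    then have "closed (\<phi> ` (?C \<inter> G -` B))"
      by (intro compact_imp_closed compact_continuous_image cont)
    moreover have "\<phi> ` (?C \<inter> G -` B) \<inter> range \<phi> = f -` B \<inter> range \<phi>"
      using f range by auto
    ultimately show "\<exists>A. closed A \<and> A \<inter> range \<phi> = f -` B \<inter> range \<phi>" by blast
  qed
  define R where "R = {g. continuous_on (range \<phi>) g \<and> trig_poly (g \<circ> \<phi>)}"
  interpret function_ring_on R "range \<phi>"
  proof
    show "compact (range \<phi>)"
      unfolding range by (intro compact_continuous_image cont) auto
  next
    fix g assume "g \<in> R" then show "continuous_on (range \<phi>) g" by (simp add: R_def)
  next
    fix g h assume "g \<in> R" "h \<in> R"
    then show "(\<lambda>x. g x + h x) \<in> R" "(\<lambda>x. g x * h x) \<in> R"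
      by (auto simp: R_def comp_def intro!: continuous_intros trig_poly.add trig_poly_mult)
  next
    fix c show "(\<lambda>_. c) \<in> R" by (simp add: R_def comp_def trig_poly_const)
  next
    fix z w assume "z \<in> range \<phi>" "w \<in> range \<phi>" "z \<noteq> w"
    then obtain j where j: "z $ j \<noteq> w $ j" by (auto simp: vec_eq_iff)
    have wav: "(\<lambda>z. Re (cis b * z $ j)) \<in> R" for b
    proof -
      have "freq (axis j 1) \<bullet> x = x $ j" for x :: "real^'n"
      proof -
        have "freq (axis j 1) = (axis j 1 :: real^'n)" by (simp add: freq_def axis_def vec_eq_iff)
        then show ?thesis by (simp add: inner_axis')
      qed
      then have "trig_poly (\<lambda>x. Re (cis b * \<phi> x $ j))"
        using trig_poly.wave[of 1 "axis j 1" b] by (simp add: \<phi>_def cis_mult add.commute)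
      then show ?thesis by (auto simp: R_def comp_def intro!: continuous_intros)
    qed
    \<comment> \<open>Multiplication by cis (-pi/2) turns an imaginary part into a real part, so the
      phases 0 and -pi/2 together read off both coordinates of z_j.\<close>
    have "Re (z $ j) \<noteq> Re (w $ j) \<or> Re (cis (-pi/2) * z $ j) \<noteq> Re (cis (-pi/2) * w $ j)"
      using j by (auto simp: complex_eq_iff)
    then show "\<exists>g\<in>R. g z \<noteq> g w"
    proof
      assume "Re (z $ j) \<noteq> Re (w $ j)"
      then show ?thesis by (intro bexI[OF _ wav[of 0]]) simp
    next
      assume "Re (cis (-pi/2) * z $ j) \<noteq> Re (cis (-pi/2) * w $ j)"
      then show ?thesis by (rule bexI[OF _ wav[of "-pi/2"]])
    qed
  qed
  obtain g where g: "g \<in> R" "\<forall>z\<in>range \<phi>. \<bar>f z - g z\<bar> < e"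
    using Stone_Weierstrass_basic[OF fcont \<open>e > 0\<close>] by blast
  show ?thesis
  proof (rule that[of "g \<circ> \<phi>"])
    show "trig_poly (g \<circ> \<phi>)" using g(1) by (simp add: R_def)
    show "\<bar>G x - (g \<circ> \<phi>) x\<bar> < e" for x
    proof -
      have "\<bar>f (\<phi> x) - g (\<phi> x)\<bar> < e" using g(2) by blast
      then show ?thesis by (simp add: f)
    qed
  qed
qed

section \<open>Fourier coefficients and their uniqueness\<close>

lemma integrable_cis_mult:
  fixes h :: "real ^ 'n \<Rightarrow> real"
  assumes "integrable torus h"
  shows "integrable torus (\<lambda>x. complex_of_real (h x) * cis (c * (freq k \<bullet> x) + b))"
proof -
  have "integrable torus (\<lambda>x. cis (c * (freq k \<bullet> x) + b) * complex_of_real (h x))"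
    using assms by (intro integrable_mult_continuous_torus) (auto intro!: continuous_intros)
  then show ?thesis by (simp add: mult.commute)
qed

lemma Re_of_real_mult: "Re (of_real c * z) = c * Re z"
  by simp

lemma integral_cis_fourier_coeff:
  fixes f :: "real ^ 'n \<Rightarrow> real"
  shows "(LINT x|torus. complex_of_real (f x) * cis (- (freq k \<bullet> x))) = (2 * pi) ^ CARD('n) * fourier_coeff f k"
  by (simp add: fourier_coeff_def)

lemma fourier_coeff_uminus: "fourier_coeff f (- k) = cnj (fourier_coeff f k)"
proof -
  have "cnj (LINT x|torus. complex_of_real (f x) * cis (- (freq k \<bullet> x))) =
      (LINT x|torus. cnj (complex_of_real (f x) * cis (- (freq k \<bullet> x))))"
    by (rule Bochner_Integration.integral_cnj[symmetric])
  also have "\<dots> = (LINT x|torus. complex_of_real (f x) * cis (- (freq (- k) \<bullet> x)))"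
    by (simp add: freq_uminus cis_cnj)
  finally show ?thesis
    unfolding fourier_coeff_def by simp
qed

lemma integral_cos_fourier_coeff:
  fixes h :: "real ^ 'n \<Rightarrow> real"
  assumes h: "integrable torus h"
  shows "(LINT x|torus. h x * cos (freq k \<bullet> x + b)) = (2 * pi) ^ CARD('n) * Re (cis b * cnj (fourier_coeff h k))"
proof -
  have "(LINT x|torus. h x * cos (freq k \<bullet> x + b)) = (LINT x|torus. Re (complex_of_real (h x) * cis (1 * (freq k \<bullet> x) + b)))"
    by simp
  also have "\<dots> = Re (LINT x|torus. complex_of_real (h x) * cis (1 * (freq k \<bullet> x) + b))"
    by (intro integral_Re integrable_cis_mult h)
  also have "(\<lambda>x. complex_of_real (h x) * cis (1 * (freq k \<bullet> x) + b)) = (\<lambda>x. cis b * (complex_of_real (h x) * cis (- (freq (- k) \<bullet> x))))"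
    by (simp add: fun_eq_iff cis_mult[symmetric] freq_uminus)
  also have "(LINT x|torus. cis b * (complex_of_real (h x) * cis (- (freq (- k) \<bullet> x)))) = cis b * ((2 * pi) ^ CARD('n) * fourier_coeff h (- k))"
    by (simp only: integral_mult_right_zero integral_cis_fourier_coeff)
  also have "cis b * ((2 * pi) ^ CARD('n) * fourier_coeff h (- k)) = of_real ((2 * pi) ^ CARD('n)) * (cis b * cnj (fourier_coeff h k))"
    by (simp only: fourier_coeff_uminus of_real_power of_real_mult of_real_numeral ac_simps)
  finally show ?thesis by (simp only: Re_of_real_mult) 
qed

text \<open>Vanishing coefficients annihilate all waves, hence trigonometric polynomials; uniform
  approximation of \<open>G\<close> within e costs at most e times the L1 norm of \<open>h\<close>.
  This weak form of uniqueness is what L2 representatives call for.\<close>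

lemma integral_eq_0_if_fourier_coeff_eq_0:
  fixes h G :: "real ^ 'n \<Rightarrow> real"
  assumes h: "integrable torus h" and 0: "\<And>k. fourier_coeff h k = 0"
    and G: "continuous_on UNIV G" "torus_periodic G"
  shows "(LINT x|torus. G x * h x) = 0"
proof -
  have P: "(LINT x|torus. P x * h x) = 0" if "trig_poly P" for P :: "real^'n \<Rightarrow> real"
    using that
  proof (induction rule: trig_poly.induct)
    case (wave a k b)
    have "(LINT x|torus. a * cos (freq k \<bullet> x + b) * h x) = (LINT x|torus. a * (h x * cos (freq k \<bullet> x + b)))"
      by (simp add: ac_simps)
    then show ?case by (simp add: integral_cos_fourier_coeff[OF h] 0)
  next
    case (add f g)
    then show ?case
      by (simp add: distrib_right integrable_mult_continuous_torus[OF trig_poly_continuous h])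
  qed
  define N where "N = (LINT x|torus. \<bar>h x\<bar>)"
  have N: "N \<ge> 0" by (simp add: N_def)
  have "\<bar>LINT x|torus. G x * h x\<bar> \<le> e * N" if "e > 0" for e
  proof -
    obtain P where P': "trig_poly P" "\<And>x. \<bar>G x - P x\<bar> < e"
      using trig_poly_dense[OF G \<open>e > 0\<close>] by blast
    note i = integrable_mult_continuous_torus[OF G(1) h] integrable_mult_continuous_torus[OF trig_poly_continuous[OF P'(1)] h]
    have "(LINT x|torus. G x * h x) = (LINT x|torus. G x * h x - P x * h x)"
      using i P[OF P'(1)] by simp
    also have "\<bar>\<dots>\<bar> \<le> (LINT x|torus. \<bar>G x * h x - P x * h x\<bar>)"
      by (rule integral_abs_bound)
    also have "\<dots> \<le> (LINT x|torus. e * \<bar>h x\<bar>)"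
    proof (rule integral_mono)
      show "\<bar>G x * h x - P x * h x\<bar> \<le> e * \<bar>h x\<bar>" for x
        using P'(2)[of x] by (simp add: left_diff_distrib[symmetric] abs_mult mult_right_mono)
    qed (use i h in auto)
    also have "\<dots> = e * N" by (simp add: N_def)
    finally show ?thesis .
  qed
  then have "\<bar>LINT x|torus. G x * h x\<bar> \<le> 0"
  proof (cases "N = 0")
    case False
    show ?thesis
    proof (rule field_le_epsilon)
      fix e :: real assume "e > 0"
      then show "\<bar>LINT x|torus. G x * h x\<bar> \<le> 0 + e"
        using \<open>\<And>e. e > 0 \<Longrightarrow> _ e\<close>[of "e / N"] False N by simp
    qed
  qed (metis mult_zero_right zero_less_one)
  then show ?thesis by simp
qed

lemma fourier_coeff_add:
  assumes "integrable torus f" "integrable torus g"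
  shows "fourier_coeff (\<lambda>x. f x + g x) k = fourier_coeff f k + fourier_coeff g k"
  using integrable_cis_mult[OF assms(1), of "-1" k 0] integrable_cis_mult[OF assms(2), of "-1" k 0]
  by (simp add: fourier_coeff_def distrib_right add_divide_distrib)

lemma fourier_coeff_diff:
  assumes "integrable torus f" "integrable torus g"
  shows "fourier_coeff (\<lambda>x. f x - g x) k = fourier_coeff f k - fourier_coeff g k"
  using integrable_cis_mult[OF assms(1), of "-1" k 0] integrable_cis_mult[OF assms(2), of "-1" k 0]
  by (simp add: fourier_coeff_def left_diff_distrib diff_divide_distrib)

lemma fourier_coeff_cmult: "fourier_coeff (\<lambda>x. c * f x) k = of_real c * fourier_coeff f k"
  by (simp add: fourier_coeff_def mult.assoc)

lemma integrable_torus_L2: "torus_L2 f \<Longrightarrow> integrable torus f"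
  unfolding torus_L2_def by (blast intro: torus.square_integrable_imp_integrable)

lemma torus_L2_continuous:
  assumes "continuous_on UNIV f" "torus_periodic f"
  shows "torus_L2 f"
  unfolding torus_L2_def
  using assms by (auto intro!: continuous_measurable_torus integrable_continuous_torus continuous_intros)

section \<open>Absolutely convergent Fourier series\<close>

text \<open>Real parts are taken termwise, so the value is real by construction; for Hermitian
  coefficients, a(-k) = cnj (a(k)), this is the usual complex series.\<close>

definition fourier_series :: "(int ^ 'n \<Rightarrow> complex) \<Rightarrow> real ^ 'n \<Rightarrow> real" where
  "fourier_series a x = (\<Sum>\<^sub>\<infinity>k. Re (a k * cis (freq k \<bullet> x)))"

lemma abs_Re_cis_le: "\<bar>Re (z * cis t)\<bar> \<le> cmod z"
  using abs_Re_le_cmod[of "z * cis t"] by (simp add: norm_mult)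

lemma fourier_series_has_sum:
  assumes "(\<lambda>k. cmod (a k)) summable_on UNIV"
  shows "((\<lambda>k. Re (a k * cis (freq k \<bullet> x))) has_sum fourier_series a x) UNIV"
  unfolding fourier_series_def
  by (rule has_sum_infsum[OF abs_summable_summable[OF Infinite_Sum.abs_summable_on_comparison_test'[OF assms]]])
    (simp only: real_norm_def abs_Re_cis_le)

lemma fourier_series_uniform_limit:
  assumes "(\<lambda>k. cmod (a k)) summable_on UNIV"
  shows "uniform_limit UNIV (\<lambda>K x. \<Sum>k\<in>K. Re (a k * cis (freq k \<bullet> x))) (fourier_series a) (finite_subsets_at_top UNIV)"
  unfolding fourier_series_def
  by (rule Weierstrass_m_test_general[OF _ assms]) (simp only: real_norm_def abs_Re_cis_le)

lemma fourier_series_continuous: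
  assumes "(\<lambda>k. cmod (a k)) summable_on UNIV"
  shows "continuous_on S (fourier_series a)"
proof (rule continuous_on_subset[OF uniform_limit_theorem[OF _ fourier_series_uniform_limit[OF assms]]])
  show "\<forall>\<^sub>F K in finite_subsets_at_top UNIV. continuous_on UNIV (\<lambda>x. \<Sum>k\<in>K. Re (a k * cis (freq k \<bullet> x)))"
    by (intro always_eventually allI) (auto intro!: continuous_intros)
qed auto

lemma fourier_series_periodic: "torus_periodic (fourier_series a)"
  unfolding fourier_series_def
  by (intro torus_periodic_comp[where f="\<lambda>x. \<lambda>k. cis (freq k \<bullet> x)" and h="\<lambda>c. \<Sum>\<^sub>\<infinity>k. Re (a k * c k)"])
    (use torus_periodic_cis in \<open>auto simp: torus_periodic_def\<close>)

lemma fourier_series_bound: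
  assumes "(\<lambda>k. cmod (a k)) summable_on UNIV"
  shows "\<bar>fourier_series a x\<bar> \<le> (\<Sum>\<^sub>\<infinity>k. cmod (a k))"
  using norm_infsum_le[OF fourier_series_has_sum[OF assms] has_sum_infsum[OF assms]] by (simp only: real_norm_def abs_Re_cis_le)

text \<open>Uniform convergence of the partial sums allows termwise integration against an L1
  function. Values in a Banach space let the same lemma serve real \<open>h\<close> and complex
  waves.\<close>

lemma integral_fourier_series_mult:
  fixes h :: "real ^ 'n \<Rightarrow> 'b::{banach, second_countable_topology}"
  assumes a: "(\<lambda>k. cmod (a k)) summable_on UNIV" and h: "integrable torus h"
  shows "((\<lambda>k. LINT x|torus. Re (a k * cis (freq k \<bullet> x)) *\<^sub>R h x) has_sum (LINT x|torus. fourier_series a x *\<^sub>R h x)) UNIV"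
proof -
  have int: "integrable torus (\<lambda>x. g x *\<^sub>R h x)" if g: "continuous_on UNIV g" "\<And>x. \<bar>g x\<bar> \<le> B" for g :: "real^'n \<Rightarrow> real" and B
  proof (rule Bochner_Integration.integrable_bound)
    show "integrable torus (\<lambda>x. B * norm (h x))" using h by auto
    show "(\<lambda>x. g x *\<^sub>R h x) \<in> borel_measurable torus"
      using continuous_measurable_torus[OF g(1)] h by auto
    show "AE x in torus. norm (g x *\<^sub>R h x) \<le> norm (B * norm (h x))"
      using g(2) by (auto simp: abs_mult intro!: mult_right_mono order_trans[OF _ abs_ge_self])
  qed
  have i1: "integrable torus (\<lambda>x. Re (a k * cis (freq k \<bullet> x)) *\<^sub>R h x)" for k
    by (rule int[of _ "cmod (a k)"]) (intro continuous_intros abs_Re_cis_le)+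
  have i2: "integrable torus (\<lambda>x. fourier_series a x *\<^sub>R h x)"
    by (rule int[OF fourier_series_continuous[OF a] fourier_series_bound[OF a]])
  define N where "N = (LINT x|torus. norm (h x))"
  have N: "N \<ge> 0" by (simp add: N_def)
  show ?thesis
    unfolding has_sum_def
  proof (rule tendstoI)
    fix e :: real assume "e > 0"
    \<comment> \<open>Dividing by N + 1 covers a vanishing L1 norm and keeps the final inequality
      strict.\<close>
    then have "e / (N + 1) > 0" using N by simp
    then have "\<forall>\<^sub>F K in finite_subsets_at_top UNIV. \<forall>x. dist (\<Sum>k\<in>K. Re (a k * cis (freq k \<bullet> x))) (fourier_series a x) < e / (N + 1)"
      using uniform_limitD[OF fourier_series_uniform_limit[OF a]] by simp
    then show "\<forall>\<^sub>F K in finite_subsets_at_top UNIV. dist (\<Sum>k\<in>K. LINT x|torus. Re (a k * cis (freq k \<bullet> x)) *\<^sub>R h x) (LINT x|torus. fourier_series a x *\<^sub>R h x) < e"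
    proof eventually_elim
      case (elim K)
      let ?s = "\<lambda>x. \<Sum>k\<in>K. Re (a k * cis (freq k \<bullet> x))"
      have isum: "integrable torus (\<lambda>x. ?s x *\<^sub>R h x)"
        using i1 by (simp only: scaleR_sum_left) (rule Bochner_Integration.integrable_sum)
      have "(\<Sum>k\<in>K. LINT x|torus. Re (a k * cis (freq k \<bullet> x)) *\<^sub>R h x) = (LINT x|torus. ?s x *\<^sub>R h x)"
        using i1 by (simp only: scaleR_sum_left Bochner_Integration.integral_sum)
      then have "dist (\<Sum>k\<in>K. LINT x|torus. Re (a k * cis (freq k \<bullet> x)) *\<^sub>R h x) (LINT x|torus. fourier_series a x *\<^sub>R h x) = norm (LINT x|torus. ?s x *\<^sub>R h x - fourier_series a x *\<^sub>R h x)"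
        using isum i2 by (simp add: dist_norm)
      also have "\<dots> \<le> (LINT x|torus. e / (N + 1) * norm (h x))"
      proof (rule Bochner_Integration.integral_norm_bound_integral)
        show "norm (?s x *\<^sub>R h x - fourier_series a x *\<^sub>R h x) \<le> e / (N + 1) * norm (h x)" for x
          using elim[rule_format, of x] by (simp only: scaleR_diff_left[symmetric] norm_scaleR dist_norm real_norm_def) (intro mult_right_mono, auto)
      qed (use isum i2 h in auto)
      also have "\<dots> = e * (N / (N + 1))" by (simp add: N_def)
      also have "\<dots> < e * 1" using \<open>e > 0\<close> N by (intro mult_strict_left_mono) auto
      finally show ?case by simp
    qed
  qed
qed

lemma integral_fourier_series:
  fixes h :: "real ^ 'n \<Rightarrow> real"
  assumes a: "(\<lambda>k. cmod (a k)) summable_on UNIV" and h: "integrable torus h"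
  shows "((\<lambda>k. (2 * pi) ^ CARD('n) * Re (a k * cnj (fourier_coeff h k))) has_sum (LINT x|torus. fourier_series a x * h x)) UNIV"
proof -
  have "(LINT x|torus. Re (a k * cis (freq k \<bullet> x)) * h x) = (2 * pi) ^ CARD('n) * Re (a k * cnj (fourier_coeff h k))" for k
  proof -
    have "Re (a k * cis (freq k \<bullet> x)) * h x = cmod (a k) * (h x * cos (freq k \<bullet> x + Arg (a k)))" for x
    proof -
      have "a k * cis (freq k \<bullet> x) = of_real (cmod (a k)) * cis (freq k \<bullet> x + Arg (a k))"
        by (metis cis_mult mult.assoc mult.commute rcis_cmod_Arg rcis_def)
      then show ?thesis by simp
    qed
    then have "(LINT x|torus. Re (a k * cis (freq k \<bullet> x)) * h x) = cmod (a k) * ((2 * pi) ^ CARD('n) * Re (cis (Arg (a k)) * cnj (fourier_coeff h k)))"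
      by (simp only: integral_mult_right_zero integral_cos_fourier_coeff[OF h])
    also have "\<dots> = (2 * pi) ^ CARD('n) * Re (of_real (cmod (a k)) * cis (Arg (a k)) * cnj (fourier_coeff h k))"
      unfolding mult.assoc Re_of_real_mult by (rule mult.left_commute)
    also have "of_real (cmod (a k)) * cis (Arg (a k)) = a k"
      using rcis_cmod_Arg[of "a k"] by (simp add: rcis_def)
    finally show ?thesis .
  qed
  then show ?thesis using integral_fourier_series_mult[OF a h] by simp
qed

text \<open>The real part splits the term of index \<open>k\<close> into half a wave of frequency
  \<open>k\<close> and half a wave of frequency \<open>- k\<close>. Coefficient \<open>l\<close>
  collects one half from k = l and one from k = -l; Hermitian symmetry makes the halves equal, and
  at l = 0 both come from the same index.\<close>

lemma fourier_coeff_fourier_series: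
  fixes a :: "int ^ 'n \<Rightarrow> complex"
  assumes a: "(\<lambda>k. cmod (a k)) summable_on UNIV" and herm: "\<And>k. a (- k) = cnj (a k)"
  shows "fourier_coeff (fourier_series a) l = a l"
proof -
  let ?V = "(2 * pi) ^ CARD('n)"
  have "(LINT x|torus. Re (a k * cis (freq k \<bullet> x)) *\<^sub>R cis (- (freq l \<bullet> x))) =
      (if k = l then ?V * a l / 2 else 0) + (if k = - l then ?V * a l / 2 else 0)" for k
  proof -
    have "Re (a k * cis (freq k \<bullet> x)) *\<^sub>R cis (- (freq l \<bullet> x)) =
       (a k / 2) * cis (freq (k - l) \<bullet> x) + (cnj (a k) / 2) * cis (freq (- k - l) \<bullet> x)" for x
    proof -
      have "of_real (Re z) = (z + cnj z) / 2" for z by (simp add: complex_add_cnj)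
      then have "Re (a k * cis (freq k \<bullet> x)) *\<^sub>R cis (- (freq l \<bullet> x)) =
         (a k * cis (freq k \<bullet> x) + cnj (a k) * cis (- (freq k \<bullet> x))) / 2 * cis (- (freq l \<bullet> x))"
        by (simp only: scaleR_conv_of_real complex_cnj_mult cis_cnj)
      also have "\<dots> = (a k / 2) * (cis (freq k \<bullet> x) * cis (- (freq l \<bullet> x))) + (cnj (a k) / 2) * (cis (- (freq k \<bullet> x)) * cis (- (freq l \<bullet> x)))"
        by (simp add: field_simps)
      finally show ?thesis
        by (simp only: cis_mult freq_diff freq_uminus inner_diff_left inner_minus_left) simp
    qed
    then have "(LINT x|torus. Re (a k * cis (freq k \<bullet> x)) *\<^sub>R cis (- (freq l \<bullet> x))) =
      (LINT x|torus. (a k / 2) * cis (freq (k - l) \<bullet> x) + (cnj (a k) / 2) * cis (freq (- k - l) \<bullet> x))"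
      by (simp only:)
    also have "\<dots> = (LINT x|torus. (a k / 2) * cis (freq (k - l) \<bullet> x)) + (LINT x|torus. (cnj (a k) / 2) * cis (freq (- k - l) \<bullet> x))"
      by (intro Bochner_Integration.integral_add integrable_continuous_torus continuous_intros)
    also have "\<dots> = (a k / 2) * (if k - l = 0 then ?V else 0) + (cnj (a k) / 2) * (if - k - l = 0 then ?V else 0)"
      by (simp only: integral_mult_right_zero integral_torus_cis)
    finally have "(LINT x|torus. Re (a k * cis (freq k \<bullet> x)) *\<^sub>R cis (- (freq l \<bullet> x))) =
      (a k / 2) * (if k - l = 0 then ?V else 0) + (cnj (a k) / 2) * (if - k - l = 0 then ?V else 0)" .
    moreover have "(a k / 2) * (if k - l = 0 then ?V else 0) = (if k = l then ?V * a l / 2 else 0)" for k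
      by simp
    moreover have "(cnj (a k) / 2) * (if - k - l = 0 then ?V else 0) = (if k = - l then ?V * a l / 2 else 0)"
    proof -
      have "- k - l = 0 \<longleftrightarrow> k = - l" by auto
      then show ?thesis by (simp add: herm)
    qed
    ultimately show ?thesis by (simp only:)
  qed
  then have "((\<lambda>k. (if k = l then ?V * a l / 2 else 0) + (if k = - l then ?V * a l / 2 else 0)) has_sum
      (LINT x|torus. fourier_series a x *\<^sub>R cis (- (freq l \<bullet> x)))) UNIV"
    using integral_fourier_series_mult[OF a, of "\<lambda>x. cis (- (freq l \<bullet> x))"]
    by (simp add: integrable_continuous_torus continuous_on_cis continuous_on_inner continuous_on_minus)
  moreover have "((\<lambda>k. (if k = l' then c else 0)) has_sum c) UNIV" for l' :: "int^'n" and c :: complex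
    by (rule has_sum_finite_neutralI[of "{l'}"]) auto
  from has_sum_add[OF this this]
  have "((\<lambda>k. (if k = l then ?V * a l / 2 else 0) + (if k = - l then ?V * a l / 2 else 0)) has_sum
      (?V * a l / 2 + ?V * a l / 2)) UNIV" .
  ultimately have "(LINT x|torus. fourier_series a x *\<^sub>R cis (- (freq l \<bullet> x))) = ?V * a l / 2 + ?V * a l / 2"
    by (rule has_sum_unique)
  then show ?thesis by (simp add: fourier_coeff_def scaleR_conv_of_real)
qed

text \<open>The good set is closed and misses only a null set, so it contains the open box and then
  its closure, the cell. Bounds almost everywhere become bounds at every point, boundary
  included.\<close>

lemma AE_torus_continuous_le:
  fixes f :: "real ^ 'n \<Rightarrow> real"
  assumes f: "continuous_on UNIV f" and ae: "AE x in torus. f x \<le> c" and x: "x \<in> cbox 0 (\<chi> j. 2 * pi)"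
  shows "f x \<le> c"
proof -
  let ?B = "box (0::real^'n) (\<chi> j. 2 * pi)"
  have cl: "closed {x. f x \<le> c}" by (intro closed_Collect_le f continuous_intros)
  have "AE x in lborel. x \<in> cbox 0 (\<chi> j. 2 * pi) \<longrightarrow> f x \<le> c"
    using ae unfolding torus_def by (subst (asm) AE_restrict_space_iff) auto
  then have "AE x in lebesgue. x \<in> cbox 0 (\<chi> j. 2 * pi) \<longrightarrow> f x \<le> c"
    by (rule AE_completion)
  then have "AE x \<in> ?B in lebesgue. x \<in> {x. f x \<le> c}"
    by eventually_elim (use box_subset_cbox in blast)
  then have "?B \<subseteq> {x. f x \<le> c}"
    using mem_closed_if_AE_lebesgue_open[OF open_box cl] by blast
  then have "closure ?B \<subseteq> {x. f x \<le> c}" using cl by (rule closure_minimal)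
  moreover have "closure ?B = cbox 0 (\<chi> j. 2 * pi)"
    by (intro closure_box) (auto simp: interval_ne_empty_cart)
  ultimately show ?thesis using x by auto
qed

text \<open>The difference \<open>d\<close> of both sides is continuous with vanishing coefficients.
  Pairing \<open>d\<close> with itself gives zero, and continuity turns zero almost everywhere into
  zero.\<close>

lemma fourier_series_inversion:
  fixes f :: "real ^ 'n \<Rightarrow> real"
  assumes f: "continuous_on UNIV f" "torus_periodic f"
    and s: "(\<lambda>k. cmod (fourier_coeff f k)) summable_on UNIV"
  shows "fourier_series (fourier_coeff f) = f"
proof
  fix x
  define d where "d = (\<lambda>x. f x - fourier_series (fourier_coeff f) x)"
  note c = fourier_series_continuous[OF s]
  have d: "continuous_on UNIV d" "torus_periodic d"
    unfolding d_def using torus_periodic_comp2[OF f(2) fourier_series_periodic, of "(-)"]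
    by (auto intro!: continuous_on_diff f c)
  have "fourier_coeff d k = 0" for k
    unfolding d_def
    by (subst fourier_coeff_diff) (auto simp: integrable_continuous_torus f c fourier_coeff_fourier_series[OF s] fourier_coeff_uminus)
  then have "(LINT x|torus. d x * d x) = 0"
    using integral_eq_0_if_fourier_coeff_eq_0[OF integrable_continuous_torus[OF d(1)] _ d] by simp
  then have "AE x in torus. d x * d x = 0"
    by (subst (asm) integral_nonneg_eq_0_iff_AE) (intro integrable_continuous_torus continuous_on_mult d | simp)+
  then have "AE x in torus. d x * d x \<le> 0" by eventually_elim simp
  then have "d x * d x \<le> 0" if "x \<in> cbox 0 (\<chi> j. 2 * pi)" for x
    using AE_torus_continuous_le[of "\<lambda>x. d x * d x" 0 x, OF continuous_on_mult[OF d(1) d(1)]] that by blast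
  then have "d x * d x \<le> 0" for x
    using torus_periodic_bound[OF d(2), of "\<lambda>y. y * y \<le> 0"] by blast
  then have "d x * d x = 0" by (intro order_antisym) auto
  then have "d x = 0" by simp
  then show "fourier_series (fourier_coeff f) x = f x" by (simp add: d_def)
qed

text \<open>Expand the nonnegative integral of |f - P|^2, with \<open>P\<close> the partial sum over
  \<open>K\<close>. The mixed term and the square of \<open>P\<close> both reduce to the left-hand
  side, counted -2 times and once.\<close>

lemma bessel_finite:
  fixes f :: "real ^ 'n \<Rightarrow> real"
  assumes f: "torus_L2 f" and K: "finite K"
  shows "(2 * pi) ^ CARD('n) * (\<Sum>k\<in>K. (cmod (fourier_coeff f k))\<^sup>2) \<le> (LINT x|torus. (f x)\<^sup>2)"
proof -
  let ?V = "(2 * pi) ^ CARD('n) :: real" and ?a = "fourier_coeff f"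
  let ?P = "\<lambda>x. \<Sum>k\<in>K. ?a k * cis (freq k \<bullet> x)"
  have fi: "integrable torus f" "integrable torus (\<lambda>x. (f x)\<^sup>2)"
    using f integrable_torus_L2 by (auto simp: torus_L2_def)
  have i1: "integrable torus (\<lambda>x. cnj (?a k) * (complex_of_real (f x) * cis (- (freq k \<bullet> x))))" for k
    using integrable_cis_mult[OF fi(1), of "-1" k 0] by (intro integrable_mult_right) simp
  have i2: "integrable torus (\<lambda>x. ?a k * cnj (?a l) * cis (freq (k - l) \<bullet> x))" for k l
    by (intro integrable_continuous_torus continuous_intros)
  have e1: "complex_of_real (f x) * cnj (?P x) = (\<Sum>k\<in>K. cnj (?a k) * (complex_of_real (f x) * cis (- (freq k \<bullet> x))))" for x
    by (simp add: sum_distrib_left cis_cnj ac_simps)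
  have e2: "?P x * cnj (?P x) = (\<Sum>k\<in>K. \<Sum>l\<in>K. ?a k * cnj (?a l) * cis (freq (k - l) \<bullet> x))" for x
  proof -
    have "?P x * cnj (?P x) = (\<Sum>k\<in>K. \<Sum>l\<in>K. ?a k * cis (freq k \<bullet> x) * (cnj (?a l) * cis (- (freq l \<bullet> x))))"
      by (simp add: sum_product cis_cnj)
    also have "\<dots> = (\<Sum>k\<in>K. \<Sum>l\<in>K. ?a k * cnj (?a l) * (cis (freq k \<bullet> x) * cis (- (freq l \<bullet> x))))"
      by (simp add: ac_simps)
    finally show ?thesis by (simp add: cis_mult freq_diff inner_diff_left)
  qed
  have I1: "(LINT x|torus. complex_of_real (f x) * cnj (?P x)) = of_real (?V * (\<Sum>k\<in>K. (cmod (?a k))\<^sup>2))"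
    unfolding e1 using i1
    by (simp only: Bochner_Integration.integral_sum integral_mult_right_zero integral_cis_fourier_coeff)
      (simp add: sum_distrib_left complex_norm_square ac_simps del: of_real_power)
  have I2: "(LINT x|torus. ?P x * cnj (?P x)) = of_real (?V * (\<Sum>k\<in>K. (cmod (?a k))\<^sup>2))"
  proof -
    have "(LINT x|torus. ?P x * cnj (?P x)) = (\<Sum>k\<in>K. \<Sum>l\<in>K. ?a k * cnj (?a l) * (if k - l = 0 then ?V else 0))"
      unfolding e2 using i2
      by (simp only: Bochner_Integration.integral_sum Bochner_Integration.integrable_sum integral_mult_right_zero integral_torus_cis)
    also have "\<dots> = (\<Sum>k\<in>K. ?a k * cnj (?a k) * ?V)"
      using K by (intro sum.cong refl) (simp add: if_distrib[of of_real] if_distrib[of "(*) _"] cong: if_cong)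
    finally show ?thesis by (simp add: sum_distrib_left complex_norm_square ac_simps del: of_real_power)
  qed
  have j1: "integrable torus (\<lambda>x. complex_of_real (f x) * cnj (?P x))"
    unfolding e1 using i1 by (intro Bochner_Integration.integrable_sum)
  have j2: "integrable torus (\<lambda>x. ?P x * cnj (?P x))"
    unfolding e2 using i2 by (intro Bochner_Integration.integrable_sum)
  have pt: "(f x)\<^sup>2 - 2 * Re (complex_of_real (f x) * cnj (?P x)) + Re (?P x * cnj (?P x)) \<ge> 0" for x
  proof -
    define w where "w = ?P x"
    have "(f x)\<^sup>2 - 2 * Re (complex_of_real (f x) * cnj w) + Re (w * cnj w) = (f x - Re w)\<^sup>2 + (Im w)\<^sup>2"
      by (simp add: power2_eq_square algebra_simps)
    also have "\<dots> \<ge> 0" by simp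
    finally show ?thesis unfolding w_def .
  qed
  have "0 \<le> (LINT x|torus. (f x)\<^sup>2 - 2 * Re (complex_of_real (f x) * cnj (?P x)) + Re (?P x * cnj (?P x)))"
    by (rule Bochner_Integration.integral_nonneg) (rule pt)
  also have "\<dots> = (LINT x|torus. (f x)\<^sup>2) - 2 * Re (LINT x|torus. complex_of_real (f x) * cnj (?P x)) + Re (LINT x|torus. ?P x * cnj (?P x))"
    using fi(2) j1 j2
    by (simp only: Bochner_Integration.integral_add Bochner_Integration.integral_diff integral_mult_right_zero integral_Re
        integrable_Re Bochner_Integration.integrable_diff integrable_mult_right)
  finally show ?thesis unfolding I1 I2 Re_complex_of_real by linarith
qed

section \<open>A Levy-Khintchine lower bound\<close>

text \<open>The standard Gaussian law on R^d, carried by functions of the index because product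
  measures live there; \<open>\<chi> j. z j\<close> turns a sample into a vector.\<close>

definition gauss :: "('n::finite \<Rightarrow> real) measure" where
  "gauss = PiM UNIV (\<lambda>_. std_normal_distribution)"

lemma prob_space_std_normal: "prob_space std_normal_distribution"
  using real_dist_normal_dist by (simp add: real_distribution_def)

lemma prob_space_gauss: "prob_space (gauss :: ('n::finite \<Rightarrow> real) measure)"
  unfolding gauss_def by (intro prob_space_PiM prob_space_std_normal)

lemma measurable_gauss_component[measurable]: "(\<lambda>z. z j) \<in> borel_measurable (gauss :: ('n::finite \<Rightarrow> real) measure)"
proof -
  have "(\<lambda>z. z j) \<in> measurable (PiM (UNIV :: 'n set) (\<lambda>_. std_normal_distribution)) std_normal_distribution"
    by (rule measurable_component_singleton) simp
  then show ?thesis unfolding gauss_def by (simp cong: measurable_cong_sets)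
qed

lemma measurable_gauss_vec[measurable]: "(\<lambda>z. \<chi> j. z j) \<in> borel_measurable (gauss :: ('n::finite \<Rightarrow> real) measure)"
  by (subst borel_measurable_euclidean_space) (auto simp: Basis_vec_def inner_axis)

lemma gauss_square:
  "integrable (gauss :: ('n::finite \<Rightarrow> real) measure) (\<lambda>z. (z j)\<^sup>2)"
  "(LINT z|(gauss :: ('n::finite \<Rightarrow> real) measure). (z j)\<^sup>2) = 1"
proof -
  have d: "distr (gauss :: ('n \<Rightarrow> real) measure) std_normal_distribution (\<lambda>z. z j) = std_normal_distribution"
    unfolding gauss_def by (rule distr_PiM_component) (auto simp: prob_space_std_normal)
  have m: "(\<lambda>z. z j) \<in> measurable (gauss :: ('n \<Rightarrow> real) measure) std_normal_distribution"
    using measurable_gauss_component by (simp cong: measurable_cong_sets)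
  have s: "(\<lambda>x::real. x\<^sup>2) \<in> borel_measurable std_normal_distribution" by simp
  have i: "integrable std_normal_distribution (\<lambda>x::real. x\<^sup>2)" "(LINT x|std_normal_distribution. x\<^sup>2) = 1"
    using std_normal_distribution_even_moments[of 1] by simp_all
  show "integrable (gauss :: ('n \<Rightarrow> real) measure) (\<lambda>z. (z j)\<^sup>2)"
    using integrable_distr_eq[OF m s] i d by simp
  show "(LINT z|(gauss :: ('n \<Rightarrow> real) measure). (z j)\<^sup>2) = 1"
    using integral_distr[OF m s] i d by simp
qed

text \<open>The characteristic function of independent coordinates is a product. At c = sqrt (2 t)
  the value is the heat multiplier exp (- t |k|^2).\<close>

lemma gauss_char:
  fixes k :: "real ^ 'n"
  shows "(LINT z|gauss. cos (c * (k \<bullet> (\<chi> j. z j)))) = exp (- (c\<^sup>2 * (norm k)\<^sup>2 / 2))"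
proof -
  interpret N: prob_space std_normal_distribution by (rule prob_space_std_normal)
  interpret product_sigma_finite "\<lambda>_::'n. std_normal_distribution"
    by standard
  have "(LINT z|gauss. cis (c * (k \<bullet> (\<chi> j. z j)))) = (LINT z|gauss. (\<Prod>j\<in>UNIV. cis (c * k $ j * z j)))"
    by (intro Bochner_Integration.integral_cong) (auto simp: inner_vec_def sum_distrib_left cis_conv_exp exp_sum[symmetric] mult.assoc)
  also have "\<dots> = (\<Prod>j\<in>UNIV. (LINT x|std_normal_distribution. cis (c * k $ j * x)))"
    unfolding gauss_def
  proof (rule product_integral_prod)
    show "integrable std_normal_distribution (\<lambda>x. cis (c * k $ j * x))" for j
      by (rule N.integrable_const_bound[where B=1]) (auto intro!: borel_measurable_continuous_onI continuous_intros)
  qed simp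
  also have "\<dots> = (\<Prod>j\<in>UNIV. char std_normal_distribution (c * k $ j))"
    by (simp add: char_def cis_conv_exp)
  also have "\<dots> = of_real (\<Prod>j\<in>UNIV. exp (- ((c * k $ j)\<^sup>2) / 2))"
    by (simp add: char_std_normal_distribution)
  also have "(\<Prod>j\<in>UNIV. exp (- ((c * k $ j)\<^sup>2) / 2)) = exp (\<Sum>j\<in>UNIV. - ((c * k $ j)\<^sup>2) / 2)"
    by (simp add: exp_sum)
  also have "(\<Sum>j\<in>UNIV. - ((c * k $ j)\<^sup>2) / 2) = - (c\<^sup>2 * (norm k)\<^sup>2 / 2)"
    by (simp add: norm_eq_sqrt_inner inner_vec_def sum_negf sum_divide_distrib[symmetric] sum_nonneg sum_distrib_left power2_eq_square ac_simps)
  finally have e: "(LINT z|gauss. cis (c * (k \<bullet> (\<chi> j. z j)))) = of_real (exp (- (c\<^sup>2 * (norm k)\<^sup>2 / 2)))" .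
  interpret G: prob_space "gauss :: ('n \<Rightarrow> real) measure" by (rule prob_space_gauss)
  have "integrable gauss (\<lambda>z. cis (c * (k \<bullet> (\<chi> j. z j))))"
    by (rule G.integrable_const_bound[where B=1]) (auto simp: cis_conv_exp)
  then have "(LINT z|gauss. Re (cis (c * (k \<bullet> (\<chi> j. z j))))) = Re (LINT z|gauss. cis (c * (k \<bullet> (\<chi> j. z j))))"
    by (rule integral_Re)
  then show ?thesis unfolding e by simp
qed

text \<open>The Levy density of \<open>|\<nabla>|^s\<close> behaves like |h|^(-d-s). The exponent
  5/4 exceeds every admissible s, which gives integrability at the origin even for s = 1; the cap at
  1 gives it at infinity. It is twice the exponent 5/8 of \<open>wiener_weight\<close>.\<close>

definition modulus :: "real ^ 'n \<Rightarrow> real" where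
  "modulus h = min 1 (norm h powr (5/4))"

lemma modulus_nonneg: "0 \<le> modulus h" and modulus_le_1: "modulus h \<le> 1"
  by (simp_all add: modulus_def)

lemma powr_54_le: "r \<ge> 0 \<Longrightarrow> r powr (5/4) \<le> 1 + r\<^sup>2" for r :: real
proof (cases "r \<le> 1")
  case True
  assume "r \<ge> 0"
  then have "r powr (5/4) \<le> 1" using True by (simp add: powr_le1)
  then show ?thesis by (smt (verit) zero_le_power2)
next
  case False
  then have "r powr (5/4) \<le> r powr 2" by (intro powr_mono) auto
  then show ?thesis using False by simp
qed

text \<open>Homogeneity extracts t^(5/8). Replacing the power 5/4 by 1 + r^2 leaves only second
  moments of the Gaussian to compute.\<close>

lemma modulus_scaled_le:
  fixes z :: "real ^ 'n"
  assumes t: "t > 0"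
  shows "modulus (sqrt (2 * t) *\<^sub>R z) \<le> t powr (5/8) * (1 + 2 * (norm z)\<^sup>2)"
proof -
  have "norm (sqrt (2 * t) *\<^sub>R z) = sqrt t * (sqrt 2 * norm z)"
    using t by (simp add: real_sqrt_mult)
  then have "norm (sqrt (2 * t) *\<^sub>R z) powr (5/4) = sqrt t powr (5/4) * (sqrt 2 * norm z) powr (5/4)"
    by (simp only: powr_mult)
  also have "sqrt t powr (5/4) = t powr (5/8)"
    using t by (simp add: powr_half_sqrt[symmetric] powr_powr)
  finally have e: "norm (sqrt (2 * t) *\<^sub>R z) powr (5/4) = t powr (5/8) * (sqrt 2 * norm z) powr (5/4)" .
  have "(sqrt 2 * norm z) powr (5/4) \<le> 1 + (sqrt 2 * norm z)\<^sup>2" by (rule powr_54_le) simp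
  also have "(sqrt 2 * norm z)\<^sup>2 = 2 * (norm z)\<^sup>2" by (simp add: power_mult_distrib)
  finally have "t powr (5/8) * (sqrt 2 * norm z) powr (5/4) \<le> t powr (5/8) * (1 + 2 * (norm z)\<^sup>2)"
    by (intro mult_left_mono) auto
  then show ?thesis unfolding modulus_def e by linarith
qed

text \<open>Average the hypothesis over h = sqrt (2 t) z with Gaussian z. The cosine averages to the
  heat multiplier; the modulus averages to at most 1 by its cap, and to at most (1 + 2 d) t^(5/8)
  because |z|^2 has mean d.\<close>

lemma heat_lower_bound:
  fixes \<beta> :: "int ^ 'n \<Rightarrow> real"
  assumes K: "finite K" and A: "A \<ge> 0" and t: "t > 0"
    and lb: "\<And>h. - A * modulus h \<le> (\<Sum>k\<in>K. \<beta> k * (1 - cos (freq k \<bullet> h)))"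
  shows "- A * min 1 ((1 + 2 * real CARD('n)) * t powr (5/8)) \<le> (\<Sum>k\<in>K. \<beta> k * (1 - exp (- t * (norm (freq k))\<^sup>2)))"
proof -
  interpret G: prob_space "gauss :: ('n \<Rightarrow> real) measure" by (rule prob_space_gauss)
  let ?z = "\<lambda>z. (\<chi> j. z j) :: real ^ 'n"
  have mm: "(\<lambda>z. modulus (sqrt (2 * t) *\<^sub>R ?z z)) \<in> borel_measurable gauss"
    unfolding modulus_def by measurable
  have im: "integrable gauss (\<lambda>z. modulus (sqrt (2 * t) *\<^sub>R ?z z))"
    by (rule G.integrable_const_bound[where B=1]) (simp_all add: mm modulus_nonneg modulus_le_1)
  have m1: "(LINT z|gauss. modulus (sqrt (2 * t) *\<^sub>R ?z z)) \<le> 1"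
    by (rule G.integral_le_const[OF im]) (simp add: modulus_le_1)
  have nz: "(norm (?z z))\<^sup>2 = (\<Sum>j\<in>UNIV. (z j)\<^sup>2)" for z
    by (simp add: norm_eq_sqrt_inner inner_vec_def sum_nonneg power2_eq_square)
  have m2: "(LINT z|gauss. modulus (sqrt (2 * t) *\<^sub>R ?z z)) \<le> (1 + 2 * real CARD('n)) * t powr (5/8)"
  proof -
    have i: "integrable gauss (\<lambda>z. t powr (5/8) * (1 + 2 * (norm (?z z))\<^sup>2))"
      unfolding nz by (intro integrable_mult_right Bochner_Integration.integrable_add Bochner_Integration.integrable_sum gauss_square) simp
    have "(LINT z|gauss. modulus (sqrt (2 * t) *\<^sub>R ?z z)) \<le> (LINT z|gauss. t powr (5/8) * (1 + 2 * (norm (?z z))\<^sup>2))"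
      by (rule integral_mono[OF im i]) (rule modulus_scaled_le[OF t])
    also have "\<dots> = t powr (5/8) * (1 + 2 * real CARD('n))"
      unfolding nz by (simp add: gauss_square Bochner_Integration.integral_sum Bochner_Integration.integrable_sum G.prob_space)
    finally show ?thesis by (simp add: mult.commute)
  qed
  have ic: "integrable gauss (\<lambda>z. cos (sqrt (2*t) * (freq k \<bullet> ?z z)))" for k :: "int ^ 'n"
    by (rule G.integrable_const_bound[where B=1]) auto
  have "- A * min 1 ((1 + 2 * real CARD('n)) * t powr (5/8)) \<le> - A * (LINT z|gauss. modulus (sqrt (2 * t) *\<^sub>R ?z z))"
    using m1 m2 A by (simp add: mult_left_mono)
  also have "\<dots> = (LINT z|gauss. - A * modulus (sqrt (2 * t) *\<^sub>R ?z z))" by simp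
  also have "\<dots> \<le> (LINT z|gauss. (\<Sum>k\<in>K. \<beta> k * (1 - cos (sqrt (2*t) * (freq k \<bullet> ?z z)))))"
  proof (rule integral_mono)
    show "integrable gauss (\<lambda>z. - A * modulus (sqrt (2 * t) *\<^sub>R ?z z))" using im by simp
    show "integrable gauss (\<lambda>z. \<Sum>k\<in>K. \<beta> k * (1 - cos (sqrt (2*t) * (freq k \<bullet> ?z z))))"
      using ic by (intro Bochner_Integration.integrable_sum integrable_mult_right Bochner_Integration.integrable_diff) auto
    show "- A * modulus (sqrt (2 * t) *\<^sub>R ?z z) \<le> (\<Sum>k\<in>K. \<beta> k * (1 - cos (sqrt (2*t) * (freq k \<bullet> ?z z))))" for z
      using lb[of "sqrt (2 * t) *\<^sub>R ?z z"] by simp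
  qed
  also have "\<dots> = (\<Sum>k\<in>K. \<beta> k * (1 - (LINT z|gauss. cos (sqrt (2*t) * (freq k \<bullet> ?z z)))))"
    using ic by (simp add: Bochner_Integration.integral_sum G.prob_space)
  also have "\<dots> = (\<Sum>k\<in>K. \<beta> k * (1 - exp (- t * (norm (freq k))\<^sup>2)))"
    using t by (simp add: gauss_char)
  finally show ?thesis .
qed

lemma powr_from_0:
  fixes a :: real
  assumes "a > - 1"
  shows "has_bochner_integral lborel (\<lambda>t. indicator {0..1} t * t powr a) (1 / (a + 1))"
proof (rule has_bochner_integral_nn_integral)
  show "(\<integral>\<^sup>+t. ennreal (indicat_real {0..1} t * t powr a) \<partial>lborel) = ennreal (1 / (a + 1))"
    using nn_integral_has_integral_lebesgue[OF _ has_integral_powr_from_0[OF assms, of 1]] by simp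
qed (use assms in auto)

lemma powr_to_inf:
  fixes a :: real
  assumes "a < - 1"
  shows "has_bochner_integral lborel (\<lambda>t. indicator {1..} t * t powr a) (- 1 / (a + 1))"
proof (rule has_bochner_integral_nn_integral)
  show "(\<integral>\<^sup>+t. ennreal (indicat_real {1..} t * t powr a) \<partial>lborel) = ennreal (- 1 / (a + 1))"
    using nn_integral_has_integral_lebesgue[OF _ has_integral_powr_to_inf[OF assms, of 1]] by simp
qed (use assms in \<open>auto simp: divide_simps\<close>)

text \<open>Subordination: \<open>|k|\<^sup>s\<close> is, up to a constant, the integral of \<open>1 - exp (- t |k|\<^sup>2)\<close> against
  \<open>t\<^sup>-\<^sup>1\<^sup>-\<^sup>\<sigma> dt\<close> with \<open>\<sigma> = s/2\<close>, and \<open>exp (- t |k|\<^sup>2)\<close> is the mean of \<open>cos (k \<bullet> h)\<close> over Gaussian \<open>h\<close> of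
  variance \<open>2 t\<close>.  So lower bounds for \<open>1 - cos (k \<bullet> h)\<close> pass to \<open>|k|\<^sup>s\<close>, uniformly in \<open>s\<close> since the
  constant is comparable to \<open>1/s\<close>.\<close>

definition subord :: "real \<Rightarrow> real \<Rightarrow> real \<Rightarrow> real" where
  "subord \<sigma> \<mu> t = indicator {0<..} t * ((1 - exp (- t * \<mu>)) * t powr (- 1 - \<sigma>))"

definition subord_const :: "real \<Rightarrow> real" where
  "subord_const \<sigma> = (LINT t|lborel. subord \<sigma> 1 t)"

lemma subord_measurable[measurable]: "subord \<sigma> \<mu> \<in> borel_measurable borel"
  unfolding subord_def by measurable

lemma subord_1_integrable:
  assumes "0 < \<sigma>" "\<sigma> < 1"
  shows "integrable lborel (subord \<sigma> 1)"
proof (rule Bochner_Integration.integrable_bound)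
  show "integrable lborel (\<lambda>t. indicator {0..1} t * t powr (- \<sigma>) + indicator {1..} t * t powr (- 1 - \<sigma>))"
    using powr_from_0[of "- \<sigma>"] powr_to_inf[of "- 1 - \<sigma>"] assms
    by (intro Bochner_Integration.integrable_add) (auto simp: has_bochner_integral_iff)
  show "AE t in lborel. norm (subord \<sigma> 1 t) \<le> norm (indicator {0..1} t * t powr (- \<sigma>) + indicator {1..} t * t powr (- 1 - \<sigma>))"
  proof (rule AE_I2)
    fix t :: real
    show "norm (subord \<sigma> 1 t) \<le> norm (indicator {0..1} t * t powr (- \<sigma>) + indicator {1..} t * t powr (- 1 - \<sigma>))"
    proof (cases "t > 0")
      case True
      have e: "0 \<le> 1 - exp (- t)" "1 - exp (- t) \<le> t" "1 - exp (- t) \<le> 1"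
        using True exp_ge_add_one_self[of "- t"] by auto
      show ?thesis
      proof (cases "t \<le> 1")
        case t1: True
        have "(1 - exp (- t)) * t powr (- 1 - \<sigma>) \<le> t * t powr (- 1 - \<sigma>)"
          using e by (intro mult_right_mono) auto
        also have "\<dots> = t powr (- \<sigma>)" using True powr_add[of t 1 "-1-\<sigma>"] by simp
        finally show ?thesis using True t1 e by (auto simp: subord_def indicator_def intro: order_trans[OF _ exp_ge_zero])
      next
        case False
        have "(1 - exp (- t)) * t powr (- 1 - \<sigma>) \<le> 1 * t powr (- 1 - \<sigma>)"
          using e by (intro mult_right_mono) auto
        then show ?thesis using False True e by (auto simp: subord_def indicator_def)
      qed
    qed (simp add: subord_def)
  qed
qed simp

text \<open>Only t >= 1 is kept, where 1 - exp (- t) is at least 1/2. The growth like 1/\<sigma>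
  absorbs the tail integral of t^(-1-\<sigma>) in \<open>levy_lower_bound_finite\<close>.\<close>

lemma subord_const_ge:
  assumes "0 < \<sigma>" "\<sigma> < 1"
  shows "1 / (2 * \<sigma>) \<le> subord_const \<sigma>"
proof -
  have h: "1 - exp (- t) \<ge> 1 / 2" if "t \<ge> 1" for t :: real
  proof -
    have "exp t \<ge> 2" using exp_ge_add_one_self[of t] that by linarith
    then show ?thesis by (simp add: exp_minus field_simps)
  qed
  have "1 / (2 * \<sigma>) = (LINT t|lborel. 1 / 2 * (indicator {1..} t * t powr (- 1 - \<sigma>)))"
    using powr_to_inf[of "- 1 - \<sigma>"] assms by (simp only: integral_mult_right_zero has_bochner_integral_iff) simp
  also have "\<dots> \<le> subord_const \<sigma>"
    unfolding subord_const_def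
  proof (rule integral_mono[OF _ subord_1_integrable[OF assms]])
    show "integrable lborel (\<lambda>t. 1 / 2 * (indicator {1..} t * t powr (- 1 - \<sigma>)))"
      using powr_to_inf[of "- 1 - \<sigma>"] assms by (intro integrable_mult_right) (auto simp: has_bochner_integral_iff)
    show "1 / 2 * (indicator {1..} t * t powr (- 1 - \<sigma>)) \<le> subord \<sigma> 1 t" for t :: real
      using mult_right_mono[OF h, of t "t powr (- 1 - \<sigma>)"] by (auto simp: subord_def indicator_def)
  qed
  finally show ?thesis .
qed

lemma subord_integral:
  assumes \<sigma>: "0 < \<sigma>" "\<sigma> < 1" and \<mu>: "\<mu> \<ge> 0"
  shows "integrable lborel (subord \<sigma> \<mu>)" "(LINT t|lborel. subord \<sigma> \<mu> t) = subord_const \<sigma> * \<mu> powr \<sigma>"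
proof -
  consider "\<mu> = 0" | "\<mu> > 0" using \<mu> by linarith
  then have "integrable lborel (subord \<sigma> \<mu>) \<and> (LINT t|lborel. subord \<sigma> \<mu> t) = subord_const \<sigma> * \<mu> powr \<sigma>"
  proof cases
    case 1
    then have "subord \<sigma> \<mu> = (\<lambda>_. 0)" by (simp add: subord_def fun_eq_iff)
    then show ?thesis using 1 by simp
  next
    case 2
    \<comment> \<open>Scaling: the power of t is homogeneous, so the density for \<mu> is a multiple
      of the density for 1 evaluated at \<mu> t. The summand 0 fits the affine substitution
      rule.\<close>
    have eq: "subord \<sigma> \<mu> t = \<mu> powr (1 + \<sigma>) * subord \<sigma> 1 (0 + \<mu> * t)" for t
    proof (cases "t > 0")
      case True
      have "\<mu> powr (1 + \<sigma>) * (\<mu> * t) powr (- 1 - \<sigma>) = (\<mu> powr (1 + \<sigma>) * \<mu> powr (- 1 - \<sigma>)) * t powr (- 1 - \<sigma>)"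
        using True 2 by (simp add: powr_mult)
      also have "\<mu> powr (1 + \<sigma>) * \<mu> powr (- 1 - \<sigma>) = 1" using 2 by (simp add: powr_add[symmetric])
      finally have "\<mu> powr (1 + \<sigma>) * (\<mu> * t) powr (- 1 - \<sigma>) = t powr (- 1 - \<sigma>)" by simp
      then show ?thesis using True 2 by (simp add: subord_def mult.commute mult.left_commute)
    next
      case False
      then show ?thesis using 2 by (simp add: subord_def zero_less_mult_iff)
    qed
    have i: "integrable lborel (\<lambda>t. subord \<sigma> 1 (0 + \<mu> * t))"
      using lborel_integrable_real_affine[OF subord_1_integrable[OF \<sigma>], of \<mu> 0] 2 by simp
    have "subord_const \<sigma> = \<mu> * (LINT t|lborel. subord \<sigma> 1 (0 + \<mu> * t))"
      unfolding subord_const_def using 2 by (subst lborel_integral_real_affine[of \<mu> _ 0]) auto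
    then have "(LINT t|lborel. subord \<sigma> \<mu> t) = \<mu> powr (1 + \<sigma>) * (subord_const \<sigma> / \<mu>)"
      using 2 by (simp only: eq integral_mult_right_zero) simp
    also have "\<dots> = subord_const \<sigma> * \<mu> powr \<sigma>"
      using 2 by (simp add: powr_add)
    finally show ?thesis using i by (simp only: eq[abs_def] integrable_mult_right simp_thms)
  qed
  then show "integrable lborel (subord \<sigma> \<mu>)" "(LINT t|lborel. subord \<sigma> \<mu> t) = subord_const \<sigma> * \<mu> powr \<sigma>" by auto
qed

text \<open>Integrate \<open>heat_lower_bound\<close> against t^(-1-\<sigma>) dt. The constant is 8
  D + 2 with D = 1 + 2 d: times up to 1 give D / (5/8 - \<sigma>) <= 8 D, later times give 1 /
  \<sigma>, and division by \<open>subord_const\<close> supplies a factor at most 2 \<sigma> <=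
  1.\<close>

lemma levy_lower_bound_finite:
  fixes \<beta> :: "int ^ 'n \<Rightarrow> real"
  assumes K: "finite K" and A: "A \<ge> 0" and s: "0 < s" "s \<le> 1"
    and lb: "\<And>h. - A * modulus h \<le> (\<Sum>k\<in>K. \<beta> k * (1 - cos (freq k \<bullet> h)))"
  shows "- (10 + 16 * real CARD('n)) * A \<le> (\<Sum>k\<in>K. \<beta> k * norm (freq k) powr s)"
proof -
  define \<sigma> where "\<sigma> = s / 2"
  define D where "D = 1 + 2 * real CARD('n)"
  have \<sigma>: "0 < \<sigma>" "\<sigma> \<le> 1 / 2" "\<sigma> < 1" using s by (auto simp: \<sigma>_def)
  \<comment> \<open>\<open>m\<close> dominates min 1 (D t^(5/8)) t^(-1-\<sigma>), with the power
    used up to t = 1 and the cap beyond, and has an explicit integral.\<close>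
  define m where "m t = D * (indicator {0..1} t * t powr (5/8 - 1 - \<sigma>)) + indicator {1..} t * t powr (- 1 - \<sigma>)" for t :: real
  have m: "integrable lborel m" "(LINT t|lborel. m t) = D / (5/8 - \<sigma>) + 1 / \<sigma>"
    using powr_from_0[of "5/8 - 1 - \<sigma>"] powr_to_inf[of "- 1 - \<sigma>"] \<sigma>
    unfolding m_def by (auto simp: has_bochner_integral_iff)
  have pw: "(norm (freq k))\<^sup>2 powr \<sigma> = norm (freq k) powr s" for k :: "int ^ 'n"
    by (simp add: \<sigma>_def powr_powr flip: powr_numeral)
  have "- A * (D / (5/8 - \<sigma>) + 1 / \<sigma>) = (LINT t|lborel. - A * m t)" using m by simp
  also have "\<dots> \<le> (LINT t|lborel. (\<Sum>k\<in>K. \<beta> k * subord \<sigma> ((norm (freq k))\<^sup>2) t))"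
  proof (rule integral_mono)
    show "integrable lborel (\<lambda>t. - A * m t)" using m by simp
    show "integrable lborel (\<lambda>t. \<Sum>k\<in>K. \<beta> k * subord \<sigma> ((norm (freq k))\<^sup>2) t)"
      using subord_integral(1)[OF \<sigma>(1,3)] by (intro Bochner_Integration.integrable_sum integrable_mult_right) auto
    show "- A * m t \<le> (\<Sum>k\<in>K. \<beta> k * subord \<sigma> ((norm (freq k))\<^sup>2) t)" for t
    proof (cases "t > 0")
      case True
      have "min 1 (D * t powr (5/8)) * t powr (- 1 - \<sigma>) \<le> m t"
      proof (cases "t \<le> 1")
        case t1: True
        have "min 1 (D * t powr (5/8)) * t powr (- 1 - \<sigma>) \<le> D * t powr (5/8) * t powr (- 1 - \<sigma>)"
          by (intro mult_right_mono) auto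
        also have "\<dots> = D * t powr (5/8 - 1 - \<sigma>)"
          by (simp add: mult.assoc powr_add[symmetric])
        also have "\<dots> \<le> m t" using t1 True by (auto simp: m_def indicator_def)
        finally show ?thesis .
      next
        case False
        have "min 1 (D * t powr (5/8)) * t powr (- 1 - \<sigma>) \<le> 1 * t powr (- 1 - \<sigma>)"
          by (intro mult_right_mono) auto
        then show ?thesis using False by (simp add: m_def)
      qed
      then have "- A * m t \<le> - A * (min 1 (D * t powr (5/8)) * t powr (- 1 - \<sigma>))"
        using A by (simp add: mult_left_mono)
      also have "\<dots> = - A * min 1 (D * t powr (5/8)) * t powr (- 1 - \<sigma>)" by simp
      also have "\<dots> \<le> (\<Sum>k\<in>K. \<beta> k * (1 - exp (- t * (norm (freq k))\<^sup>2))) * t powr (- 1 - \<sigma>)"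
        using heat_lower_bound[OF K A True lb] unfolding D_def by (intro mult_right_mono) auto
      also have "\<dots> = (\<Sum>k\<in>K. \<beta> k * subord \<sigma> ((norm (freq k))\<^sup>2) t)"
        using True by (simp add: subord_def sum_distrib_right mult.assoc)
      finally show ?thesis .
    next
      case False
      then show ?thesis using A by (auto simp: subord_def m_def D_def indicator_def)
    qed
  qed
  also have "\<dots> = (\<Sum>k\<in>K. \<beta> k * (subord_const \<sigma> * norm (freq k) powr s))"
    using subord_integral[OF \<sigma>(1,3)] by (simp add: Bochner_Integration.integral_sum pw)
  also have "\<dots> = subord_const \<sigma> * (\<Sum>k\<in>K. \<beta> k * norm (freq k) powr s)"
    by (simp add: sum_distrib_left mult.left_commute)
  finally have *: "- A * (D / (5/8 - \<sigma>) + 1 / \<sigma>) \<le> subord_const \<sigma> * (\<Sum>k\<in>K. \<beta> k * norm (freq k) powr s)" .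
  define S where "S = (\<Sum>k\<in>K. \<beta> k * norm (freq k) powr s)"
  have c: "1 / (2 * \<sigma>) \<le> subord_const \<sigma>" by (rule subord_const_ge[OF \<sigma>(1,3)])
  show ?thesis
  \<comment> \<open>A nonnegative \<open>S\<close> settles the claim at once; for negative
    \<open>S\<close> the lower bound on \<open>subord_const\<close> becomes an upper bound on the
    product with \<open>S\<close>, which is the direction wanted.\<close>
  proof (cases "S \<ge> 0")
    case True
    then show ?thesis using A unfolding S_def[symmetric] by (smt (verit) mult_nonneg_nonneg of_nat_0_le_iff mult_minus_left)
  next
    case False
    have "D / (5/8 - \<sigma>) \<le> D / (1/8)"
      using \<sigma> unfolding D_def by (intro divide_left_mono) auto
    then have "D / (5/8 - \<sigma>) + 1 / \<sigma> \<le> 8 * D + 1 / \<sigma>" by simp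
    then have "- A * (8 * D + 1 / \<sigma>) \<le> - A * (D / (5/8 - \<sigma>) + 1 / \<sigma>)"
      using A by (simp add: mult_left_mono)
    also have "\<dots> \<le> subord_const \<sigma> * S" using * by (simp add: S_def)
    also have "\<dots> \<le> 1 / (2 * \<sigma>) * S" using c False by (intro mult_right_mono_neg) auto
    finally have "2 * \<sigma> * (- A * (8 * D + 1 / \<sigma>)) \<le> 2 * \<sigma> * (1 / (2 * \<sigma>) * S)"
      using \<sigma> by (intro mult_left_mono) auto
    also have "\<dots> = S" using \<sigma> by simp
    also have "2 * \<sigma> * (- A * (8 * D + 1 / \<sigma>)) = - A * (16 * D * \<sigma> + 2)"
      using \<sigma> by (simp add: field_simps)
    finally have "- A * (16 * D * \<sigma> + 2) \<le> S" .
    moreover have "16 * D * \<sigma> \<le> 16 * D * (1 / 2)"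
      using \<sigma> by (intro mult_left_mono) (auto simp: D_def)
    then have "A * (16 * D * \<sigma> + 2) \<le> A * (8 * D + 2)"
      using A by (intro mult_left_mono) auto
    ultimately show ?thesis unfolding S_def D_def by (simp add: algebra_simps)
  qed
qed


text \<open>An integer \<open>m > d/2 + 1\<close> is at least \<open>d/2 + 3/2\<close>, so any exponent below \<open>3/4\<close> is controlled by
  \<open>H\<^sup>m\<close>; an exponent above \<open>1/2\<close> is needed to control second differences when \<open>s = 1\<close>.\<close>

definition wiener_weight :: "int ^ 'n \<Rightarrow> real" where
  "wiener_weight k = (1 + (norm (freq k))\<^sup>2) powr (5/8)"

lemma wiener_weight_ge_1: "1 \<le> wiener_weight k"
  by (simp add: wiener_weight_def ge_one_powr_ge_zero)

lemma wiener_weight_nonneg: "0 \<le> wiener_weight k"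
  using wiener_weight_ge_1[of k] by linarith

lemma wiener_weight_ge_powr: "norm (freq k) powr (5/4) \<le> wiener_weight k"
proof -
  have "norm (freq k) powr (5/4) = ((norm (freq k))\<^sup>2) powr (5/8)"
    by (simp add: powr_powr flip: powr_numeral)
  also have "\<dots> \<le> wiener_weight k"
    unfolding wiener_weight_def by (intro powr_mono2) auto
  finally show ?thesis .
qed

lemma norm_powr_le_wiener_weight:
  assumes "0 < s" "s \<le> 5/4"
  shows "norm (freq k) powr s \<le> wiener_weight k"
proof (cases "norm (freq k) \<le> 1")
  case True
  then have "norm (freq k) powr s \<le> 1" using assms by (intro powr_le1) auto
  then show ?thesis using wiener_weight_ge_1[of k] by linarith
next
  case False
  then have "norm (freq k) powr s \<le> norm (freq k) powr (5/4)" using assms by (intro powr_mono) auto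
  then show ?thesis using wiener_weight_ge_powr[of k] by linarith
qed

lemma norm_le_wiener_weight: "norm (freq k) \<le> wiener_weight k"
  using norm_powr_le_wiener_weight[of 1 k] by simp

text \<open>The quadratic bound for |\<theta>| <= 1 and the trivial bound 2 beyond it both lie below
  the power 5/4 of the modulus.\<close>

lemma one_minus_cos_le: "1 - cos \<theta> \<le> 2 * \<bar>\<theta>\<bar> powr (5/4)" for \<theta> :: real
proof (cases "\<bar>\<theta>\<bar> \<le> 1")
  case True
  have "1 - cos \<theta> = 2 * (sin (\<theta> / 2))\<^sup>2"
    using cos_double_sin[of "\<theta> / 2"] by simp
  also have "(sin (\<theta> / 2))\<^sup>2 \<le> (\<theta> / 2)\<^sup>2"
    using abs_sin_x_le_abs_x[of "\<theta> / 2"] by (metis abs_le_square_iff)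
  also have "(\<theta> / 2)\<^sup>2 \<le> \<theta>\<^sup>2" by (simp add: power2_eq_square)
  also have "\<theta>\<^sup>2 = \<bar>\<theta>\<bar> powr 2" by simp
  also have "\<bar>\<theta>\<bar> powr 2 \<le> \<bar>\<theta>\<bar> powr (5/4)"
    using True by (intro powr_mono') auto
  finally show ?thesis by simp
next
  case False
  then have "1 \<le> \<bar>\<theta>\<bar> powr (5/4)" by (intro ge_one_powr_ge_zero) auto
  then show ?thesis using cos_ge_minus_one[of \<theta>] by linarith
qed

lemma inner_freq_powr_le: "\<bar>freq k \<bullet> h\<bar> powr (5/4) \<le> wiener_weight k * norm h powr (5/4)"
proof -
  have "\<bar>freq k \<bullet> h\<bar> powr (5/4) \<le> (norm (freq k) * norm h) powr (5/4)"
    by (intro powr_mono2 Cauchy_Schwarz_ineq2) auto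
  also have "\<dots> = norm (freq k) powr (5/4) * norm h powr (5/4)" by (simp add: powr_mult)
  also have "\<dots> \<le> wiener_weight k * norm h powr (5/4)"
    by (intro mult_right_mono wiener_weight_ge_powr) auto
  finally show ?thesis .
qed

lemma one_minus_cos_freq_le: "1 - cos (freq k \<bullet> h) \<le> 2 * wiener_weight k * modulus h"
proof (cases "norm h powr (5/4) \<le> 1")
  case True
  then show ?thesis
    using one_minus_cos_le[of "freq k \<bullet> h"] inner_freq_powr_le[of k h] by (simp add: modulus_def min_def)
next
  case False
  then have "modulus h = 1" by (simp add: modulus_def)
  moreover have "1 - cos (freq k \<bullet> h) \<le> 2 * wiener_weight k"
    using wiener_weight_ge_1[of k] cos_ge_minus_one[of "freq k \<bullet> h"] by linarith
  ultimately show ?thesis by simp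
qed

text \<open>Truncation to a finite \<open>K\<close> changes the sum in the hypothesis by at most 2
  \<open>modulus h\<close> times the tail of the weighted series. The finite bound therefore holds
  with \<open>A\<close> enlarged by twice that tail, which vanishes as \<open>K\<close>
  grows.\<close>

lemma levy_lower_bound:
  fixes \<beta> :: "int ^ 'n \<Rightarrow> real"
  assumes A: "A \<ge> 0" and s: "0 < s" "s \<le> 1"
    and sm: "(\<lambda>k. \<bar>\<beta> k\<bar> * wiener_weight k) summable_on UNIV"
    and lb: "\<And>h. - A * modulus h \<le> (\<Sum>\<^sub>\<infinity>k. \<beta> k * (1 - cos (freq k \<bullet> h)))"
  shows "- (10 + 16 * real CARD('n)) * A \<le> (\<Sum>\<^sub>\<infinity>k. \<beta> k * norm (freq k) powr s)"
proof -
  let ?b = "\<lambda>k. \<bar>\<beta> k\<bar> * wiener_weight k" and ?C = "10 + 16 * real CARD('n)"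
  define T where "T = infsum ?b UNIV"
  have T: "(?b has_sum T) UNIV" using sm by (simp add: T_def)
  have s1: "(\<lambda>k. \<beta> k * norm (freq k) powr s) summable_on UNIV"
    by (rule abs_summable_summable[OF Infinite_Sum.abs_summable_on_comparison_test'[OF sm]])
      (use s in \<open>auto simp: abs_mult intro!: mult_left_mono norm_powr_le_wiener_weight\<close>)
  have bd: "\<bar>\<beta> k * (1 - cos (freq k \<bullet> h))\<bar> \<le> 2 * modulus h * ?b k" for k h
    using mult_left_mono[OF one_minus_cos_freq_le[of k h], of "\<bar>\<beta> k\<bar>"] by (simp add: abs_mult ac_simps)
  have s2: "(\<lambda>k. \<beta> k * (1 - cos (freq k \<bullet> h))) summable_on UNIV" for h
    by (rule abs_summable_summable[OF Infinite_Sum.abs_summable_on_comparison_test'[OF summable_on_cmult_right[OF sm, of "2 * modulus h"]]])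
      (simp only: real_norm_def bd)
  have fin: "- ?C * (A + 2 * (T - sum ?b K)) \<le> (\<Sum>k\<in>K. \<beta> k * norm (freq k) powr s)" if K: "finite K" for K
  proof (rule levy_lower_bound_finite[OF K _ s])
    have "sum ?b K \<le> T"
      unfolding T_def by (rule finite_sum_le_infsum[OF sm K]) (auto simp: wiener_weight_nonneg)
    then show "0 \<le> A + 2 * (T - sum ?b K)" using A by simp
    fix h :: "real ^ 'n"
    have h1: "((\<lambda>k. \<beta> k * (1 - cos (freq k \<bullet> h))) has_sum (infsum (\<lambda>k. \<beta> k * (1 - cos (freq k \<bullet> h))) UNIV - (\<Sum>k\<in>K. \<beta> k * (1 - cos (freq k \<bullet> h))))) (UNIV - K)"
      by (intro has_sum_Diff has_sum_infsum s2 has_sum_finite K) auto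
    have h2: "((\<lambda>k. 2 * modulus h * ?b k) has_sum (2 * modulus h * (T - sum ?b K))) (UNIV - K)"
      by (intro has_sum_cmult_right has_sum_Diff T has_sum_finite K) auto
    have "infsum (\<lambda>k. \<beta> k * (1 - cos (freq k \<bullet> h))) UNIV - (\<Sum>k\<in>K. \<beta> k * (1 - cos (freq k \<bullet> h))) \<le> 2 * modulus h * (T - sum ?b K)"
      using bd by (intro has_sum_mono[OF h1 h2]) (auto intro: order_trans[OF abs_ge_self])
    then show "- (A + 2 * (T - sum ?b K)) * modulus h \<le> (\<Sum>k\<in>K. \<beta> k * (1 - cos (freq k \<bullet> h)))"
      using lb[of h] by (simp add: algebra_simps)
  qed
  have "((\<lambda>K. - ?C * (A + 2 * (T - sum ?b K))) \<longlongrightarrow> - ?C * (A + 2 * (T - T))) (finite_subsets_at_top UNIV)"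
    using T unfolding has_sum_def by (intro tendsto_intros)
  moreover have "((\<lambda>K. \<Sum>k\<in>K. \<beta> k * norm (freq k) powr s) \<longlongrightarrow> (\<Sum>\<^sub>\<infinity>k. \<beta> k * norm (freq k) powr s)) (finite_subsets_at_top UNIV)"
    using s1 by (simp add: infsum_tendsto)
  moreover have "\<forall>\<^sub>F K in finite_subsets_at_top UNIV. - ?C * (A + 2 * (T - sum ?b K)) \<le> (\<Sum>k\<in>K. \<beta> k * norm (freq k) powr s)"
    using fin by (simp add: eventually_finite_subsets_at_top_weakI)
  ultimately show ?thesis
    using tendsto_le[of "finite_subsets_at_top UNIV" "\<lambda>K. \<Sum>k\<in>K. \<beta> k * norm (freq k) powr s"] by fastforce
qed

lemma has_sum_diff:
  fixes f g :: "'a \<Rightarrow> 'b::real_normed_vector"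
  assumes "(f has_sum a) A" "(g has_sum b) A"
  shows "((\<lambda>x. f x - g x) has_sum (a - b)) A"
proof -
  have "((\<lambda>x. - g x) has_sum - b) A" using assms(2) by (simp add: has_sum_uminus)
  from has_sum_add[OF assms(1) this] show ?thesis by simp
qed

lemma has_sum_sum:
  fixes f :: "'j \<Rightarrow> 'a \<Rightarrow> 'b::real_normed_vector"
  assumes "\<And>j. j \<in> J \<Longrightarrow> (f j has_sum S j) A"
  shows "((\<lambda>k. \<Sum>j\<in>J. f j k) has_sum (\<Sum>j\<in>J. S j)) A"
  using assms by (induction J rule: infinite_finite_induct) (auto intro: has_sum_add)

section \<open>Functions with a weighted absolutely convergent Fourier series\<close>

definition wiener_norm :: "(real ^ 'n \<Rightarrow> real) \<Rightarrow> real" where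
  "wiener_norm f = (\<Sum>\<^sub>\<infinity>k. wiener_weight k * cmod (fourier_coeff f k))"

text \<open>A weighted Wiener class. Continuity is part of it so that the Fourier series represents
  \<open>f\<close> at every point, not merely almost everywhere.\<close>

definition wiener :: "(real ^ 'n \<Rightarrow> real) \<Rightarrow> bool" where
  "wiener f \<longleftrightarrow> continuous_on UNIV f \<and> torus_periodic f \<and>
     (\<lambda>k. wiener_weight k * cmod (fourier_coeff f k)) summable_on UNIV"

lemma wiener_continuous: "wiener f \<Longrightarrow> continuous_on S f"
  using continuous_on_subset by (auto simp: wiener_def)

lemma wiener_periodic: "wiener f \<Longrightarrow> torus_periodic f"
  by (simp add: wiener_def)

lemma wiener_integrable: "wiener f \<Longrightarrow> integrable torus f"
  by (intro integrable_continuous_torus wiener_continuous)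

lemma wiener_L2: "wiener f \<Longrightarrow> torus_L2 f"
  by (simp add: wiener_continuous wiener_periodic torus_L2_continuous)

lemma wiener_has_sum:
  "wiener f \<Longrightarrow> ((\<lambda>k. wiener_weight k * cmod (fourier_coeff f k)) has_sum wiener_norm f) UNIV"
  by (simp add: wiener_def wiener_norm_def)

text \<open>Point values, the gradient, \<open>|\<nabla>|^s\<close> and centred differences are all
  Fourier multipliers whose symbol is dominated by the weight, and this lemma serves them
  together.\<close>

lemma wiener_multiplier_summable:
  assumes "wiener f" "\<And>k. cmod (\<mu> k) \<le> c * wiener_weight k"
  shows "(\<lambda>k. cmod (\<mu> k * fourier_coeff f k)) summable_on UNIV"
proof (rule Infinite_Sum.abs_summable_on_comparison_test')
  show "(\<lambda>k. c * (wiener_weight k * cmod (fourier_coeff f k))) summable_on UNIV"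
    using assms(1) by (intro summable_on_cmult_right) (simp add: wiener_def)
  show "norm (\<mu> k * fourier_coeff f k) \<le> c * (wiener_weight k * cmod (fourier_coeff f k))" for k
    using mult_right_mono[OF assms(2)[of k], of "cmod (fourier_coeff f k)"] by (simp add: norm_mult mult.assoc)
qed

lemma wiener_multiplier_bound:
  assumes f: "wiener f" and \<mu>: "\<And>k. cmod (\<mu> k) \<le> c * wiener_weight k"
  shows "\<bar>fourier_series (\<lambda>k. \<mu> k * fourier_coeff f k) x\<bar> \<le> c * wiener_norm f"
proof -
  note s = wiener_multiplier_summable[OF f \<mu>]
  have "norm (fourier_series (\<lambda>k. \<mu> k * fourier_coeff f k) x) \<le> c * wiener_norm f"
  proof (rule norm_infsum_le[OF fourier_series_has_sum[OF s] has_sum_cmult_right[OF wiener_has_sum[OF f]]])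
    fix k
    have "norm (Re (\<mu> k * fourier_coeff f k * cis (freq k \<bullet> x))) \<le> cmod (\<mu> k * fourier_coeff f k)"
      by (simp only: real_norm_def abs_Re_cis_le)
    also have "\<dots> \<le> c * (wiener_weight k * cmod (fourier_coeff f k))"
      using mult_right_mono[OF \<mu>[of k], of "cmod (fourier_coeff f k)"] by (simp add: norm_mult mult.assoc)
    finally show "norm (Re (\<mu> k * fourier_coeff f k * cis (freq k \<bullet> x))) \<le> c * (wiener_weight k * cmod (fourier_coeff f k))" .
  qed
  then show ?thesis by simp
qed

lemma wiener_coeff_summable:
  "wiener f \<Longrightarrow> (\<lambda>k. cmod (fourier_coeff f k)) summable_on UNIV"
  using wiener_multiplier_summable[of f "\<lambda>_. 1" 1] by (simp add: wiener_weight_ge_1)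

lemma wiener_inversion: "wiener f \<Longrightarrow> fourier_series (fourier_coeff f) = f"
  by (intro fourier_series_inversion wiener_continuous wiener_periodic wiener_coeff_summable)

lemma wiener_series:
  assumes "wiener f"
  shows "((\<lambda>k. Re (fourier_coeff f k * cis (freq k \<bullet> x))) has_sum f x) UNIV"
  using fourier_series_has_sum[OF wiener_coeff_summable[OF assms]] by (simp only: wiener_inversion[OF assms])

lemma wiener_norm_nonneg: "0 \<le> wiener_norm f"
  unfolding wiener_norm_def by (intro infsum_nonneg mult_nonneg_nonneg wiener_weight_nonneg) auto

lemma wiener_bound: "wiener f \<Longrightarrow> \<bar>f x\<bar> \<le> wiener_norm f"
  using wiener_multiplier_bound[of f "\<lambda>_. 1" 1 x] by (simp add: wiener_inversion wiener_weight_ge_1)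

lemma fourier_series_eqI:
  assumes "(\<lambda>k. cmod (a k)) summable_on UNIV" "((\<lambda>k. Re (a k * cis (freq k \<bullet> x))) has_sum S) UNIV"
  shows "fourier_series a x = S"
  using fourier_series_has_sum[OF assms(1)] assms(2) has_sum_unique by blast

lemma cmod_cis_minus_1_le: "cmod (cis \<theta> - 1) \<le> \<bar>\<theta>\<bar>"
  using iexp_approx1[of \<theta> 0] by (simp add: cis_conv_exp)

lemma cmod_cis_remainder_le: "cmod (cis \<theta> - 1 - \<i> * \<theta>) \<le> 2 * \<bar>\<theta>\<bar> powr (5/4)"
proof (cases "\<bar>\<theta>\<bar> \<le> 1")
  case True
  have "cmod (cis \<theta> - 1 - \<i> * \<theta>) \<le> \<theta>\<^sup>2 / 2"
    using iexp_approx1[of \<theta> 1] by (simp add: cis_conv_exp power2_eq_square algebra_simps)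
  also have "\<dots> \<le> \<bar>\<theta>\<bar> powr 2" by simp
  also have "\<bar>\<theta>\<bar> powr 2 \<le> \<bar>\<theta>\<bar> powr (5/4)"
    using True by (intro powr_mono') auto
  also have "\<dots> \<le> 2 * \<bar>\<theta>\<bar> powr (5/4)" by simp
  finally show ?thesis .
next
  case False
  have "cmod (cis \<theta> - 1 - \<i> * \<theta>) \<le> cmod (cis \<theta> - 1) + cmod (\<i> * \<theta>)"
    by (rule norm_triangle_ineq4)
  also have "\<dots> \<le> 2 * \<bar>\<theta>\<bar> powr 1"
    using cmod_cis_minus_1_le[of \<theta>] False by (simp add: norm_mult)
  also have "\<dots> \<le> 2 * \<bar>\<theta>\<bar> powr (5/4)" using False by (intro mult_left_mono powr_mono) auto
  finally show ?thesis .
qed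

lemma wiener_lipschitz:
  assumes f: "wiener f"
  shows "\<bar>f (x + h) - f x\<bar> \<le> wiener_norm f * norm h"
proof -
  have "norm (f (x + h) - f x) \<le> norm h * wiener_norm f"
  proof (rule norm_infsum_le[OF has_sum_diff[OF wiener_series[OF f] wiener_series[OF f]] has_sum_cmult_right[OF wiener_has_sum[OF f]]])
    fix k
    have "Re (fourier_coeff f k * cis (freq k \<bullet> (x + h))) - Re (fourier_coeff f k * cis (freq k \<bullet> x)) =
        Re (fourier_coeff f k * cis (freq k \<bullet> x) * (cis (freq k \<bullet> h) - 1))"
      by (simp only: inner_add_right cis_mult[symmetric] minus_complex.sel[symmetric]) (simp add: algebra_simps)
    also have "norm \<dots> \<le> cmod (fourier_coeff f k * cis (freq k \<bullet> x) * (cis (freq k \<bullet> h) - 1))"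
      by (simp only: real_norm_def abs_Re_le_cmod)
    also have "\<dots> = cmod (fourier_coeff f k) * cmod (cis (freq k \<bullet> h) - 1)" by (simp add: norm_mult)
    also have "\<dots> \<le> cmod (fourier_coeff f k) * (wiener_weight k * norm h)"
    proof (rule mult_left_mono)
      have "cmod (cis (freq k \<bullet> h) - 1) \<le> norm (freq k) * norm h"
        using cmod_cis_minus_1_le Cauchy_Schwarz_ineq2 order_trans by blast
      also have "\<dots> \<le> wiener_weight k * norm h" by (intro mult_right_mono norm_le_wiener_weight) auto
      finally show "cmod (cis (freq k \<bullet> h) - 1) \<le> wiener_weight k * norm h" .
    qed simp
    finally show "norm (Re (fourier_coeff f k * cis (freq k \<bullet> (x + h))) - Re (fourier_coeff f k * cis (freq k \<bullet> x))) \<le> norm h * (wiener_weight k * cmod (fourier_coeff f k))"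
      by (simp add: ac_simps)
  qed
  then show ?thesis by (simp add: mult.commute)
qed

text \<open>A centred difference multiplies each wave by the real number 1 - cos (k . h), the very
  factor in the hypothesis of \<open>levy_lower_bound\<close>; this is the link from translations to
  \<open>|\<nabla>|^s\<close>.\<close>

lemma wiener_second_difference_has_sum:
  assumes f: "wiener f"
  shows "((\<lambda>k. (1 - cos (freq k \<bullet> h)) * Re (fourier_coeff f k * cis (freq k \<bullet> x))) has_sum (f x - (f (x + h) + f (x - h)) / 2)) UNIV"
proof -
  have "((\<lambda>k. Re (fourier_coeff f k * cis (freq k \<bullet> x)) - (1/2) * (Re (fourier_coeff f k * cis (freq k \<bullet> (x + h))) + Re (fourier_coeff f k * cis (freq k \<bullet> (x - h)))))
     has_sum (f x - (1/2) * (f (x + h) + f (x - h)))) UNIV"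
    by (intro has_sum_diff has_sum_cmult_right has_sum_add wiener_series f)
  moreover have "Re (c * cis t) - (1/2) * (Re (c * cis (t + u)) + Re (c * cis (t - u))) = (1 - cos u) * Re (c * cis t)" for c t u
    by (simp add: cos_add cos_diff sin_add sin_diff algebra_simps)
  ultimately show ?thesis by (simp only: inner_add_right inner_diff_right) simp
qed

lemma wiener_second_difference:
  assumes f: "wiener f"
  shows "\<bar>f (x + h) + f (x - h) - 2 * f x\<bar> \<le> 4 * wiener_norm f * modulus h"
proof -
  have "norm (f x - (f (x + h) + f (x - h)) / 2) \<le> 2 * modulus h * wiener_norm f"
  proof (rule norm_infsum_le[OF wiener_second_difference_has_sum[OF f] has_sum_cmult_right[OF wiener_has_sum[OF f]]])
    fix k
    have "norm ((1 - cos (freq k \<bullet> h)) * Re (fourier_coeff f k * cis (freq k \<bullet> x))) \<le> (1 - cos (freq k \<bullet> h)) * cmod (fourier_coeff f k)"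
      unfolding real_norm_def abs_mult using abs_Re_cis_le by (intro mult_mono) auto
    also have "\<dots> \<le> (2 * wiener_weight k * modulus h) * cmod (fourier_coeff f k)"
      by (intro mult_right_mono one_minus_cos_freq_le) auto
    finally show "norm ((1 - cos (freq k \<bullet> h)) * Re (fourier_coeff f k * cis (freq k \<bullet> x))) \<le> 2 * modulus h * (wiener_weight k * cmod (fourier_coeff f k))"
      by (simp add: ac_simps)
  qed
  then have "\<bar>f x - (f (x + h) + f (x - h)) / 2\<bar> \<le> 2 * modulus h * wiener_norm f" by simp
  then show ?thesis by (simp only: abs_le_iff) (simp add: field_simps)
qed

section \<open>Differentiability of Wiener functions\<close>

definition wiener_gradient :: "(real ^ 'n \<Rightarrow> real) \<Rightarrow> real ^ 'n \<Rightarrow> real ^ 'n" where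
  "wiener_gradient f x = (\<chi> j. fourier_series (\<lambda>k. (\<i> * of_int (k $ j)) * fourier_coeff f k) x)"

lemma cmod_freq_component_le: "cmod (\<i> * of_int (k $ j)) \<le> 1 * wiener_weight k"
proof -
  have "cmod (\<i> * of_int (k $ j)) = \<bar>freq k $ j\<bar>" by (simp add: norm_mult freq_def)
  also have "\<dots> \<le> norm (freq k)" by (rule component_le_norm_cart)
  also have "\<dots> \<le> wiener_weight k" by (rule norm_le_wiener_weight)
  finally show ?thesis by simp
qed

lemma wiener_gradient_continuous: "wiener f \<Longrightarrow> continuous_on S (wiener_gradient f)"
  unfolding wiener_gradient_def
  by (rule continuous_on_vec_lambda, rule fourier_series_continuous, rule wiener_multiplier_summable[OF _ cmod_freq_component_le])

text \<open>Termwise, cis \<theta> - 1 - \<i> \<theta> is at most of order |\<theta>|^(5/4), an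
  interpolation between its quadratic and linear bounds. So one weighted sum controls a Taylor
  remainder of order above 1.\<close>

lemma wiener_gradient_remainder:
  assumes f: "wiener f"
  shows "\<bar>f (x + h) - f x - h \<bullet> wiener_gradient f x\<bar> \<le> 2 * wiener_norm f * norm h powr (5/4)"
proof -
  let ?c = "fourier_coeff f"
  have g: "((\<lambda>k. \<Sum>j\<in>UNIV. h $ j * Re ((\<i> * of_int (k $ j)) * ?c k * cis (freq k \<bullet> x))) has_sum (h \<bullet> wiener_gradient f x)) UNIV"
    unfolding wiener_gradient_def inner_vec_def[of h] inner_real_def vec_lambda_beta
    by (intro has_sum_sum has_sum_cmult_right fourier_series_has_sum wiener_multiplier_summable[OF f cmod_freq_component_le])
  have "norm (f (x + h) - f x - h \<bullet> wiener_gradient f x) \<le> 2 * norm h powr (5/4) * wiener_norm f"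
  proof (rule norm_infsum_le[OF has_sum_diff[OF has_sum_diff[OF wiener_series[OF f] wiener_series[OF f]] g] has_sum_cmult_right[OF wiener_has_sum[OF f]]])
    fix k
    have "(\<Sum>j\<in>UNIV. h $ j * Re ((\<i> * of_int (k $ j)) * ?c k * cis (freq k \<bullet> x))) = (\<Sum>j\<in>UNIV. freq k $ j * h $ j) * Re (\<i> * (?c k * cis (freq k \<bullet> x)))"
      unfolding sum_distrib_right by (intro sum.cong refl) (simp add: freq_def algebra_simps)
    also have "\<dots> = Re (?c k * cis (freq k \<bullet> x) * (\<i> * of_real (freq k \<bullet> h)))"
      by (simp add: inner_vec_def algebra_simps)
    finally have "Re (?c k * cis (freq k \<bullet> (x + h))) - Re (?c k * cis (freq k \<bullet> x)) - (\<Sum>j\<in>UNIV. h $ j * Re ((\<i> * of_int (k $ j)) * ?c k * cis (freq k \<bullet> x))) =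
        Re (?c k * cis (freq k \<bullet> x) * (cis (freq k \<bullet> h) - 1 - \<i> * of_real (freq k \<bullet> h)))"
      by (simp only: inner_add_right cis_mult[symmetric] minus_complex.sel[symmetric]) (simp add: algebra_simps)
    also have "norm \<dots> \<le> cmod (?c k * cis (freq k \<bullet> x) * (cis (freq k \<bullet> h) - 1 - \<i> * of_real (freq k \<bullet> h)))"
      by (simp only: real_norm_def abs_Re_le_cmod)
    also have "\<dots> = cmod (?c k) * cmod (cis (freq k \<bullet> h) - 1 - \<i> * of_real (freq k \<bullet> h))" by (simp add: norm_mult)
    also have "\<dots> \<le> cmod (?c k) * (2 * (wiener_weight k * norm h powr (5/4)))"
      using cmod_cis_remainder_le[of "freq k \<bullet> h"] inner_freq_powr_le[of k h] by (intro mult_left_mono) auto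
    finally show "norm (Re (?c k * cis (freq k \<bullet> (x + h))) - Re (?c k * cis (freq k \<bullet> x)) - (\<Sum>j\<in>UNIV. h $ j * Re ((\<i> * of_int (k $ j)) * ?c k * cis (freq k \<bullet> x)))) \<le> 2 * norm h powr (5/4) * (wiener_weight k * cmod (?c k))"
      by (simp add: ac_simps)
  qed
  then show ?thesis by (simp add: ac_simps)
qed

lemma wiener_has_derivative:
  assumes f: "wiener f"
  shows "(f has_derivative (\<lambda>h. h \<bullet> wiener_gradient f x)) (at x)"
  unfolding has_derivative_at
proof (intro conjI)
  show "bounded_linear (\<lambda>h. h \<bullet> wiener_gradient f x)" by (rule bounded_linear_inner_left)
  have "((\<lambda>h::real^'n. norm h powr (1/4)) \<longlongrightarrow> 0) (at 0)"
    by (rule tendsto_zero_powrI[OF tendsto_norm_zero[OF tendsto_ident_at] tendsto_const]) auto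
  then have "((\<lambda>h::real^'n. 2 * wiener_norm f * norm h powr (1/4)) \<longlongrightarrow> 0) (at 0)"
    by (rule tendsto_mult_right_zero)
  moreover have "norm (f (x + h) - f x - h \<bullet> wiener_gradient f x) / norm h \<le> 2 * wiener_norm f * norm h powr (1/4)" if "h \<noteq> 0" for h
  proof -
    have "norm h powr (5/4) = norm h powr (1/4) * norm h"
      using that powr_add[of "norm h" "1/4" 1] by simp
    then show ?thesis using wiener_gradient_remainder[OF f, of x h] that by (simp add: pos_divide_le_eq mult.assoc)
  qed
  then have "\<forall>\<^sub>F h in at 0. norm (norm (f (x + h) - f x - h \<bullet> wiener_gradient f x) / norm h) \<le> 2 * wiener_norm f * norm h powr (1/4)"
    by (simp add: eventually_at_filter)
  ultimately show "((\<lambda>h. norm (f (x + h) - f x - h \<bullet> wiener_gradient f x) / norm h) \<longlongrightarrow> 0) (at 0)"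
    by (rule Lim_null_comparison[rotated])
qed

lemma gradient_eq_wiener_gradient:
  assumes f: "wiener f"
  shows "gradient f = wiener_gradient f"
proof
  fix x
  have "deriv (\<lambda>h. f (x + axis j h)) 0 = wiener_gradient f x $ j" for j
  proof (rule DERIV_imp_deriv)
    have ax: "axis j h = h *\<^sub>R axis j 1" for h :: real
      by (simp add: axis_def vec_eq_iff)
    have "((\<lambda>h. x + h *\<^sub>R axis j 1) has_derivative (\<lambda>h. h *\<^sub>R axis j 1)) (at (0::real))"
      by (auto intro!: derivative_eq_intros)
    then have "((\<lambda>h. x + axis j h) has_derivative (\<lambda>h. axis j h)) (at (0::real))"
      by (simp only: ax[symmetric])
    then have "((\<lambda>h. f (x + axis j h)) has_derivative (\<lambda>h. axis j h \<bullet> wiener_gradient f x)) (at 0)"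
      using has_derivative_compose[of "\<lambda>h. x + axis j h" "\<lambda>h. axis j h" 0 UNIV f] wiener_has_derivative[OF f, of "x + axis j 0"]
      by (simp add: axis_def zero_vec_def[symmetric])
    moreover have "(\<lambda>h. axis j h \<bullet> wiener_gradient f x) = (*) (wiener_gradient f x $ j)"
      by (simp add: inner_axis' fun_eq_iff mult.commute)
    ultimately show "((\<lambda>h. f (x + axis j h)) has_real_derivative wiener_gradient f x $ j) (at 0)"
      by (simp add: has_field_derivative_def)
  qed
  then show "gradient f x = wiener_gradient f x" by (simp add: gradient_def vec_eq_iff)
qed

lemma wiener_gradient_lipschitz:
  assumes f: "wiener f" and x: "x \<in> S" and y: "y \<in> S" and S: "convex S"
    and B: "\<And>x. x \<in> S \<Longrightarrow> norm (gradient f x) \<le> B"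
  shows "\<bar>f y - f x\<bar> \<le> B * norm (y - x)"
proof -
  have "norm (f y - f x) \<le> B * norm (y - x)"
  proof (rule differentiable_bound[OF S _ _ y x])
    fix z assume "z \<in> S"
    show "(f has_derivative (\<lambda>h. h \<bullet> wiener_gradient f z)) (at z within S)"
      by (rule has_derivative_at_withinI[OF wiener_has_derivative[OF f]])
    show "onorm (\<lambda>h. h \<bullet> wiener_gradient f z) \<le> B"
    proof (rule onorm_le)
      fix h
      have "norm (h \<bullet> wiener_gradient f z) \<le> norm h * norm (wiener_gradient f z)"
        by (simp add: Cauchy_Schwarz_ineq2)
      also have "\<dots> \<le> norm h * B"
        using B[OF \<open>z \<in> S\<close>] by (intro mult_left_mono) (simp_all add: gradient_eq_wiener_gradient[OF f])
      finally show "norm (h \<bullet> wiener_gradient f z) \<le> B * norm h" by (simp add: mult.commute)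
    qed
  qed
  then show ?thesis by simp
qed

lemma wiener_add_diff:
  assumes f: "wiener f" and g: "wiener g"
  shows "wiener (\<lambda>x. f x + g x)" "wiener (\<lambda>x. f x - g x)" "wiener_norm (\<lambda>x. f x - g x) \<le> wiener_norm f + wiener_norm g"
proof -
  have s: "(\<lambda>k. wiener_weight k * cmod (fourier_coeff f k) + wiener_weight k * cmod (fourier_coeff g k)) summable_on UNIV"
    using f g by (intro summable_on_add) (auto simp: wiener_def)
  have le: "cmod (fourier_coeff f k + fourier_coeff g k) \<le> cmod (fourier_coeff f k) + cmod (fourier_coeff g k)"
     "cmod (fourier_coeff f k - fourier_coeff g k) \<le> cmod (fourier_coeff f k) + cmod (fourier_coeff g k)" for k
    by (rule norm_triangle_ineq norm_triangle_ineq4)+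
  have le': "wiener_weight k * cmod (fourier_coeff f k + fourier_coeff g k) \<le> wiener_weight k * cmod (fourier_coeff f k) + wiener_weight k * cmod (fourier_coeff g k)"
     "wiener_weight k * cmod (fourier_coeff f k - fourier_coeff g k) \<le> wiener_weight k * cmod (fourier_coeff f k) + wiener_weight k * cmod (fourier_coeff g k)" for k
    using mult_left_mono[OF le(1)[of k] wiener_weight_nonneg[of k]] mult_left_mono[OF le(2)[of k] wiener_weight_nonneg[of k]]
    by (simp_all add: distrib_left)
  have s1: "(\<lambda>k. wiener_weight k * cmod (fourier_coeff f k + fourier_coeff g k)) summable_on UNIV"
    by (rule summable_on_comparison_test[OF s]) (auto simp: le' wiener_weight_nonneg)
  have s2: "(\<lambda>k. wiener_weight k * cmod (fourier_coeff f k - fourier_coeff g k)) summable_on UNIV"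
    by (rule summable_on_comparison_test[OF s]) (auto simp: le' wiener_weight_nonneg)
  note c = fourier_coeff_add[OF f[THEN wiener_integrable] g[THEN wiener_integrable]]
    fourier_coeff_diff[OF f[THEN wiener_integrable] g[THEN wiener_integrable]]
  show "wiener (\<lambda>x. f x + g x)"
    unfolding wiener_def c
    using s1 f g torus_periodic_comp2[of f g "(+)"] by (auto simp: wiener_def intro: continuous_on_add)
  show "wiener (\<lambda>x. f x - g x)"
    unfolding wiener_def c
    using s2 f g torus_periodic_comp2[of f g "(-)"] by (auto simp: wiener_def intro: continuous_on_diff)
  have "wiener_norm (\<lambda>x. f x - g x) \<le> (\<Sum>\<^sub>\<infinity>k. wiener_weight k * cmod (fourier_coeff f k) + wiener_weight k * cmod (fourier_coeff g k))"
    unfolding wiener_norm_def c by (rule infsum_mono[OF s2 s]) (rule le')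
  also have "\<dots> = wiener_norm f + wiener_norm g"
    unfolding wiener_norm_def using f g by (intro infsum_add) (auto simp: wiener_def)
  finally show "wiener_norm (\<lambda>x. f x - g x) \<le> wiener_norm f + wiener_norm g" .
qed

section \<open>Parseval pairings and the fractional Laplacian on Wiener functions\<close>

lemma wiener_pairing:
  fixes f h :: "real ^ 'n \<Rightarrow> real"
  assumes "wiener f" "integrable torus h"
  shows "((\<lambda>k. (2 * pi) ^ CARD('n) * Re (fourier_coeff f k * cnj (fourier_coeff h k))) has_sum (LINT x|torus. f x * h x)) UNIV"
  using integral_fourier_series[OF wiener_coeff_summable[OF assms(1)] assms(2)] by (simp only: wiener_inversion[OF assms(1)])

text \<open>The continuous representative of the relation \<open>has_frac_laplacian\<close>: for 0 <
  s <= 1 the symbol lies below the weight, so on Wiener functions the series converges absolutely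
  and has point values.\<close>

definition frac_lap :: "real \<Rightarrow> (real ^ 'n \<Rightarrow> real) \<Rightarrow> real ^ 'n \<Rightarrow> real" where
  "frac_lap s f = fourier_series (\<lambda>k. of_real (norm (freq k) powr s) * fourier_coeff f k)"

context
  fixes s :: real
  assumes s: "0 < s" "s \<le> 1"
begin

lemma frac_lap_symbol_le: "cmod (of_real (norm (freq k) powr s)) \<le> 1 * wiener_weight k"
  using s norm_powr_le_wiener_weight[of s k] by simp

lemma frac_lap_summable:
  "wiener f \<Longrightarrow> (\<lambda>k. cmod (of_real (norm (freq k) powr s) * fourier_coeff f k)) summable_on UNIV"
  by (rule wiener_multiplier_summable[OF _ frac_lap_symbol_le])

lemma frac_lap_continuous: "wiener f \<Longrightarrow> continuous_on S (frac_lap s f)"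
  unfolding frac_lap_def by (intro fourier_series_continuous frac_lap_summable)

lemma frac_lap_bound: "wiener f \<Longrightarrow> \<bar>frac_lap s f x\<bar> \<le> wiener_norm f"
  unfolding frac_lap_def using wiener_multiplier_bound[OF _ frac_lap_symbol_le] by simp

lemma fourier_coeff_frac_lap:
  assumes "wiener f"
  shows "fourier_coeff (frac_lap s f) k = of_real (norm (freq k) powr s) * fourier_coeff f k"
  unfolding frac_lap_def
  by (rule fourier_coeff_fourier_series[OF frac_lap_summable[OF assms]]) (simp add: fourier_coeff_uminus freq_uminus)

lemma frac_lap_diff:
  assumes f: "wiener f" and g: "wiener g"
  shows "frac_lap s (\<lambda>x. f x - g x) x = frac_lap s f x - frac_lap s g x"
  unfolding frac_lap_def
proof (rule fourier_series_eqI)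
  show "(\<lambda>k. cmod (of_real (norm (freq k) powr s) * fourier_coeff (\<lambda>x. f x - g x) k)) summable_on UNIV"
    by (intro frac_lap_summable wiener_add_diff f g)
  have "((\<lambda>k. Re (of_real (norm (freq k) powr s) * fourier_coeff f k * cis (freq k \<bullet> x)) - Re (of_real (norm (freq k) powr s) * fourier_coeff g k * cis (freq k \<bullet> x)))
    has_sum (fourier_series (\<lambda>k. of_real (norm (freq k) powr s) * fourier_coeff f k) x - fourier_series (\<lambda>k. of_real (norm (freq k) powr s) * fourier_coeff g k) x)) UNIV"
    by (intro has_sum_diff fourier_series_has_sum frac_lap_summable f g)
  then show "((\<lambda>k. Re (of_real (norm (freq k) powr s) * fourier_coeff (\<lambda>x. f x - g x) k * cis (freq k \<bullet> x)))
    has_sum (fourier_series (\<lambda>k. of_real (norm (freq k) powr s) * fourier_coeff f k) x - fourier_series (\<lambda>k. of_real (norm (freq k) powr s) * fourier_coeff g k) x)) UNIV"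
    unfolding fourier_coeff_diff[OF f[THEN wiener_integrable] g[THEN wiener_integrable]]
    by (simp only: right_diff_distrib left_diff_distrib minus_complex.sel)
qed

lemma frac_lap_pairing:
  fixes f h :: "real ^ 'n \<Rightarrow> real"
  assumes "wiener f" "integrable torus h"
  shows "((\<lambda>k. (2 * pi) ^ CARD('n) * (norm (freq k) powr s * Re (fourier_coeff f k * cnj (fourier_coeff h k)))) has_sum (LINT x|torus. frac_lap s f x * h x)) UNIV"
  using integral_fourier_series[OF frac_lap_summable[OF assms(1)] assms(2)]
  by (simp only: frac_lap_def[symmetric] mult.assoc Re_of_real_mult)

end

text \<open>The L2 representative \<open>p\<close> and the continuous one share their coefficients,
  so their difference annihilates continuous periodic functions. That is enough, as p occurs only
  under integrals.\<close>

lemma has_frac_laplacian_integral: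
  assumes fs: "has_frac_laplacian s f p" and f: "wiener f" and s: "0 < s" "s \<le> 1"
    and G: "continuous_on UNIV G" "torus_periodic G"
  shows "(LINT x|torus. G x * p x) = (LINT x|torus. G x * frac_lap s f x)"
proof -
  note c = frac_lap_continuous[OF s f, of UNIV]
  have p: "integrable torus p" using fs by (simp add: has_frac_laplacian_def integrable_torus_L2)
  have "(LINT x|torus. G x * (p x - frac_lap s f x)) = 0"
  proof (rule integral_eq_0_if_fourier_coeff_eq_0[OF _ _ G])
    show "integrable torus (\<lambda>x. p x - frac_lap s f x)" by (rule Bochner_Integration.integrable_diff[OF p integrable_continuous_torus[OF c]])
    show "fourier_coeff (\<lambda>x. p x - frac_lap s f x) k = 0" for k
      using fs by (subst fourier_coeff_diff[OF p integrable_continuous_torus[OF c]]) (simp add: fourier_coeff_frac_lap[OF s f] has_frac_laplacian_def)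
  qed
  then show ?thesis
    using integrable_mult_continuous_torus[OF G(1) p] integrable_mult_continuous_torus[OF G(1) integrable_continuous_torus[OF c]]
    by (simp add: right_diff_distrib)
qed

text \<open>The symbol is real, so both sides are the same Parseval sum. The roles differ:
  \<open>f\<close> is a Wiener function, while \<open>g\<close>, later u F(u), is only known to have
  a fractional Laplacian in L2.\<close>

lemma has_frac_laplacian_symmetric:
  assumes gq: "has_frac_laplacian s g q" and f: "wiener f" and s: "0 < s" "s \<le> 1"
  shows "(LINT x|torus. f x * q x) = (LINT x|torus. frac_lap s f x * g x)"
proof (rule has_sum_unique)
  have q: "integrable torus q" "integrable torus g" "\<And>k. fourier_coeff q k = of_real (norm (freq k) powr s) * fourier_coeff g k"
    using gq by (auto simp: has_frac_laplacian_def integrable_torus_L2)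
  show "((\<lambda>k. (2 * pi) ^ CARD('a) * Re (fourier_coeff f k * cnj (fourier_coeff q k))) has_sum (LINT x|torus. f x * q x)) UNIV"
    by (rule wiener_pairing[OF f q(1)])
  have "Re (fourier_coeff f k * cnj (fourier_coeff q k)) = norm (freq k) powr s * Re (fourier_coeff f k * cnj (fourier_coeff g k))" for k
    unfolding q(3) complex_cnj_mult complex_cnj_complex_of_real mult.left_commute[of "fourier_coeff f k"] Re_of_real_mult ..
  then show "((\<lambda>k. (2 * pi) ^ CARD('a) * Re (fourier_coeff f k * cnj (fourier_coeff q k))) has_sum (LINT x|torus. frac_lap s f x * g x)) UNIV"
    using frac_lap_pairing[OF s f q(2)] by simp
qed

section \<open>Sobolev embedding\<close>

lemma int_powr_summable:
  fixes p :: real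
  assumes "p > 1 / 2"
  shows "(\<lambda>i::int. (1 + (of_int i)\<^sup>2) powr (- p)) summable_on (UNIV :: int set)"
proof -
  have n: "(\<lambda>n::nat. (1 + (real n)\<^sup>2) powr (- p)) summable_on UNIV"
  proof (rule summable_nonneg_imp_summable_on)
    show "summable (\<lambda>n::nat. (1 + (real n)\<^sup>2) powr (- p))"
    proof (rule summable_comparison_test)
      show "summable (\<lambda>n::nat. real n powr (- 2 * p))"
        using assms by (simp add: summable_real_powr_iff)
      have "(1 + (real n)\<^sup>2) powr (- p) \<le> real n powr (- 2 * p)" if "n \<ge> 1" for n
      proof -
        have "(1 + (real n)\<^sup>2) powr (- p) \<le> ((real n)\<^sup>2) powr (- p)"
          using that assms by (intro powr_mono2') auto
        also have "\<dots> = real n powr (- 2 * p)"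
          using that by (simp add: powr_powr flip: powr_numeral)
        finally show ?thesis .
      qed
      then show "\<exists>N. \<forall>n\<ge>N. norm ((1 + (real n)\<^sup>2) powr (- p)) \<le> real n powr (- 2 * p)" by auto
    qed
  qed simp
  have "(\<lambda>i::int. (1 + (of_int i)\<^sup>2) powr (- p)) summable_on (range int \<union> range (\<lambda>n. - int n))"
  proof (rule summable_on_union)
    show "(\<lambda>i::int. (1 + (of_int i)\<^sup>2) powr (- p)) summable_on range int"
      using n by (subst summable_on_reindex) (auto simp: comp_def)
    show "(\<lambda>i::int. (1 + (of_int i)\<^sup>2) powr (- p)) summable_on range (\<lambda>n. - int n)"
      using n by (subst summable_on_reindex) (auto simp: comp_def inj_def)
  qed
  moreover have "range int \<union> range (\<lambda>n. - int n) = UNIV"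
    by (auto intro: int_cases2)
  ultimately show ?thesis by simp
qed

text \<open>Dominate by a product over coordinates: 1 + |k|^2 is at least every 1 + k_j^2, and
  splitting the exponent evenly leaves r/d > 1/2 for each coordinate. Finite sums over boxes then
  factor into one-dimensional ones.\<close>

lemma lattice_powr_summable:
  assumes r: "r > real CARD('n) / 2"
  shows "(\<lambda>k::int^'n. (1 + (norm (freq k))\<^sup>2) powr (- r)) summable_on UNIV"
proof -
  define p where "p = r / real CARD('n)"
  have d: "real CARD('n) > 0" by simp
  have p: "p > 1 / 2" using r d by (simp add: p_def field_simps)
  define a where "a i = (1 + (of_int i)\<^sup>2) powr (- p)" for i :: int
  have a0: "a i \<ge> 0" for i by (simp add: a_def)
  define S where "S = infsum a UNIV"
  have a: "a summable_on UNIV" using int_powr_summable[OF p] by (simp add: a_def[abs_def])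
  have le: "(1 + (norm (freq k))\<^sup>2) powr (- r) \<le> (\<Prod>j\<in>UNIV. a (k $ j))" for k :: "int ^ 'n"
  proof -
    have "- r = - p * real CARD('n)" using d by (simp add: p_def)
    then have "(1 + (norm (freq k))\<^sup>2) powr (- r) = ((1 + (norm (freq k))\<^sup>2) powr (- p)) powr real CARD('n)"
      by (simp only: powr_powr)
    also have "\<dots> = ((1 + (norm (freq k))\<^sup>2) powr (- p)) ^ CARD('n)"
      by (rule powr_realpow) (metis add_pos_nonneg powr_gt_zero zero_le_power2 zero_less_one less_irrefl)
    also have "\<dots> = (\<Prod>j\<in>(UNIV::'n set). (1 + (norm (freq k))\<^sup>2) powr (- p))"
      by simp
    also have "\<dots> \<le> (\<Prod>j\<in>UNIV. a (k $ j))"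
    proof (rule prod_mono)
      fix j :: 'n
      have "\<bar>freq k $ j\<bar> \<le> norm (freq k)" by (rule component_le_norm_cart)
      then have "(of_int (k $ j))\<^sup>2 \<le> (norm (freq k))\<^sup>2" by (simp add: freq_def abs_le_square_iff[symmetric])
      then show "0 \<le> (1 + (norm (freq k))\<^sup>2) powr (- p) \<and> (1 + (norm (freq k))\<^sup>2) powr (- p) \<le> a (k $ j)"
        unfolding a_def using p by (auto intro!: powr_mono2' simp: add_pos_nonneg)
    qed
    finally show ?thesis .
  qed
  show ?thesis
  proof (rule nonneg_bdd_above_summable_on)
    show "bdd_above (sum (\<lambda>k::int^'n. (1 + (norm (freq k))\<^sup>2) powr (- r)) ` {F. F \<subseteq> UNIV \<and> finite F})"
    proof (rule bdd_aboveI2)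
      fix F :: "(int^'n) set" assume "F \<in> {F. F \<subseteq> UNIV \<and> finite F}"
      then have F: "finite F" by simp
      \<comment> \<open>\<open>B j\<close> is the projection of \<open>F\<close> to coordinate
        \<open>j\<close>; enlarging \<open>F\<close> to the box of its projections makes the sum a
        product.\<close>
      define B where "B j = (\<lambda>k. k $ j) ` F" for j :: 'n
      have B: "finite (B j)" for j using F by (simp add: B_def)
      have "(\<Sum>k\<in>F. (1 + (norm (freq k))\<^sup>2) powr (- r)) \<le> (\<Sum>k\<in>F. \<Prod>j\<in>UNIV. a (k $ j))"
        by (intro sum_mono le)
      also have "\<dots> = (\<Sum>g\<in>(\<lambda>k. ($) k) ` F. \<Prod>j\<in>UNIV. a (g j))"
        by (subst sum.reindex) (auto simp: inj_on_def vec_eq_iff)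
      also have "\<dots> \<le> (\<Sum>g\<in>PiE UNIV B. \<Prod>j\<in>UNIV. a (g j))"
        by (intro sum_mono2 finite_PiE prod_nonneg) (auto simp: B a0, auto simp: B_def)
      also have "\<dots> = (\<Prod>j\<in>UNIV. \<Sum>i\<in>B j. a i)"
        using B by (intro prod_sum_PiE[symmetric]) auto
      also have "\<dots> \<le> (\<Prod>j\<in>(UNIV::'n set). S)"
        unfolding S_def using B by (intro prod_mono conjI sum_nonneg finite_sum_le_infsum[OF a]) (auto simp: a0)
      finally show "(\<Sum>k\<in>F. (1 + (norm (freq k))\<^sup>2) powr (- r)) \<le> (\<Prod>j\<in>(UNIV::'n set). S)" .
    qed
  qed simp
qed

text \<open>Cauchy-Schwarz between (1 + |k|^2)^(-r/2) and (1 + |k|^2)^(m/2) |c_k|: with r = m - 5/4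
  the product of the two powers is exactly \<open>wiener_weight\<close>.\<close>

lemma sobolev_imp_wiener:
  assumes m: "real m > real CARD('n) / 2 + 1"
  obtains C where "C \<ge> 0"
    "\<And>f :: real ^ 'n \<Rightarrow> real. continuous_on UNIV f \<Longrightarrow> sobolev_space m f \<Longrightarrow> wiener f \<and> wiener_norm f \<le> C * sobolev_norm m f"
proof -
  define r where "r = real m - 5 / 4"
  have "2 * real m > real CARD('n) + 2" using m by simp
  then have "2 * m > CARD('n) + 2" by linarith
  \<comment> \<open>Integrality enters here: the strict inequality improves by a whole unit, hence r
    >= d/2 + 1/4.\<close>
  then have "2 * m \<ge> CARD('n) + 3" by linarith
  then have r: "r > real CARD('n) / 2" unfolding r_def by linarith
  define T where "T = (\<Sum>\<^sub>\<infinity>k::int^'n. (1 + (norm (freq k))\<^sup>2) powr (- r))"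
  note sT = lattice_powr_summable[OF r]
  have T0: "T \<ge> 0" unfolding T_def by (intro infsum_nonneg) auto
  let ?V = "(2 * pi) ^ CARD('n) :: real"
  have V: "?V > 0" by simp
  show ?thesis
  proof (rule that[of "sqrt (T / ?V)"])
    show "sqrt (T / ?V) \<ge> 0" using T0 by simp
    fix f :: "real ^ 'n \<Rightarrow> real"
    assume f: "continuous_on UNIV f" and sob: "sobolev_space m f"
    define g where "g k = (1 + (norm (freq k))\<^sup>2) ^ m * (cmod (fourier_coeff f k))\<^sup>2" for k
    have g: "g summable_on UNIV" "torus_L2 f" using sob by (auto simp: sobolev_space_def g_def[abs_def])
    have g0: "g k \<ge> 0" for k by (simp add: g_def)
    define N where "N = infsum g UNIV"
    have N0: "N \<ge> 0" unfolding N_def by (intro infsum_nonneg g0)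
    have fin: "(\<Sum>k\<in>K. wiener_weight k * cmod (fourier_coeff f k)) \<le> sqrt T * sqrt N" if K: "finite K" for K
    proof -
      have e: "wiener_weight k * cmod (fourier_coeff f k) = \<bar>sqrt ((1 + (norm (freq k))\<^sup>2) powr (- r))\<bar> * \<bar>sqrt (g k)\<bar>" for k
      proof -
        have x: "1 + (norm (freq k))\<^sup>2 > 0" by (simp add: add_pos_nonneg)
        have "(1 + (norm (freq k))\<^sup>2) powr (- r) * (1 + (norm (freq k))\<^sup>2) ^ m = (1 + (norm (freq k))\<^sup>2) powr (- r + m)"
          by (simp only: powr_add powr_realpow[OF x])
        also have "- r + m = 5/8 + 5/8" by (simp add: r_def)
        also have "(1 + (norm (freq k))\<^sup>2) powr (5/8 + 5/8) = (wiener_weight k)\<^sup>2"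
          unfolding powr_add wiener_weight_def power2_eq_square ..
        finally have "(1 + (norm (freq k))\<^sup>2) powr (- r) * g k = (wiener_weight k * cmod (fourier_coeff f k))\<^sup>2"
          by (simp add: g_def power_mult_distrib mult.assoc[symmetric])
        then have "sqrt ((1 + (norm (freq k))\<^sup>2) powr (- r) * g k) = wiener_weight k * cmod (fourier_coeff f k)"
          by (simp add: wiener_weight_nonneg abs_mult)
        then show ?thesis by (simp add: real_sqrt_mult g0)
      qed
      have "(\<Sum>k\<in>K. wiener_weight k * cmod (fourier_coeff f k)) \<le> L2_set (\<lambda>k. sqrt ((1 + (norm (freq k))\<^sup>2) powr (- r))) K * L2_set (\<lambda>k. sqrt (g k)) K"
        unfolding e by (rule L2_set_mult_ineq)
      also have "\<dots> \<le> sqrt T * sqrt N"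
        unfolding L2_set_def
      proof (intro mult_mono real_sqrt_le_mono)
        have "(\<Sum>k\<in>K. (sqrt ((1 + (norm (freq k))\<^sup>2) powr (- r)))\<^sup>2) = (\<Sum>k\<in>K. (1 + (norm (freq k))\<^sup>2) powr (- r))" by simp
        also have "\<dots> \<le> T" unfolding T_def using K by (intro finite_sum_le_infsum[OF sT]) auto
        finally show "(\<Sum>k\<in>K. (sqrt ((1 + (norm (freq k))\<^sup>2) powr (- r)))\<^sup>2) \<le> T" .
        have "(\<Sum>k\<in>K. (sqrt (g k))\<^sup>2) = (\<Sum>k\<in>K. g k)" by (simp add: g0)
        also have "\<dots> \<le> N" unfolding N_def using K by (intro finite_sum_le_infsum[OF g(1)]) (auto simp: g0)
        finally show "(\<Sum>k\<in>K. (sqrt (g k))\<^sup>2) \<le> N" .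
      qed (auto simp: T0 intro: sum_nonneg)
      finally show ?thesis .
    qed
    have s: "(\<lambda>k. wiener_weight k * cmod (fourier_coeff f k)) summable_on UNIV"
      by (rule nonneg_bdd_above_summable_on) (auto intro!: bdd_aboveI2 fin simp: wiener_weight_nonneg)
    have w: "wiener f" unfolding wiener_def using f s g(2) by (simp add: torus_L2_def)
    have "wiener_norm f \<le> sqrt T * sqrt N"
      unfolding wiener_norm_def by (rule infsum_le_finite_sums[OF s fin])
    also have "\<dots> = sqrt (T / ?V) * sqrt (?V * N)"
      using V by (simp add: real_sqrt_mult[symmetric] field_simps)
    also have "sqrt (?V * N) = sobolev_norm m f" by (simp add: sobolev_norm_def N_def g_def[abs_def])
    finally show "wiener f \<and> wiener_norm f \<le> sqrt (T / ?V) * sobolev_norm m f" using w by simp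
  qed
qed

section \<open>Integral inequalities for the fractional Laplacian\<close>

lemma fourier_coeff_shift:
  fixes g :: "real ^ 'n \<Rightarrow> real"
  assumes g: "continuous_on UNIV g" "torus_periodic g"
  shows "fourier_coeff (\<lambda>x. g (x + h)) k = cis (freq k \<bullet> h) * fourier_coeff g k"
proof -
  let ?F = "\<lambda>x. complex_of_real (g x) * cis (- (freq k \<bullet> x))"
  have c: "continuous_on UNIV ?F" by (intro continuous_intros g)
  have p: "torus_periodic ?F"
    using torus_periodic_comp2[OF g(2) torus_periodic_cis[of "- k"], of "\<lambda>a b. complex_of_real a * b"] by (simp add: freq_uminus)
  have "(LINT x|torus. complex_of_real (g (x + h)) * cis (- (freq k \<bullet> x))) = (LINT x|torus. cis (freq k \<bullet> h) * ?F (x + h))"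
    by (intro Bochner_Integration.integral_cong refl) (simp add: inner_add_right cis_mult mult.left_commute)
  also have "\<dots> = cis (freq k \<bullet> h) * (LINT x|torus. ?F x)"
    by (simp only: integral_mult_right_zero integral_torus_shift[OF c p])
  finally show ?thesis by (simp add: fourier_coeff_def)
qed

lemma cmod_fourier_coeff_le:
  fixes g :: "real ^ 'n \<Rightarrow> real"
  shows "(2 * pi) ^ CARD('n) * cmod (fourier_coeff g k) \<le> (LINT x|torus. \<bar>g x\<bar>)"
proof -
  have "(2 * pi) ^ CARD('n) * cmod (fourier_coeff g k) = cmod (LINT x|torus. complex_of_real (g x) * cis (- (freq k \<bullet> x)))"
    by (simp add: fourier_coeff_def norm_divide norm_mult norm_power)
  also have "\<dots> \<le> (LINT x|torus. cmod (complex_of_real (g x) * cis (- (freq k \<bullet> x))))"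
    by (rule integral_norm_bound)
  finally show ?thesis by (simp add: norm_mult)
qed

text \<open>By Parseval the pairing is a sum of \<beta> k |k|^s, so \<open>levy_lower_bound\<close>
  reduces the claim to centred differences. There it is elementary: b w times the centred difference
  of w exceeds b times that of w^2/2 by weighted squares, and translation then moves the difference
  from w^2 to b.\<close>

lemma cordoba_inequality:
  fixes w b :: "real ^ 'n \<Rightarrow> real"
  assumes s: "0 < s" "s \<le> 1" and w: "wiener w"
    and b: "continuous_on UNIV b" "torus_periodic b" "\<And>x. 0 \<le> b x"
    and A: "A \<ge> 0" "\<And>x h. \<bar>b (x + h) + b (x - h) - 2 * b x\<bar> \<le> A * modulus h"
  shows "- (10 + 16 * real CARD('n)) * (A / 4 * (LINT x|torus. (w x)\<^sup>2)) \<le> (LINT x|torus. frac_lap s w x * (b x * w x))"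
proof -
  let ?V = "(2 * pi) ^ CARD('n) :: real"
  note wc = wiener_continuous[OF w] and wp = wiener_periodic[OF w]
  define E where "E = (LINT x|torus. (w x)\<^sup>2)"
  have E: "E \<ge> 0" by (simp add: E_def)
  define g where "g x = b x * w x" for x
  have gi: "integrable torus g" unfolding g_def by (intro integrable_continuous_torus continuous_on_mult b wc)
  define \<beta> where "\<beta> k = ?V * Re (fourier_coeff w k * cnj (fourier_coeff g k))" for k
  have \<beta>_le: "\<bar>\<beta> k\<bar> \<le> (LINT x|torus. \<bar>g x\<bar>) * cmod (fourier_coeff w k)" for k
  proof -
    have "\<bar>\<beta> k\<bar> = ?V * \<bar>Re (fourier_coeff w k * cnj (fourier_coeff g k))\<bar>" by (simp add: \<beta>_def abs_mult)
    also have "\<dots> \<le> ?V * cmod (fourier_coeff w k * cnj (fourier_coeff g k))"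
      by (intro mult_left_mono abs_Re_le_cmod) auto
    also have "\<dots> = (?V * cmod (fourier_coeff g k)) * cmod (fourier_coeff w k)" by (simp add: norm_mult)
    also have "\<dots> \<le> (LINT x|torus. \<bar>g x\<bar>) * cmod (fourier_coeff w k)"
      by (intro mult_right_mono cmod_fourier_coeff_le) auto
    finally show ?thesis .
  qed
  have sm: "(\<lambda>k. \<bar>\<beta> k\<bar> * wiener_weight k) summable_on UNIV"
  proof (rule summable_on_comparison_test)
    show "(\<lambda>k. (LINT x|torus. \<bar>g x\<bar>) * (wiener_weight k * cmod (fourier_coeff w k))) summable_on UNIV"
      using w by (intro summable_on_cmult_right) (simp add: wiener_def)
    show "\<bar>\<beta> k\<bar> * wiener_weight k \<le> (LINT x|torus. \<bar>g x\<bar>) * (wiener_weight k * cmod (fourier_coeff w k))" for k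
      using mult_right_mono[OF \<beta>_le[of k] wiener_weight_nonneg[of k]] by (simp add: ac_simps)
  qed (simp add: wiener_weight_nonneg)
  have lb: "- (A / 4 * E) * modulus h \<le> (\<Sum>\<^sub>\<infinity>k. \<beta> k * (1 - cos (freq k \<bullet> h)))" for h
  proof -
    define \<mu> where "\<mu> k = complex_of_real (1 - cos (freq k \<bullet> h))" for k :: "int ^ 'n"
    have \<mu>: "cmod (\<mu> k) \<le> 2 * wiener_weight k" for k
    proof -
      have "cmod (\<mu> k) \<le> 2" unfolding \<mu>_def norm_of_real using cos_le_one[of "freq k \<bullet> h"] cos_ge_minus_one[of "freq k \<bullet> h"] by linarith
      then show ?thesis using wiener_weight_ge_1[of k] by linarith
    qed
    note sum = wiener_multiplier_summable[OF w \<mu>]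
    define D where "D x = w x - (w (x + h) + w (x - h)) / 2" for x
    have D: "fourier_series (\<lambda>k. \<mu> k * fourier_coeff w k) x = D x" for x
    proof (rule fourier_series_eqI[OF sum])
      show "((\<lambda>k. Re (\<mu> k * fourier_coeff w k * cis (freq k \<bullet> x))) has_sum D x) UNIV"
        using wiener_second_difference_has_sum[OF w, of h x] by (simp only: \<mu>_def mult.assoc Re_of_real_mult D_def)
    qed
    have "((\<lambda>k. \<beta> k * (1 - cos (freq k \<bullet> h))) has_sum (LINT x|torus. D x * g x)) UNIV"
    proof -
      have "?V * Re (\<mu> k * fourier_coeff w k * cnj (fourier_coeff g k)) = \<beta> k * (1 - cos (freq k \<bullet> h))" for k
        unfolding \<mu>_def \<beta>_def mult.assoc Re_of_real_mult by simp
      then show ?thesis using integral_fourier_series[OF sum gi] by (simp only: D)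
    qed
    then have S: "(\<Sum>\<^sub>\<infinity>k. \<beta> k * (1 - cos (freq k \<bullet> h))) = (LINT x|torus. D x * g x)"
      by (rule infsumI)
    have cw: "continuous_on UNIV (\<lambda>x. w (x + h))" "continuous_on UNIV (\<lambda>x. w (x - h))"
      by (auto intro!: continuous_on_compose2[OF wc[of UNIV]] continuous_intros)
    have cb: "continuous_on UNIV (\<lambda>x. b (x + h))" "continuous_on UNIV (\<lambda>x. b (x - h))"
      by (auto intro!: continuous_on_compose2[OF b(1)] continuous_intros)
    have per: "torus_periodic (\<lambda>x. b (x + r) * (w x)\<^sup>2)" for r
      using torus_periodic_comp2[OF torus_periodic_shift[OF b(2)] wp, of "\<lambda>a b. a * b\<^sup>2"] .
    \<comment> \<open>Translation invariance trades a shift of \<open>w\<close> for the opposite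
      shift of \<open>b\<close>.\<close>
    have sh1: "(LINT x|torus. b x * (w (x + h))\<^sup>2) = (LINT x|torus. b (x - h) * (w x)\<^sup>2)"
      using integral_torus_shift[OF _ per[of "- h"], of h] cb by (simp add: continuous_on_mult continuous_on_power wc)
    have sh2: "(LINT x|torus. b x * (w (x - h))\<^sup>2) = (LINT x|torus. b (x + h) * (w x)\<^sup>2)"
      using integral_torus_shift[OF _ per[of h], of "- h"] cb by (simp add: continuous_on_mult continuous_on_power wc)
    note ints = integrable_continuous_torus continuous_on_mult continuous_on_power continuous_on_diff continuous_on_add continuous_on_const b(1) wc cb cw
    have "- (A / 4 * E) * modulus h = (LINT x|torus. - (A * modulus h / 4) * (w x)\<^sup>2)"
      by (simp add: E_def)
    also have "\<dots> \<le> (LINT x|torus. (1/2) * (b x * (w x)\<^sup>2) - (1/4) * (b (x + h) * (w x)\<^sup>2) - (1/4) * (b (x - h) * (w x)\<^sup>2))"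
    proof (rule integral_mono)
      show "integrable torus (\<lambda>x. - (A * modulus h / 4) * (w x)\<^sup>2)"
        "integrable torus (\<lambda>x. (1/2) * (b x * (w x)\<^sup>2) - (1/4) * (b (x + h) * (w x)\<^sup>2) - (1/4) * (b (x - h) * (w x)\<^sup>2))"
        by (intro ints)+
      fix x
      \<comment> \<open>The second difference of \<open>b\<close> appears with factor 1/4, which is
        the origin of \<open>A / 4\<close>.\<close>
      have "- (A * modulus h / 4) \<le> (2 * b x - b (x + h) - b (x - h)) / 4"
        using A(2)[of x h] by (simp add: abs_le_iff)
      from mult_right_mono[OF this, of "(w x)\<^sup>2"]
      show "- (A * modulus h / 4) * (w x)\<^sup>2 \<le> (1/2) * (b x * (w x)\<^sup>2) - (1/4) * (b (x + h) * (w x)\<^sup>2) - (1/4) * (b (x - h) * (w x)\<^sup>2)"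
        by (simp add: field_simps)
    qed
    also have "\<dots> = (1/2) * (LINT x|torus. b x * (w x)\<^sup>2) - (1/4) * (LINT x|torus. b (x + h) * (w x)\<^sup>2) - (1/4) * (LINT x|torus. b (x - h) * (w x)\<^sup>2)"
      by (subst Bochner_Integration.integral_diff, (intro ints)+)+ (simp only: integral_mult_right_zero)
    also have "\<dots> = (1/2) * (LINT x|torus. b x * (w x)\<^sup>2) - (1/4) * (LINT x|torus. b x * (w (x - h))\<^sup>2) - (1/4) * (LINT x|torus. b x * (w (x + h))\<^sup>2)"
      by (simp only: sh1 sh2)
    also have "\<dots> = (LINT x|torus. (1/2) * (b x * (w x)\<^sup>2) - (1/4) * (b x * (w (x - h))\<^sup>2) - (1/4) * (b x * (w (x + h))\<^sup>2))"
      by (subst Bochner_Integration.integral_diff, (intro ints)+)+ (simp only: integral_mult_right_zero)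
    also have "\<dots> \<le> (LINT x|torus. D x * g x)"
    proof (rule integral_mono)
      show "integrable torus (\<lambda>x. (1/2) * (b x * (w x)\<^sup>2) - (1/4) * (b x * (w (x - h))\<^sup>2) - (1/4) * (b x * (w (x + h))\<^sup>2))"
        by (intro ints)
      have "(\<lambda>x. D x * g x) = (\<lambda>x. (w x - (1/2) * (w (x + h) + w (x - h))) * (b x * w x))"
        by (simp add: D_def g_def fun_eq_iff)
      then show "integrable torus (\<lambda>x. D x * g x)" by (simp only:) (intro ints)
      fix x
      \<comment> \<open>The discrete Cordoba-Cordoba identity: the surplus is a sum of squares with
        the nonnegative weight b.\<close>
      have "D x * g x - ((1/2) * (b x * (w x)\<^sup>2) - (1/4) * (b x * (w (x - h))\<^sup>2) - (1/4) * (b x * (w (x + h))\<^sup>2)) =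
        b x * (((w x - w (x + h))\<^sup>2 + (w x - w (x - h))\<^sup>2) / 4)"
        by (simp add: D_def g_def power2_eq_square field_simps)
      also have "\<dots> \<ge> 0" by (intro mult_nonneg_nonneg b) auto
      finally show "(1/2) * (b x * (w x)\<^sup>2) - (1/4) * (b x * (w (x - h))\<^sup>2) - (1/4) * (b x * (w (x + h))\<^sup>2) \<le> D x * g x" by simp
    qed
    finally show ?thesis unfolding S .
  qed
  have "- (10 + 16 * real CARD('n)) * (A / 4 * E) \<le> (\<Sum>\<^sub>\<infinity>k. \<beta> k * norm (freq k) powr s)"
    by (rule levy_lower_bound[OF _ s sm lb]) (use A E in simp)
  also have "\<dots> = (LINT x|torus. frac_lap s w x * g x)"
    using infsumI[OF frac_lap_pairing[OF s w gi]] by (simp add: \<beta>_def ac_simps)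
  finally show ?thesis unfolding E_def g_def .
qed

section \<open>Pairings with Lipschitz and Sobolev functions\<close>

lemma cis_difference_quotient: "((\<lambda>r. (cmod (cis (a * r) - 1) / r)\<^sup>2) \<longlongrightarrow> a\<^sup>2) (at (0::real))"
proof -
  have "((\<lambda>r. 4 * (sin (a / 2 * r) / r)\<^sup>2) \<longlongrightarrow> 4 * (a / 2)\<^sup>2) (at (0::real))"
  proof (rule tendsto_mult[OF tendsto_const tendsto_power])
    have "((\<lambda>r. sin (a / 2 * r)) has_real_derivative cos (a / 2 * 0) * (a / 2)) (at 0)"
      by (auto intro!: derivative_eq_intros)
    then show "((\<lambda>r. sin (a / 2 * r) / r) \<longlongrightarrow> a / 2) (at 0)"
      by (simp add: DERIV_def)
  qed
  moreover have "(cmod (cis (a * r) - 1) / r)\<^sup>2 = 4 * (sin (a / 2 * r) / r)\<^sup>2" for r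
  proof -
    have "(cmod (cis t - 1))\<^sup>2 = 2 - 2 * cos t" for t
    proof -
      have "(cmod (cis t - 1))\<^sup>2 = (cos t - 1)\<^sup>2 + (sin t)\<^sup>2" by (simp add: cmod_power2)
      also have "\<dots> = 2 - 2 * cos t" using sin_cos_squared_add[of t] by (simp add: power2_eq_square algebra_simps)
      finally show ?thesis .
    qed
    moreover have "cos (a * r) = 1 - 2 * (sin (a / 2 * r))\<^sup>2"
      using cos_double_sin[of "a / 2 * r"] by simp
    ultimately show ?thesis by (simp add: power_divide)
  qed
  moreover have "4 * (a / 2)\<^sup>2 = a\<^sup>2" by (simp add: power2_eq_square)
  ultimately show ?thesis by (simp only:)
qed

text \<open>Bessel's inequality is applied to difference quotients in direction j, which are bounded
  by \<open>L\<close>; in the finite sum r -> 0 turns |cis (k_j r) - 1| / |r| into |k_j|. Summing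
  over directions gives the factor d. This replaces almost everywhere differentiability of Lipschitz
  functions.\<close>

lemma lipschitz_fourier_coeff:
  fixes g :: "real ^ 'n \<Rightarrow> real"
  assumes g: "continuous_on UNIV g" "torus_periodic g"
    and L: "\<And>x h. \<bar>g (x + h) - g x\<bar> \<le> L * norm h" and K: "finite K"
  shows "(\<Sum>k\<in>K. (norm (freq k) * cmod (fourier_coeff g k))\<^sup>2) \<le> real CARD('n) * L\<^sup>2"
proof -
  let ?V = "(2 * pi) ^ CARD('n) :: real"
  have V: "?V > 0" by simp
  have comp: "(\<Sum>k\<in>K. (freq k $ j * cmod (fourier_coeff g k))\<^sup>2) \<le> L\<^sup>2" for j
  proof -
    have fr: "(\<Sum>k\<in>K. (cmod (cis (freq k $ j * r) - 1) / r)\<^sup>2 * (cmod (fourier_coeff g k))\<^sup>2) \<le> L\<^sup>2" if r: "r \<noteq> 0" for r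
    proof -
      define G where "G x = (1 / r) * (g (x + axis j r) - g x)" for x
      have c1: "continuous_on UNIV (\<lambda>x. g (x + axis j r))"
        by (auto intro!: continuous_on_compose2[OF g(1)] continuous_intros)
      have c: "continuous_on UNIV G" unfolding G_def by (intro continuous_on_mult continuous_on_diff continuous_on_const c1 g)
      have p: "torus_periodic G"
        unfolding G_def using torus_periodic_comp2[OF torus_periodic_shift[OF g(2), of "axis j r"] g(2), of "\<lambda>a b. (1 / r) * (a - b)"] .
      have co: "fourier_coeff G k = of_real (1 / r) * ((cis (freq k $ j * r) - 1) * fourier_coeff g k)" for k
      proof -
        have "fourier_coeff G k = of_real (1 / r) * (fourier_coeff (\<lambda>x. g (x + axis j r)) k - fourier_coeff g k)"
          unfolding G_def fourier_coeff_cmult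
          by (simp only: fourier_coeff_diff[OF integrable_continuous_torus[OF c1] integrable_continuous_torus[OF g(1)]])
        then show ?thesis by (simp add: fourier_coeff_shift[OF g] inner_axis algebra_simps)
      qed
      have "(\<Sum>k\<in>K. (cmod (cis (freq k $ j * r) - 1) / r)\<^sup>2 * (cmod (fourier_coeff g k))\<^sup>2) = (\<Sum>k\<in>K. (cmod (fourier_coeff G k))\<^sup>2)"
        unfolding co by (simp add: norm_mult norm_divide power_mult_distrib power_divide)
      moreover have "?V * (\<Sum>k\<in>K. (cmod (fourier_coeff G k))\<^sup>2) \<le> (LINT x|torus. (G x)\<^sup>2)"
        by (rule bessel_finite[OF torus_L2_continuous[OF c p] K])
      moreover have "(LINT x|torus. (G x)\<^sup>2) \<le> (LINT x|(torus :: (real^'n) measure). L\<^sup>2)"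
      proof (rule integral_mono)
        show "integrable torus (\<lambda>x. (G x)\<^sup>2)" by (intro integrable_continuous_torus continuous_on_power c)
        show "(G x)\<^sup>2 \<le> L\<^sup>2" for x
        proof -
          have "\<bar>G x\<bar> \<le> L" using L[of x "axis j r"] r
            by (simp add: G_def abs_mult pos_divide_le_eq norm_eq_sqrt_inner inner_axis_axis)
          then show ?thesis by (metis abs_ge_zero power2_abs power_mono)
        qed
      qed simp
      moreover have "(LINT x|(torus :: (real^'n) measure). L\<^sup>2) = ?V * L\<^sup>2" by (simp add: measure_torus)
      ultimately have "?V * (\<Sum>k\<in>K. (cmod (cis (freq k $ j * r) - 1) / r)\<^sup>2 * (cmod (fourier_coeff g k))\<^sup>2) \<le> ?V * L\<^sup>2"
        by (metis (no_types, lifting) order_trans)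
      then show ?thesis using V by (simp only: mult_le_cancel_left_pos)
    qed
    have "((\<lambda>r. \<Sum>k\<in>K. (cmod (cis (freq k $ j * r) - 1) / r)\<^sup>2 * (cmod (fourier_coeff g k))\<^sup>2) \<longlongrightarrow> (\<Sum>k\<in>K. (freq k $ j)\<^sup>2 * (cmod (fourier_coeff g k))\<^sup>2)) (at 0)"
      by (intro tendsto_sum tendsto_mult tendsto_const cis_difference_quotient)
    then have "(\<Sum>k\<in>K. (freq k $ j)\<^sup>2 * (cmod (fourier_coeff g k))\<^sup>2) \<le> L\<^sup>2"
      by (rule tendsto_upperbound) (auto simp: eventually_at_filter fr)
    then show ?thesis by (simp add: power_mult_distrib)
  qed
  have "(\<Sum>k\<in>K. (norm (freq k) * cmod (fourier_coeff g k))\<^sup>2) = (\<Sum>k\<in>K. \<Sum>j\<in>UNIV. (freq k $ j * cmod (fourier_coeff g k))\<^sup>2)"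
    by (intro sum.cong refl)
      (simp add: power_mult_distrib sum_distrib_right[symmetric] norm_eq_sqrt_inner inner_vec_def sum_nonneg power2_eq_square[symmetric])
  also have "\<dots> = (\<Sum>j\<in>UNIV. \<Sum>k\<in>K. (freq k $ j * cmod (fourier_coeff g k))\<^sup>2)" by (rule sum.swap)
  also have "\<dots> \<le> (\<Sum>j\<in>(UNIV::'n set). L\<^sup>2)" by (intro sum_mono comp)
  finally show ?thesis by simp
qed

lemma L2_norm_nonneg: "0 \<le> L2_norm f"
  by (simp add: L2_norm_def)

lemma L2_norm_square: "(L2_norm f)\<^sup>2 = (LINT x|torus. (f x)\<^sup>2)"
  by (simp add: L2_norm_def)

lemma L2_set_fourier_coeff_le:
  fixes f :: "real ^ 'n \<Rightarrow> real"
  assumes "torus_L2 f" "finite K"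
  shows "sqrt ((2 * pi) ^ CARD('n)) * L2_set (\<lambda>k. cmod (fourier_coeff f k)) K \<le> L2_norm f"
  unfolding L2_set_def L2_norm_def real_sqrt_mult[symmetric]
  using bessel_finite[OF assms] by (rule real_sqrt_le_mono)

text \<open>Cauchy-Schwarz in frequency with all of |k|^s put on the Lipschitz factor, so that
  \<open>w\<close> contributes no more than its L2 norm.\<close>

lemma frac_lap_lipschitz_bound:
  fixes g w :: "real ^ 'n \<Rightarrow> real"
  assumes s: "0 < s" "s \<le> 1" and w: "wiener w" and g: "continuous_on UNIV g" "torus_periodic g"
    and L: "L \<ge> 0" "\<And>x h. \<bar>g (x + h) - g x\<bar> \<le> L * norm h"
  shows "(LINT x|torus. frac_lap s w x * g x) \<le> sqrt ((2 * pi) ^ CARD('n) * real CARD('n)) * L * L2_norm w"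
proof (rule has_sum_le_finite_sums[OF frac_lap_pairing[OF s w integrable_continuous_torus[OF g(1)]]])
  fix K :: "(int ^ 'n) set" assume K: "finite K"
  let ?V = "(2 * pi) ^ CARD('n) :: real"
  \<comment> \<open>Nonzero lattice points have norm at least 1, so s <= 1 makes |k|^s at most |k|,
    uniformly in s; at 0 both sides vanish.\<close>
  have le: "norm (freq k) powr s \<le> norm (freq k)" for k :: "int ^ 'n"
  proof (cases "k = 0")
    case False
    then obtain j where "k $ j \<noteq> 0" by (auto simp: vec_eq_iff)
    then have "1 \<le> \<bar>freq k $ j\<bar>" by (simp add: freq_def flip: of_int_abs)
    also have "\<dots> \<le> norm (freq k)" by (rule component_le_norm_cart)
    finally have "norm (freq k) powr s \<le> norm (freq k) powr 1" using s by (intro powr_mono) auto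
    then show ?thesis by simp
  qed (simp add: freq_zero)
  have "(\<Sum>k\<in>K. ?V * (norm (freq k) powr s * Re (fourier_coeff w k * cnj (fourier_coeff g k)))) \<le>
     (\<Sum>k\<in>K. ?V * (\<bar>cmod (fourier_coeff w k)\<bar> * \<bar>norm (freq k) * cmod (fourier_coeff g k)\<bar>))"
  proof (intro sum_mono mult_left_mono)
    fix k
    have "norm (freq k) powr s * Re (fourier_coeff w k * cnj (fourier_coeff g k)) \<le> norm (freq k) powr s * cmod (fourier_coeff w k * cnj (fourier_coeff g k))"
      by (intro mult_left_mono complex_Re_le_cmod) auto
    also have "\<dots> \<le> norm (freq k) * cmod (fourier_coeff w k * cnj (fourier_coeff g k))"
      by (intro mult_right_mono le) auto
    finally show "norm (freq k) powr s * Re (fourier_coeff w k * cnj (fourier_coeff g k)) \<le> \<bar>cmod (fourier_coeff w k)\<bar> * \<bar>norm (freq k) * cmod (fourier_coeff g k)\<bar>"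
      by (simp add: norm_mult ac_simps)
  qed simp
  also have "\<dots> = ?V * (\<Sum>k\<in>K. \<bar>cmod (fourier_coeff w k)\<bar> * \<bar>norm (freq k) * cmod (fourier_coeff g k)\<bar>)"
    by (simp only: sum_distrib_left)
  also have "\<dots> \<le> ?V * (L2_set (\<lambda>k. cmod (fourier_coeff w k)) K * L2_set (\<lambda>k. norm (freq k) * cmod (fourier_coeff g k)) K)"
    by (intro mult_left_mono L2_set_mult_ineq) auto
  also have "\<dots> = (sqrt ?V * L2_set (\<lambda>k. cmod (fourier_coeff w k)) K) * (sqrt ?V * L2_set (\<lambda>k. norm (freq k) * cmod (fourier_coeff g k)) K)"
    by simp
  also have "\<dots> \<le> L2_norm w * (sqrt ?V * (sqrt (real CARD('n)) * L))"
  proof (intro mult_mono L2_set_fourier_coeff_le wiener_L2 w K mult_left_mono)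
    have "L2_set (\<lambda>k. norm (freq k) * cmod (fourier_coeff g k)) K \<le> sqrt (real CARD('n) * L\<^sup>2)"
      unfolding L2_set_def by (intro real_sqrt_le_mono lipschitz_fourier_coeff[OF g L(2) K])
    then show "L2_set (\<lambda>k. norm (freq k) * cmod (fourier_coeff g k)) K \<le> sqrt (real CARD('n)) * L"
      using L(1) by (simp add: real_sqrt_mult)
  qed (auto simp: L2_norm_nonneg L2_set_nonneg L)
  finally show "(\<Sum>k\<in>K. ?V * (norm (freq k) powr s * Re (fourier_coeff w k * cnj (fourier_coeff g k)))) \<le> sqrt (?V * real CARD('n)) * L * L2_norm w"
    by (simp add: real_sqrt_mult ac_simps)
qed

text \<open>Done in frequency because \<open>sobolev_norm\<close> sees only coefficients, with
  weights at least 1. It transfers limits in H^(m-1) to integrals against Wiener functions.\<close>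

lemma wiener_sobolev_pairing_bound:
  fixes a h :: "real ^ 'n \<Rightarrow> real"
  assumes a: "wiener a" and h: "sobolev_space l h"
  shows "(LINT x|torus. a x * h x) \<le> L2_norm a * sobolev_norm l h"
proof -
  have hL: "torus_L2 h" and sm: "(\<lambda>k. (1 + (norm (freq k))\<^sup>2) ^ l * (cmod (fourier_coeff h k))\<^sup>2) summable_on UNIV"
    using h by (auto simp: sobolev_space_def)
  let ?V = "(2 * pi) ^ CARD('n) :: real"
  show ?thesis
  proof (rule has_sum_le_finite_sums[OF wiener_pairing[OF a integrable_torus_L2[OF hL]]])
    fix K :: "(int ^ 'n) set" assume K: "finite K"
    have "(\<Sum>k\<in>K. ?V * Re (fourier_coeff a k * cnj (fourier_coeff h k))) \<le> (\<Sum>k\<in>K. ?V * (\<bar>cmod (fourier_coeff a k)\<bar> * \<bar>cmod (fourier_coeff h k)\<bar>))"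
      by (intro sum_mono mult_left_mono order_trans[OF complex_Re_le_cmod]) (auto simp only: norm_mult complex_mod_cnj abs_norm_cancel, simp)
    also have "\<dots> = ?V * (\<Sum>k\<in>K. \<bar>cmod (fourier_coeff a k)\<bar> * \<bar>cmod (fourier_coeff h k)\<bar>)"
      by (simp only: sum_distrib_left)
    also have "\<dots> \<le> ?V * (L2_set (\<lambda>k. cmod (fourier_coeff a k)) K * L2_set (\<lambda>k. cmod (fourier_coeff h k)) K)"
      by (intro mult_left_mono L2_set_mult_ineq) auto
    also have "\<dots> = (sqrt ?V * L2_set (\<lambda>k. cmod (fourier_coeff a k)) K) * (sqrt ?V * L2_set (\<lambda>k. cmod (fourier_coeff h k)) K)"
      by simp
    also have "\<dots> \<le> L2_norm a * sobolev_norm l h"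
    proof (intro mult_mono L2_set_fourier_coeff_le wiener_L2 a K)
      have "(\<Sum>k\<in>K. (cmod (fourier_coeff h k))\<^sup>2) \<le> (\<Sum>k\<in>K. (1 + (norm (freq k))\<^sup>2) ^ l * (cmod (fourier_coeff h k))\<^sup>2)"
      proof (rule sum_mono)
        fix k :: "int ^ 'n"
        have "1 \<le> (1 + (norm (freq k))\<^sup>2) ^ l" by (rule one_le_power) simp
        from mult_right_mono[OF this, of "(cmod (fourier_coeff h k))\<^sup>2"]
        show "(cmod (fourier_coeff h k))\<^sup>2 \<le> (1 + (norm (freq k))\<^sup>2) ^ l * (cmod (fourier_coeff h k))\<^sup>2" by simp
      qed
      also have "\<dots> \<le> (\<Sum>\<^sub>\<infinity>k. (1 + (norm (freq k))\<^sup>2) ^ l * (cmod (fourier_coeff h k))\<^sup>2)"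
        by (rule finite_sum_le_infsum[OF sm K]) auto
      finally show "sqrt ?V * L2_set (\<lambda>k. cmod (fourier_coeff h k)) K \<le> sobolev_norm l h"
        unfolding L2_set_def sobolev_norm_def real_sqrt_mult[symmetric]
        by (intro real_sqrt_le_mono mult_left_mono) auto
    qed (auto simp: L2_norm_nonneg L2_set_nonneg)
    finally show "(\<Sum>k\<in>K. ?V * Re (fourier_coeff a k * cnj (fourier_coeff h k))) \<le> L2_norm a * sobolev_norm l h" .
  qed
qed

section \<open>The nonlinearity\<close>

lemma half_deriv_works:
  assumes "G differentiable_on {0..}" "z \<ge> 0"
  shows "(G has_real_derivative half_deriv G z) (at z within {0..})"
  using assms unfolding half_deriv_def differentiable_on_def
  by (simp add: has_real_derivative_iff_has_vector_derivative vector_derivative_works[symmetric])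

lemma admissible_derivs:
  assumes "admissible F"
  shows "F differentiable_on {0..}" "half_deriv F differentiable_on {0..}"
    "half_deriv (half_deriv F) differentiable_on {0..}"
    "half_deriv (half_deriv (half_deriv F)) differentiable_on {0..}"
proof -
  have "(half_deriv ^^ n) F differentiable_on {0..}" for n
    using assms by (simp add: admissible_def)
  from this[of 0] this[of 1] this[of 2] this[of 3]
  show "F differentiable_on {0..}" "half_deriv F differentiable_on {0..}"
    "half_deriv (half_deriv F) differentiable_on {0..}"
    "half_deriv (half_deriv (half_deriv F)) differentiable_on {0..}"
    by (simp_all add: eval_nat_numeral)
qed

text \<open>The open half-line lies in the closed good set, and its closure adds the endpoint 0.
  This converts the essential supremum of F1' - F2' into a bound at every z >= 0.\<close>

lemma AE_half_line_continuous_le: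
  fixes f :: "real \<Rightarrow> real"
  assumes f: "continuous_on {0..} f" and ae: "AE z in half_line. f z \<le> c" and z: "z \<ge> 0"
  shows "f z \<le> c"
proof -
  define C where "C = {z \<in> {0..}. f z \<le> c}"
  have C: "closed C"
    unfolding C_def using continuous_closed_preimage[OF f closed_atLeast, of "{..c}"]
    by (simp add: vimage_def Int_def)
  have "AE z in lborel. z \<in> {0..} \<longrightarrow> f z \<le> c"
    using ae unfolding half_line_def by (subst (asm) AE_restrict_space_iff) auto
  then have "AE z in lebesgue. z \<in> {0..} \<longrightarrow> f z \<le> c"
    by (rule AE_completion)
  then have "AE z \<in> {0<..} in lebesgue. z \<in> C"
    by eventually_elim (auto simp: C_def)
  then have "{0<..} \<subseteq> C"
    using mem_closed_if_AE_lebesgue_open[OF open_greaterThan C] by blast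
  then have "closure {0<..} \<subseteq> C" using C by (rule closure_minimal)
  then have "{0..} \<subseteq> C" by simp
  then show ?thesis using z by (auto simp: C_def)
qed

text \<open>Continuity turns positivity almost everywhere into nonnegativity everywhere, the sign
  that the weight in \<open>cordoba_inequality\<close> must have.\<close>

lemma admissible_deriv_nonneg:
  assumes F: "admissible F" and z: "z \<ge> 0"
  shows "0 \<le> half_deriv F z"
proof -
  have "AE z in half_line. 0 < half_deriv F z" using F by (simp add: admissible_def)
  then have "AE z in half_line. - half_deriv F z \<le> 0" by eventually_elim simp
  moreover have "continuous_on {0..} (\<lambda>z. - half_deriv F z)"
    by (intro continuous_on_minus differentiable_imp_continuous_on admissible_derivs(2)[OF F])
  ultimately have "- half_deriv F z \<le> 0"
    using AE_half_line_continuous_le z by blast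
  then show ?thesis by simp
qed

lemma lipschitz_on_half_line:
  fixes G :: "real \<Rightarrow> real"
  assumes "\<And>z. z \<in> {0..R} \<Longrightarrow> (G has_real_derivative G' z) (at z within {0..})"
    and "\<And>z. z \<in> {0..R} \<Longrightarrow> \<bar>G' z\<bar> \<le> N" and "y \<in> {0..R}" "z \<in> {0..R}"
  shows "\<bar>G y - G z\<bar> \<le> N * \<bar>y - z\<bar>"
proof -
  have "norm (G y - G z) \<le> N * norm (y - z)"
  proof (rule field_differentiable_bound[of "{0..R}" G G'])
    show "(G has_field_derivative G' z) (at z within {0..R})" if "z \<in> {0..R}" for z
      by (rule has_field_derivative_subset[OF assms(1)[OF that]]) auto
  qed (use assms in auto)
  then show ?thesis by simp
qed

text \<open>Mean value inequality for x -> G x - G' z x on the segment from z to y, where its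
  derivative is at most N |y - z|.\<close>

lemma taylor_on_half_line:
  fixes G :: "real \<Rightarrow> real"
  assumes G: "\<And>z. z \<in> {0..R} \<Longrightarrow> (G has_real_derivative G' z) (at z within {0..})"
    and L: "\<And>y z. y \<in> {0..R} \<Longrightarrow> z \<in> {0..R} \<Longrightarrow> \<bar>G' y - G' z\<bar> \<le> N * \<bar>y - z\<bar>"
    and N: "N \<ge> 0" and y: "y \<in> {0..R}" and z: "z \<in> {0..R}"
  shows "\<bar>G y - G z - G' z * (y - z)\<bar> \<le> N * (y - z)\<^sup>2"
proof -
  have seg: "closed_segment z y \<subseteq> {0..R}"
    using y z by (intro closed_segment_subset) auto
  have "norm ((G y - G' z * y) - (G z - G' z * z)) \<le> (N * \<bar>y - z\<bar>) * norm (y - z)"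
  proof (rule field_differentiable_bound[of "closed_segment z y" _ "\<lambda>x. G' x - G' z"])
    fix x assume x: "x \<in> closed_segment z y"
    then have xR: "x \<in> {0..R}" using seg by blast
    have "(G has_field_derivative G' x) (at x within closed_segment z y)"
      by (rule has_field_derivative_subset[OF G[OF xR]]) (use seg in auto)
    then show "((\<lambda>x. G x - G' z * x) has_field_derivative (G' x - G' z)) (at x within closed_segment z y)"
      by (auto intro!: derivative_eq_intros)
    have "\<bar>G' x - G' z\<bar> \<le> N * \<bar>x - z\<bar>" by (rule L[OF xR z])
    also have "\<dots> \<le> N * \<bar>y - z\<bar>"
      using x N by (intro mult_left_mono) (auto simp: closed_segment_eq_real_ivl split: if_splits)
    finally show "norm (G' x - G' z) \<le> N * \<bar>y - z\<bar>" by simp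
  qed auto
  then show ?thesis by (simp add: power2_eq_square algebra_simps)
qed

text \<open>Products of two first differences, of size min(1, |h|)^2, have to fit under the modulus
  meant for second differences.\<close>

lemma square_min_le_modulus: "(min 1 (norm h))\<^sup>2 \<le> modulus h"
proof (cases "norm h \<le> 1")
  case True
  have "(norm h)\<^sup>2 = norm h powr 2" by simp
  also have "\<dots> \<le> norm h powr (5/4)" using True by (intro powr_mono') auto
  finally have "(norm h)\<^sup>2 \<le> norm h powr (5/4)" .
  moreover have "(norm h)\<^sup>2 \<le> 1" using True by (simp add: power_le_one)
  ultimately show ?thesis using True by (simp add: modulus_def min_def)
next
  case False
  then have "1 \<le> norm h powr (5/4)" by (intro ge_one_powr_ge_zero) auto
  then show ?thesis using False by (simp add: modulus_def min_def)
qed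

text \<open>The regularity, between \<open>C\<^sup>1\<close> and \<open>C\<^sup>2\<close>, under which the weight \<open>b\<close> of the Cordoba-Cordoba
  inequality is admissible.\<close>

definition tame :: "real \<Rightarrow> (real ^ 'n \<Rightarrow> real) \<Rightarrow> bool" where
  "tame R v \<longleftrightarrow> continuous_on UNIV v \<and> torus_periodic v \<and> (\<forall>x. 0 < v x \<and> v x \<le> R) \<and>
     (\<forall>x h. \<bar>v (x + h) - v x\<bar> \<le> R * min 1 (norm h)) \<and>
     (\<forall>x h. \<bar>v (x + h) + v (x - h) - 2 * v x\<bar> \<le> 4 * R * modulus h)"

lemma tameD:
  assumes "tame R v"
  shows "continuous_on UNIV v" "torus_periodic v" "0 < v x" "v x \<le> R"
    "\<bar>v (x + h) - v x\<bar> \<le> R * min 1 (norm h)"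
    "\<bar>v (x + h) + v (x - h) - 2 * v x\<bar> \<le> 4 * R * modulus h"
  using assms by (simp_all add: tame_def)

lemma wiener_tame:
  assumes u: "wiener u" and pos: "\<And>x. 0 < u x" and R: "wiener_norm u \<le> R"
  shows "tame R u"
proof -
  have R0: "0 \<le> R" using wiener_norm_nonneg[of u] R by linarith
  have le: "u x \<le> R" for x using wiener_bound[OF u, of x] R by linarith
  have "\<bar>u (x + h) - u x\<bar> \<le> R * min 1 (norm h)" for x h
  proof -
    have "\<bar>u (x + h) - u x\<bar> \<le> R" using pos[of x] pos[of "x + h"] le[of x] le[of "x + h"] by linarith
    moreover have "\<bar>u (x + h) - u x\<bar> \<le> R * norm h"
      using wiener_lipschitz[OF u, of x h] mult_right_mono[OF R norm_ge_zero[of h]] by linarith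
    ultimately show ?thesis by (simp add: min_def)
  qed
  moreover have "\<bar>u (x + h) + u (x - h) - 2 * u x\<bar> \<le> 4 * R * modulus h" for x h
    using wiener_second_difference[OF u, of x h] mult_right_mono[OF R modulus_nonneg[of h]] by linarith
  ultimately show ?thesis
    unfolding tame_def using pos le wiener_continuous[OF u] wiener_periodic[OF u] by blast
qed

text \<open>All bounds in \<open>tame\<close> are convex, so a single \<open>R\<close> serves the
  whole segment between two solutions and no constant depends on the position on it.\<close>

lemma tame_convex:
  assumes u: "tame R u" and v: "tame R v" and t: "0 \<le> t" "t \<le> 1"
  shows "tame R (\<lambda>x. v x + t * (u x - v x))"
proof -
  have c: "\<bar>b + t * (a - b)\<bar> \<le> r" if "\<bar>a\<bar> \<le> r" "\<bar>b\<bar> \<le> r" for a b r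
  proof -
    have "\<bar>t * a + (1 - t) * b\<bar> \<le> t * \<bar>a\<bar> + (1 - t) * \<bar>b\<bar>"
      using t by (intro order_trans[OF abs_triangle_ineq]) (simp add: abs_mult)
    also have "\<dots> \<le> t * r + (1 - t) * r" using that t by (intro add_mono mult_left_mono) auto
    finally show ?thesis by (simp add: algebra_simps)
  qed
  have p: "0 < b + t * (a - b)" if "0 < a" "0 < b" for a b :: real
  proof -
    have "0 < t * a + (1 - t) * b"
      using that t by (cases "t = 0") (auto intro: add_pos_nonneg)
    then show ?thesis by (simp add: algebra_simps)
  qed
  show ?thesis
    unfolding tame_def
  proof (intro conjI allI)
    show "continuous_on UNIV (\<lambda>x. v x + t * (u x - v x))"
      using u v by (auto simp: tame_def intro!: continuous_intros)
    show "torus_periodic (\<lambda>x. v x + t * (u x - v x))"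
      using u v torus_periodic_comp2[of u v "\<lambda>a b. b + t * (a - b)"] by (simp add: tame_def)
    show "0 < v x + t * (u x - v x)" for x using u v p by (simp add: tame_def)
    have uv: "0 < u x" "u x \<le> R" "0 < v x" "v x \<le> R" for x
      using u v by (simp_all add: tame_def)
    show "v x + t * (u x - v x) \<le> R" for x
      using c[of "u x" R "v x"] uv[of x] by simp
    show "\<bar>v (x + h) + t * (u (x + h) - v (x + h)) - (v x + t * (u x - v x))\<bar> \<le> R * min 1 (norm h)" for x h
      using c[OF tameD(5)[OF u, of x h] tameD(5)[OF v, of x h]] by (simp add: algebra_simps)
    show "\<bar>v (x + h) + t * (u (x + h) - v (x + h)) + (v (x - h) + t * (u (x - h) - v (x - h))) - 2 * (v x + t * (u x - v x))\<bar> \<le> 4 * R * modulus h" for x h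
      using c[OF tameD(6)[OF u, of x h] tameD(6)[OF v, of x h]] by (simp add: algebra_simps)
  qed
qed

text \<open>For a product u G(v), the factor N multiplies 4 R from second differences of u, 4 R^2 +
  2 R^3 from those of G(v), and 2 R^2 from two products of first differences.\<close>

definition weight_const :: "real \<Rightarrow> real \<Rightarrow> real" where
  "weight_const N R = N * (4 * R + 6 * R\<^sup>2 + 2 * R ^ 3)"

text \<open>Second differences obey a Leibniz rule: each factor is differenced twice in one term,
  and two products of first differences remain. For G(v), expansion at v x leaves G' times the
  second difference of v plus quadratic remainders.\<close>

lemma tame_weight_second_difference:
  assumes u: "tame R u" and v: "tame R v" and N: "N \<ge> 0"
    and b0: "\<And>z. z \<in> {0..R} \<Longrightarrow> \<bar>G z\<bar> \<le> N"
    and b1: "\<And>z. z \<in> {0..R} \<Longrightarrow> \<bar>G' z\<bar> \<le> N"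
    and l0: "\<And>y z. y \<in> {0..R} \<Longrightarrow> z \<in> {0..R} \<Longrightarrow> \<bar>G y - G z\<bar> \<le> N * \<bar>y - z\<bar>"
    and ty: "\<And>y z. y \<in> {0..R} \<Longrightarrow> z \<in> {0..R} \<Longrightarrow> \<bar>G y - G z - G' z * (y - z)\<bar> \<le> N * (y - z)\<^sup>2"
  shows "\<bar>u (x + h) * G (v (x + h)) + u (x - h) * G (v (x - h)) - 2 * (u x * G (v x))\<bar> \<le> weight_const N R * modulus h"
proof -
  define m where "m = min 1 (norm h)"
  define \<rho> where "\<rho> = modulus h"
  have m: "0 \<le> m" "m\<^sup>2 \<le> \<rho>" using square_min_le_modulus[of h] by (auto simp: m_def \<rho>_def)
  have \<rho>: "0 \<le> \<rho>" using m(2) by (meson order_trans zero_le_power2)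
  have in_R: "v y \<in> {0..R}" for y using v by (simp add: tame_def less_imp_le)
  have uR: "\<bar>u y\<bar> \<le> R" for y using tameD(3,4)[OF u, of y] by linarith
  have R: "0 \<le> R" using in_R[of 0] by auto
  have du: "\<bar>u (x + r) - u x\<bar> \<le> R * m" "\<bar>v (x + r) - v x\<bar> \<le> R * m" if "r = h \<or> r = - h" for r
    using u v that unfolding tame_def m_def by (metis norm_minus_cancel)+
  have dG: "\<bar>G (v (x + r)) - G (v x)\<bar> \<le> N * R * m" if "r = h \<or> r = - h" for r
    using l0[OF in_R in_R, of "x + r" x] mult_left_mono[OF du(2)[OF that] N] by (simp add: mult.assoc)
  have tG: "\<bar>G (v (x + r)) - G (v x) - G' (v x) * (v (x + r) - v x)\<bar> \<le> N * R\<^sup>2 * \<rho>" if "r = h \<or> r = - h" for r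
  proof -
    have "(v (x + r) - v x)\<^sup>2 \<le> (R * m)\<^sup>2"
      using du(2)[OF that] R m(1) by (metis abs_le_square_iff abs_of_nonneg mult_nonneg_nonneg)
    also have "\<dots> \<le> R\<^sup>2 * \<rho>" using m(2) by (simp add: power_mult_distrib mult_left_mono)
    finally have "N * (v (x + r) - v x)\<^sup>2 \<le> N * (R\<^sup>2 * \<rho>)" using N by (rule mult_left_mono)
    then show ?thesis using ty[OF in_R in_R, of "x + r" x] by (simp add: mult.assoc)
  qed
  have d2u: "\<bar>u (x + h) + u (x - h) - 2 * u x\<bar> \<le> 4 * R * \<rho>" and d2v: "\<bar>v (x + h) + v (x - h) - 2 * v x\<bar> \<le> 4 * R * \<rho>"
    using u v by (simp_all add: tame_def \<rho>_def)
  have d2G: "\<bar>G (v (x + h)) + G (v (x - h)) - 2 * G (v x)\<bar> \<le> 2 * (N * R\<^sup>2 * \<rho>) + N * (4 * R * \<rho>)"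
  proof -
    have "\<bar>G' (v x) * (v (x + h) + v (x - h) - 2 * v x)\<bar> \<le> N * (4 * R * \<rho>)"
      unfolding abs_mult using b1[OF in_R[of x]] d2v N by (intro mult_mono) auto
    moreover have "G (v (x + h)) + G (v (x - h)) - 2 * G (v x) =
       (G (v (x + h)) - G (v x) - G' (v x) * (v (x + h) - v x)) + (G (v (x - h)) - G (v x) - G' (v x) * (v (x - h) - v x)) + G' (v x) * (v (x + h) + v (x - h) - 2 * v x)"
      by (simp add: algebra_simps)
    ultimately show ?thesis using tG[of h] tG[of "- h"] by (simp add: abs_le_iff)
  qed
  have p: "\<bar>(u (x + r) - u x) * (G (v (x + r)) - G (v x))\<bar> \<le> N * R\<^sup>2 * \<rho>" if "r = h \<or> r = - h" for r
  proof -
    have "\<bar>(u (x + r) - u x) * (G (v (x + r)) - G (v x))\<bar> \<le> (R * m) * (N * R * m)"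
      unfolding abs_mult using du(1)[OF that] dG[OF that] R m(1) by (intro mult_mono) auto
    also have "\<dots> = N * R\<^sup>2 * m\<^sup>2" by (simp add: power2_eq_square ac_simps)
    also have "\<dots> \<le> N * R\<^sup>2 * \<rho>" using m(2) N by (intro mult_left_mono) auto
    finally show ?thesis .
  qed
  have q1: "\<bar>G (v x) * (u (x + h) + u (x - h) - 2 * u x)\<bar> \<le> N * (4 * R * \<rho>)"
    unfolding abs_mult using b0[OF in_R[of x]] d2u N by (intro mult_mono) auto
  have q2: "\<bar>u x * (G (v (x + h)) + G (v (x - h)) - 2 * G (v x))\<bar> \<le> R * (2 * (N * R\<^sup>2 * \<rho>) + N * (4 * R * \<rho>))"
    unfolding abs_mult using uR[of x] d2G R by (intro mult_mono) auto
  have "u (x + h) * G (v (x + h)) + u (x - h) * G (v (x - h)) - 2 * (u x * G (v x)) =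
     G (v x) * (u (x + h) + u (x - h) - 2 * u x) + u x * (G (v (x + h)) + G (v (x - h)) - 2 * G (v x))
     + (u (x + h) - u x) * (G (v (x + h)) - G (v x)) + (u (x - h) - u x) * (G (v (x - h)) - G (v x))"
    by (simp add: algebra_simps)
  moreover have tri: "\<bar>a + b + c + d\<bar> \<le> A + B + C + D"
    if "\<bar>a\<bar> \<le> A" "\<bar>b\<bar> \<le> B" "\<bar>c\<bar> \<le> C" "\<bar>d\<bar> \<le> D" for a b c d A B C D :: real
    using that by linarith
  ultimately have "\<bar>u (x + h) * G (v (x + h)) + u (x - h) * G (v (x - h)) - 2 * (u x * G (v x))\<bar> \<le>
     N * (4 * R * \<rho>) + R * (2 * (N * R\<^sup>2 * \<rho>) + N * (4 * R * \<rho>)) + N * R\<^sup>2 * \<rho> + N * R\<^sup>2 * \<rho>"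
    using tri[OF q1 q2 p[of h, simplified] p[of "- h", simplified]] by (simp only:)
  also have "\<dots> = weight_const N R * \<rho>"
    by (simp add: weight_const_def algebra_simps power2_eq_square power3_eq_cube)
  finally show ?thesis by (simp add: \<rho>_def)
qed

text \<open>Passage to the gauge integral, where \<open>leibniz_rule_field_derivative\<close>
  differentiates under the integral sign.\<close>

lemma integral_torus_HK:
  fixes f :: "real ^ 'n \<Rightarrow> real"
  assumes "continuous_on UNIV f"
  shows "(LINT x|torus. f x) = integral (cbox 0 (\<chi> j. 2 * pi)) f"
proof -
  have "set_integrable lborel (cbox 0 (\<chi> j. 2 * pi)) f"
    unfolding set_integrable_def by (intro borel_integrable_compact continuous_on_subset[OF assms]) auto
  then show ?thesis
    unfolding integral_torus using set_borel_integral_eq_integral(2) by (simp only: set_lebesgue_integral_def)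
qed

lemma continuous_on_comp_tame:
  assumes "continuous_on {0..} G" "tame R v"
  shows "continuous_on S (\<lambda>x. G (v x))"
  by (rule continuous_on_compose2[OF assms(1)])
    (use assms(2) in \<open>auto simp: tame_def less_imp_le intro: continuous_on_subset\<close>)

text \<open>The mean value theorem is applied to the integrated quantity \<open>\<phi>\<close>, not
  at each x. One \<theta> then serves all x, and the weight b = u2 F'(v \<theta>) inherits the
  regularity of v \<theta>; a pointwise choice of \<theta> would give no control of its
  differences.\<close>

lemma dissipative_term:
  fixes u1 u2 w :: "real ^ 'n \<Rightarrow> real"
  assumes s: "0 < s" "s \<le> 1" and F: "admissible F" and N: "N \<ge> 0"
    and u1: "tame R u1" and u2: "tame R u2"
    and w: "wiener w" and w_eq: "\<And>x. w x = u1 x - u2 x"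
    and b1: "\<And>z. z \<in> {0..R} \<Longrightarrow> \<bar>half_deriv F z\<bar> \<le> N"
    and b2: "\<And>z. z \<in> {0..R} \<Longrightarrow> \<bar>half_deriv (half_deriv F) z\<bar> \<le> N"
    and b3: "\<And>z. z \<in> {0..R} \<Longrightarrow> \<bar>half_deriv (half_deriv (half_deriv F)) z\<bar> \<le> N"
  shows "- (10 + 16 * real CARD('n)) * (weight_const N R / 4 * (LINT x|torus. (w x)\<^sup>2)) \<le>
     (LINT x|torus. (F (u1 x) - F (u2 x)) * (u2 x * frac_lap s w x))"
proof -
  let ?C = "cbox (0::real^'n) (\<chi> j. 2 * pi)"
  note D = admissible_derivs[OF F]
  define v where "v \<theta> x = u2 x + \<theta> * (u1 x - u2 x)" for \<theta> x
  have v: "tame R (v \<theta>)" if "\<theta> \<in> {0..1}" for \<theta>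
    unfolding v_def using that by (intro tame_convex u1 u2) auto
  have R: "0 \<le> R" using u1 by (metis tame_def less_imp_le order_trans)
  note Lc = frac_lap_continuous[OF s w]
  have u2c: "continuous_on S u2" and wc: "continuous_on S w" for S
    using u2 by (auto simp: tame_def intro: continuous_on_subset wiener_continuous[OF w])
  have F0: "continuous_on {0..} F" and F1: "continuous_on {0..} (half_deriv F)"
    by (intro differentiable_imp_continuous_on D)+
  define \<phi> where "\<phi> \<theta> = integral ?C (\<lambda>x. F (v \<theta> x) * (u2 x * frac_lap s w x))" for \<theta>
  have \<phi>': "(\<phi> has_real_derivative integral ?C (\<lambda>x. (half_deriv F (v \<theta> x) * w x) * (u2 x * frac_lap s w x))) (at \<theta> within {0..1})"
    if \<theta>: "\<theta> \<in> {0..1}" for \<theta>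
    unfolding \<phi>_def
  proof (rule leibniz_rule_field_derivative[OF _ _ _ \<theta>])
    fix t x assume t: "t \<in> {0..1::real}"
    have vp: "v r x \<in> {0..}" if "r \<in> {0..1}" for r
      using v[OF that] by (simp add: tame_def less_imp_le)
    have "((\<lambda>r. v r x) has_real_derivative w x) (at t within {0..1})"
      unfolding v_def w_eq by (auto intro!: derivative_eq_intros)
    then have "((\<lambda>r. F (v r x)) has_real_derivative (half_deriv F (v t x) * w x)) (at t within {0..1})"
      using vp t
      by (intro DERIV_image_chain[where g="\<lambda>r. v r x" and f=F, unfolded comp_def] DERIV_subset[OF half_deriv_works[OF D(1)]]) auto
    then show "((\<lambda>t. F (v t x) * (u2 x * frac_lap s w x)) has_real_derivative (half_deriv F (v t x) * w x) * (u2 x * frac_lap s w x)) (at t within {0..1})"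
      by (rule DERIV_cmult_right)
  next
    fix t :: real assume "t \<in> {0..1}"
    then show "(\<lambda>x. F (v t x) * (u2 x * frac_lap s w x)) integrable_on ?C"
      by (intro integrable_continuous continuous_on_mult continuous_on_comp_tame[OF F0 v] u2c Lc)
  next
    have vc: "continuous_on ({0..1} \<times> ?C) (\<lambda>p. v (fst p) (snd p))"
      unfolding v_def
      using u1 u2 by (auto simp: tame_def intro!: continuous_intros continuous_on_compose2[where f=snd])
    have "continuous_on ({0..1} \<times> ?C) (\<lambda>p. half_deriv F (v (fst p) (snd p)))"
    proof (rule continuous_on_compose2[OF F1 vc])
      show "(\<lambda>p. v (fst p) (snd p)) ` ({0..1} \<times> ?C) \<subseteq> {0..}"
        using v by (auto simp: tame_def less_imp_le)
    qed
    then show "continuous_on ({0..1} \<times> ?C) (\<lambda>(t, x). (half_deriv F (v t x) * w x) * (u2 x * frac_lap s w x))"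
      unfolding case_prod_beta
      by (intro continuous_on_mult continuous_on_compose2[OF wc continuous_on_snd] continuous_on_compose2[OF u2c continuous_on_snd] continuous_on_compose2[OF Lc continuous_on_snd] continuous_on_id) auto
  qed auto
  have "\<exists>\<theta>\<in>{0<..<1}. \<phi> 1 - \<phi> 0 = integral ?C (\<lambda>x. (half_deriv F (v \<theta> x) * w x) * (u2 x * frac_lap s w x)) * (1 - 0)"
    by (rule mvt_simple) (use \<phi>' in \<open>auto simp: has_field_derivative_def\<close>)
  then obtain \<theta> where "\<theta> \<in> {0<..<1}" and eq: "\<phi> 1 - \<phi> 0 = integral ?C (\<lambda>x. (half_deriv F (v \<theta> x) * w x) * (u2 x * frac_lap s w x))"
    unfolding diff_zero mult_1_right by blast
  then have \<theta>: "\<theta> \<in> {0..1}" by simp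
  define b where "b x = u2 x * half_deriv F (v \<theta> x)" for x
  have bc: "continuous_on UNIV b" unfolding b_def by (intro continuous_on_mult u2c continuous_on_comp_tame[OF F1 v[OF \<theta>]])
  have "- (10 + 16 * real CARD('n)) * (weight_const N R / 4 * (LINT x|torus. (w x)\<^sup>2)) \<le> (LINT x|torus. frac_lap s w x * (b x * w x))"
  proof (rule cordoba_inequality[OF s w bc])
    show "torus_periodic b"
      unfolding b_def using u2 v[OF \<theta>] torus_periodic_comp2[of u2 "v \<theta>" "\<lambda>a c. a * half_deriv F c"] by (simp add: tame_def)
    show "0 \<le> b x" for x
      unfolding b_def using u2 v[OF \<theta>] by (intro mult_nonneg_nonneg admissible_deriv_nonneg[OF F]) (auto simp: tame_def less_imp_le)
    show "0 \<le> weight_const N R" unfolding weight_const_def using N R by simp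
    \<comment> \<open>The weight already contains F', so its Taylor bound needs F'' to be Lipschitz;
      this is where the third derivative comes in.\<close>
    have l: "\<bar>half_deriv F y - half_deriv F z\<bar> \<le> N * \<bar>y - z\<bar>"
      "\<bar>half_deriv (half_deriv F) y - half_deriv (half_deriv F) z\<bar> \<le> N * \<bar>y - z\<bar>" if "y \<in> {0..R}" "z \<in> {0..R}" for y z
      using lipschitz_on_half_line[OF half_deriv_works[OF D(2)] b2 that]
        lipschitz_on_half_line[OF half_deriv_works[OF D(3)] b3 that] by (simp_all only: atLeastAtMost_iff)
    show "\<bar>b (x + h) + b (x - h) - 2 * b x\<bar> \<le> weight_const N R * modulus h" for x h
      unfolding b_def
    proof (rule tame_weight_second_difference[OF u2 v[OF \<theta>] N b1 b2 l(1)])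
      show "\<bar>half_deriv F y - half_deriv F z - half_deriv (half_deriv F) z * (y - z)\<bar> \<le> N * (y - z)\<^sup>2" if "y \<in> {0..R}" "z \<in> {0..R}" for y z
        by (rule taylor_on_half_line[OF _ l(2) N that]) (use half_deriv_works[OF D(2)] in auto)
    qed
  qed
  also have "(LINT x|torus. frac_lap s w x * (b x * w x)) = (LINT x|torus. (half_deriv F (v \<theta> x) * w x) * (u2 x * frac_lap s w x))"
    by (simp add: b_def ac_simps)
  also have "\<dots> = integral ?C (\<lambda>x. (half_deriv F (v \<theta> x) * w x) * (u2 x * frac_lap s w x))"
    by (intro integral_torus_HK continuous_on_mult u2c wc Lc continuous_on_comp_tame[OF F1 v[OF \<theta>]])
  also have "\<dots> = \<phi> 1 - \<phi> 0" by (simp only: eq)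
  also have "\<dots> = (LINT x|torus. F (v 1 x) * (u2 x * frac_lap s w x)) - (LINT x|torus. F (v 0 x) * (u2 x * frac_lap s w x))"
    unfolding \<phi>_def
    by (intro arg_cong2[where f="(-)"] integral_torus_HK[symmetric] continuous_on_mult u2c Lc continuous_on_comp_tame[OF F0 v]) auto
  also have "\<dots> = (LINT x|torus. F (v 1 x) * (u2 x * frac_lap s w x) - F (v 0 x) * (u2 x * frac_lap s w x))"
    by (intro Bochner_Integration.integral_diff[symmetric] integrable_continuous_torus continuous_on_mult u2c Lc continuous_on_comp_tame[OF F0 v]) auto
  also have "\<dots> = (LINT x|torus. (F (u1 x) - F (u2 x)) * (u2 x * frac_lap s w x))"
    by (simp add: v_def left_diff_distrib)
  finally show ?thesis .
qed

lemma L1_le_L2_norm: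
  fixes w :: "real ^ 'n \<Rightarrow> real"
  assumes w: "continuous_on UNIV w"
  shows "(LINT x|torus. \<bar>w x\<bar>) \<le> sqrt ((2 * pi) ^ CARD('n)) * L2_norm w"
proof -
  let ?V = "(2 * pi) ^ CARD('n) :: real"
  define I where "I = (LINT x|torus. \<bar>w x\<bar>)"
  have V: "?V > 0" by simp
  have i: "integrable torus (\<lambda>x. \<bar>w x\<bar>)" "integrable torus (\<lambda>x. (w x)\<^sup>2)"
    by (intro integrable_continuous_torus continuous_intros w)+
  \<comment> \<open>The variance of |w|; expanding it is Cauchy-Schwarz against the constant
    1.\<close>
  have "0 \<le> (LINT x|torus. (\<bar>w x\<bar> - I / ?V)\<^sup>2)" by simp
  also have "\<dots> = (LINT x|torus. (w x)\<^sup>2 - 2 * (I / ?V) * \<bar>w x\<bar> + (I / ?V)\<^sup>2)"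
    by (intro Bochner_Integration.integral_cong refl) (simp add: power2_eq_square algebra_simps)
  also have "\<dots> = (L2_norm w)\<^sup>2 - 2 * (I / ?V) * I + (I / ?V)\<^sup>2 * ?V"
    using i by (simp add: L2_norm_square I_def measure_torus)
  also have "\<dots> = (L2_norm w)\<^sup>2 - I\<^sup>2 / ?V" using V by (simp add: field_simps power2_eq_square)
  finally have "I\<^sup>2 \<le> ?V * (L2_norm w)\<^sup>2" using V by (simp add: pos_divide_le_eq mult.commute)
  also have "\<dots> = (sqrt ?V * L2_norm w)\<^sup>2" using V by (simp add: power_mult_distrib)
  finally show ?thesis
    unfolding I_def by (rule power2_le_imp_le) (simp add: L2_norm_nonneg)
qed

text \<open>The summands come, in this order, from \<open>T1\<close>, \<open>T2\<close>,
  \<open>T3\<close> and \<open>T4\<close> in \<open>nonlinear_estimate\<close>. \<open>N\<close>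
  bounds three derivatives of F1 on {0..R}, and \<open>R\<close> the Wiener norms of both
  solutions.\<close>

definition stability_const :: "nat \<Rightarrow> real \<Rightarrow> real \<Rightarrow> real" where
  "stability_const d N R = N * R + (10 + 16 * real d) * weight_const N R / 4
     + sqrt ((2 * pi) ^ d) * R\<^sup>2 + sqrt ((2 * pi) ^ d * real d) * (2 * R\<^sup>2)"

text \<open>\<open>T1\<close> and \<open>T2\<close> carry F1(u1) - F1(u2) and give the squared norm
  of w, \<open>T2\<close> by the one-sided bound of \<open>dissipative_term\<close>.
  \<open>T3\<close> and \<open>T4\<close> carry H(u2) with H = F1 - F2 and give \<epsilon> times the
  norm of w.\<close>

lemma nonlinear_estimate:
  fixes u1 u2 w :: "real ^ 'n \<Rightarrow> real"
  assumes s: "0 < s" "s \<le> 1" and F1: "admissible F1" and F2: "admissible F2" and N: "N \<ge> 0"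
    and u1: "wiener u1" "\<And>x. 0 < u1 x" "wiener_norm u1 \<le> R"
    and u2: "wiener u2" "\<And>x. 0 < u2 x" "wiener_norm u2 \<le> R"
    and w: "wiener w" and w_eq: "\<And>x. w x = u1 x - u2 x"
    and b1: "\<And>z. z \<in> {0..R} \<Longrightarrow> \<bar>half_deriv F1 z\<bar> \<le> N"
    and b2: "\<And>z. z \<in> {0..R} \<Longrightarrow> \<bar>half_deriv (half_deriv F1) z\<bar> \<le> N"
    and b3: "\<And>z. z \<in> {0..R} \<Longrightarrow> \<bar>half_deriv (half_deriv (half_deriv F1)) z\<bar> \<le> N"
    and eps: "\<And>z. z \<ge> 0 \<Longrightarrow> \<bar>half_deriv F1 z - half_deriv F2 z\<bar> \<le> \<epsilon>"
  shows "(LINT x|torus. (F1 (u1 x) - F2 (u2 x)) * (w x * frac_lap s u2 x - u2 x * frac_lap s w x)) \<le>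
    stability_const CARD('n) N R * ((L2_norm w)\<^sup>2 + \<epsilon> * L2_norm w)"
proof -
  let ?V = "(2 * pi) ^ CARD('n) :: real"
  note t1 = wiener_tame[OF u1] and t2 = wiener_tame[OF u2]
  note D1 = admissible_derivs[OF F1] and D2 = admissible_derivs[OF F2]
  have e0: "\<epsilon> \<ge> 0" using eps[of 0] by linarith
  have R: "0 \<le> R" using u1(3) wiener_norm_nonneg[of u1] by linarith
  have in1: "u1 x \<in> {0..R}" and in2: "u2 x \<in> {0..R}" for x
    using t1 t2 by (simp_all add: tame_def less_imp_le)
  have Fc: "continuous_on {0..} F1" "continuous_on {0..} F2"
    by (intro differentiable_imp_continuous_on D1 D2)+
  note Lw = frac_lap_continuous[OF s w] and Lu = frac_lap_continuous[OF s u2(1)]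
  note wc = wiener_continuous[OF w] and u2c = wiener_continuous[OF u2(1)]
  note F1c = continuous_on_comp_tame[OF Fc(1) t1] continuous_on_comp_tame[OF Fc(1) t2] continuous_on_comp_tame[OF Fc(2) t2]
  define H where "H z = F1 z - F2 z" for z
  have H': "(H has_real_derivative (half_deriv F1 z - half_deriv F2 z)) (at z within {0..})" if "z \<in> {0..R}" for z
    unfolding H_def using that by (intro DERIV_diff half_deriv_works D1 D2) auto
  \<comment> \<open>Both nonlinearities vanish at 0, so the bound on H' controls H itself.\<close>
  have H0: "\<bar>H z\<bar> \<le> \<epsilon> * z" if "z \<in> {0..R}" for z
    using lipschitz_on_half_line[OF H' _ that, of \<epsilon> 0] eps R F1 F2 that by (auto simp: H_def admissible_def)
  define g where "g x = - (u2 x * H (u2 x))" for x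
  have lipG: "\<bar>y * H y - z * H z\<bar> \<le> (2 * \<epsilon> * R) * \<bar>y - z\<bar>" if "y \<in> {0..R}" "z \<in> {0..R}" for y z
  proof (rule lipschitz_on_half_line[where G="\<lambda>z. z * H z" and G'="\<lambda>z. H z + z * (half_deriv F1 z - half_deriv F2 z)", OF _ _ that])
    fix z assume z: "z \<in> {0..R}"
    show "((\<lambda>z. z * H z) has_real_derivative (H z + z * (half_deriv F1 z - half_deriv F2 z))) (at z within {0..})"
      using H'[OF z] by (auto intro!: derivative_eq_intros)
    have "\<bar>H z\<bar> \<le> \<epsilon> * R" using H0[OF z] z e0 by (auto intro: order_trans mult_left_mono)
    moreover have "\<bar>z * (half_deriv F1 z - half_deriv F2 z)\<bar> \<le> R * \<epsilon>"
      unfolding abs_mult using z eps[of z] R by (intro mult_mono) auto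
    ultimately show "\<bar>H z + z * (half_deriv F1 z - half_deriv F2 z)\<bar> \<le> 2 * \<epsilon> * R"
      by (simp add: abs_le_iff mult.commute)
  qed
  have gc: "continuous_on UNIV g" unfolding g_def H_def by (intro continuous_on_minus continuous_on_mult continuous_on_diff u2c F1c)
  have gp: "torus_periodic g" unfolding g_def by (rule torus_periodic_comp[OF wiener_periodic[OF u2(1)]])
  \<comment> \<open>z H(z) is Lipschitz on {0..R} with constant 2 \<epsilon> R, since |H| and |z H'|
    are at most \<epsilon> R there; composition with u2 contributes one more R.\<close>
  have gL: "\<bar>g (x + h) - g x\<bar> \<le> (2 * \<epsilon> * R\<^sup>2) * norm h" for x h
  proof -
    have "\<bar>g (x + h) - g x\<bar> \<le> (2 * \<epsilon> * R) * \<bar>u2 (x + h) - u2 x\<bar>"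
      using lipG[OF in2[of "x + h"] in2[of x]] by (simp add: g_def abs_minus_commute)
    also have "\<dots> \<le> (2 * \<epsilon> * R) * (R * norm h)"
      using wiener_lipschitz[OF u2(1), of x h] mult_right_mono[OF u2(3) norm_ge_zero[of h]] e0 R by (intro mult_left_mono) auto
    finally show ?thesis by (simp add: power2_eq_square ac_simps)
  qed
  define T1 where "T1 x = (F1 (u1 x) - F1 (u2 x)) * w x * frac_lap s u2 x" for x
  define T2 where "T2 x = (F1 (u1 x) - F1 (u2 x)) * (u2 x * frac_lap s w x)" for x
  define T3 where "T3 x = H (u2 x) * w x * frac_lap s u2 x" for x
  define T4 where "T4 x = frac_lap s w x * g x" for x
  have int: "integrable torus T1" "integrable torus T2" "integrable torus T3" "integrable torus T4"
    unfolding T1_def T2_def T3_def T4_def H_def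
    by (intro integrable_continuous_torus continuous_on_mult continuous_on_diff u2c wc Lw Lu F1c gc)+
  have Lb: "\<bar>frac_lap s u2 x\<bar> \<le> R" for x
    using frac_lap_bound[OF s u2(1), of x] u2(3) by linarith
  have i1: "(LINT x|torus. T1 x) \<le> N * R * (L2_norm w)\<^sup>2"
  proof -
    have "(LINT x|torus. T1 x) \<le> (LINT x|torus. N * R * (w x)\<^sup>2)"
    proof (rule integral_mono[OF int(1)])
      show "integrable torus (\<lambda>x. N * R * (w x)\<^sup>2)" by (intro integrable_continuous_torus continuous_intros wc)
      fix x
      have "\<bar>F1 (u1 x) - F1 (u2 x)\<bar> \<le> N * \<bar>w x\<bar>"
        unfolding w_eq using half_deriv_works[OF D1(1)] b1 by (intro lipschitz_on_half_line[OF _ _ in1 in2]) auto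
      then have "\<bar>T1 x\<bar> \<le> (N * \<bar>w x\<bar>) * \<bar>w x\<bar> * R"
        unfolding T1_def abs_mult using Lb[of x] N by (intro mult_mono) auto
      then show "T1 x \<le> N * R * (w x)\<^sup>2" by (simp add: abs_le_iff power2_eq_square ac_simps)
    qed
    then show ?thesis by (simp add: L2_norm_square)
  qed
  have i2: "- (LINT x|torus. T2 x) \<le> (10 + 16 * real CARD('n)) * weight_const N R / 4 * (L2_norm w)\<^sup>2"
  proof -
    have "- ((10 + 16 * real CARD('n)) * (weight_const N R / 4 * (L2_norm w)\<^sup>2)) \<le> (LINT x|torus. T2 x)"
      using dissipative_term[OF s F1 N t1 t2 w w_eq b1 b2 b3] unfolding T2_def L2_norm_square by (simp only: mult_minus_left)
    then have "- (LINT x|torus. T2 x) \<le> (10 + 16 * real CARD('n)) * (weight_const N R / 4 * (L2_norm w)\<^sup>2)" by linarith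
    then show ?thesis by (simp only: times_divide_eq_right times_divide_eq_left mult.assoc)
  qed
  have i3: "(LINT x|torus. T3 x) \<le> sqrt ?V * R\<^sup>2 * (\<epsilon> * L2_norm w)"
  proof -
    have "(LINT x|torus. T3 x) \<le> (LINT x|torus. \<epsilon> * R\<^sup>2 * \<bar>w x\<bar>)"
    proof (rule integral_mono[OF int(3)])
      show "integrable torus (\<lambda>x. \<epsilon> * R\<^sup>2 * \<bar>w x\<bar>)" by (intro integrable_continuous_torus continuous_intros wc)
      fix x
      have "\<bar>H (u2 x)\<bar> \<le> \<epsilon> * R" using H0[OF in2[of x]] in2[of x] e0 by (auto intro: order_trans mult_left_mono)
      then have "\<bar>T3 x\<bar> \<le> (\<epsilon> * R) * \<bar>w x\<bar> * R"
        unfolding T3_def abs_mult using Lb[of x] e0 R by (intro mult_mono) auto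
      then show "T3 x \<le> \<epsilon> * R\<^sup>2 * \<bar>w x\<bar>" by (simp add: abs_le_iff power2_eq_square ac_simps)
    qed
    also have "\<dots> \<le> \<epsilon> * R\<^sup>2 * (sqrt ?V * L2_norm w)"
      using L1_le_L2_norm[OF wc] e0 by (simp add: mult_left_mono)
    finally show ?thesis by (simp add: ac_simps)
  qed
  have i4: "(LINT x|torus. T4 x) \<le> sqrt (?V * real CARD('n)) * (2 * R\<^sup>2) * (\<epsilon> * L2_norm w)"
    using frac_lap_lipschitz_bound[OF s w gc gp _ gL] e0 by (simp add: T4_def ac_simps)
  \<comment> \<open>F1(u1) - F2(u2) is written as F1(u1) - F1(u2) plus H(u2); \<open>g\<close>
    already contains the minus sign of the last product.\<close>
  have "(LINT x|torus. (F1 (u1 x) - F2 (u2 x)) * (w x * frac_lap s u2 x - u2 x * frac_lap s w x)) = (LINT x|torus. T1 x - T2 x + T3 x + T4 x)"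
    by (intro Bochner_Integration.integral_cong refl) (simp add: T1_def T2_def T3_def T4_def g_def H_def algebra_simps)
  also have "\<dots> = (LINT x|torus. T1 x) - (LINT x|torus. T2 x) + (LINT x|torus. T3 x) + (LINT x|torus. T4 x)"
    using int by simp
  also have "\<dots> \<le> N * R * (L2_norm w)\<^sup>2 + (10 + 16 * real CARD('n)) * weight_const N R / 4 * (L2_norm w)\<^sup>2
      + sqrt ?V * R\<^sup>2 * (\<epsilon> * L2_norm w) + sqrt (?V * real CARD('n)) * (2 * R\<^sup>2) * (\<epsilon> * L2_norm w)"
    using i1 i2 i3 i4 by linarith
  also have "\<dots> = (N * R + (10 + 16 * real CARD('n)) * weight_const N R / 4) * (L2_norm w)\<^sup>2
      + (sqrt ?V * R\<^sup>2 + sqrt (?V * real CARD('n)) * (2 * R\<^sup>2)) * (\<epsilon> * L2_norm w)"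
    by (simp only: distrib_right[of "N * R"] distrib_right[of "sqrt ?V * R\<^sup>2"] add.assoc)
  also have "\<dots> \<le> stability_const CARD('n) N R * (L2_norm w)\<^sup>2 + stability_const CARD('n) N R * (\<epsilon> * L2_norm w)"
  proof (intro add_mono mult_right_mono)
    have "0 \<le> weight_const N R" unfolding weight_const_def using N R by simp
    then show "N * R + (10 + 16 * real CARD('n)) * weight_const N R / 4 \<le> stability_const CARD('n) N R"
      "sqrt ?V * R\<^sup>2 + sqrt (?V * real CARD('n)) * (2 * R\<^sup>2) \<le> stability_const CARD('n) N R"
      unfolding stability_const_def using N R by (simp_all add: add_nonneg_nonneg)
  qed (use e0 L2_norm_nonneg[of w] in auto)
  finally show ?thesis by (simp add: distrib_left)
qed

section \<open>Energy identities\<close>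

lemma sobolev_space_diff:
  assumes f: "sobolev_space m f" and g: "sobolev_space m g"
  shows "sobolev_space m (\<lambda>x. f x - g x)"
proof -
  have L2: "torus_L2 f" "torus_L2 g" using f g by (auto simp: sobolev_space_def)
  have "torus_L2 (\<lambda>x. f x - g x)"
    unfolding torus_L2_def
  proof (intro conjI)
    show "torus_periodic (\<lambda>x. f x - g x)"
      using L2 torus_periodic_comp2[of f g "(-)"] by (auto simp: torus_L2_def)
    show m: "(\<lambda>x. f x - g x) \<in> borel_measurable torus"
      using L2 by (auto simp: torus_L2_def)
    show "integrable torus (\<lambda>x. (f x - g x)\<^sup>2)"
    proof (rule Bochner_Integration.integrable_bound)
      show "integrable torus (\<lambda>x. 2 * (f x)\<^sup>2 + 2 * (g x)\<^sup>2)" using L2 by (auto simp: torus_L2_def)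
      show "AE x in torus. norm ((f x - g x)\<^sup>2) \<le> norm (2 * (f x)\<^sup>2 + 2 * (g x)\<^sup>2)"
      proof (rule AE_I2)
        fix x
        have "(f x - g x)\<^sup>2 + (f x + g x)\<^sup>2 = 2 * (f x)\<^sup>2 + 2 * (g x)\<^sup>2" by (simp add: power2_eq_square algebra_simps)
        then have "(f x - g x)\<^sup>2 \<le> 2 * (f x)\<^sup>2 + 2 * (g x)\<^sup>2" using zero_le_power2[of "f x + g x"] by linarith
        then show "norm ((f x - g x)\<^sup>2) \<le> norm (2 * (f x)\<^sup>2 + 2 * (g x)\<^sup>2)" by simp
      qed
    qed (use m in measurable)
  qed
  moreover have "(\<lambda>k. (1 + (norm (freq k))\<^sup>2) ^ m * (cmod (fourier_coeff f k - fourier_coeff g k))\<^sup>2) summable_on UNIV"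
  proof (rule summable_on_comparison_test)
    show "(\<lambda>k. 2 * ((1 + (norm (freq k))\<^sup>2) ^ m * (cmod (fourier_coeff f k))\<^sup>2) + 2 * ((1 + (norm (freq k))\<^sup>2) ^ m * (cmod (fourier_coeff g k))\<^sup>2)) summable_on UNIV"
      using f g by (intro summable_on_add summable_on_cmult_right) (auto simp: sobolev_space_def)
    fix k
    have "(cmod (fourier_coeff f k - fourier_coeff g k))\<^sup>2 \<le> (cmod (fourier_coeff f k) + cmod (fourier_coeff g k))\<^sup>2"
      by (intro power_mono norm_triangle_ineq4) auto
    also have "\<dots> + (cmod (fourier_coeff f k) - cmod (fourier_coeff g k))\<^sup>2 = 2 * (cmod (fourier_coeff f k))\<^sup>2 + 2 * (cmod (fourier_coeff g k))\<^sup>2"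
      by (simp add: power2_eq_square algebra_simps)
    finally have "(cmod (fourier_coeff f k - fourier_coeff g k))\<^sup>2 \<le> 2 * (cmod (fourier_coeff f k))\<^sup>2 + 2 * (cmod (fourier_coeff g k))\<^sup>2"
      using zero_le_power2[of "cmod (fourier_coeff f k) - cmod (fourier_coeff g k)"] by linarith
    from mult_left_mono[OF this, of "(1 + (norm (freq k))\<^sup>2) ^ m"]
    show "(1 + (norm (freq k))\<^sup>2) ^ m * (cmod (fourier_coeff f k - fourier_coeff g k))\<^sup>2 \<le> 2 * ((1 + (norm (freq k))\<^sup>2) ^ m * (cmod (fourier_coeff f k))\<^sup>2) + 2 * ((1 + (norm (freq k))\<^sup>2) ^ m * (cmod (fourier_coeff g k))\<^sup>2)"
      by (simp add: algebra_simps)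
  qed simp
  ultimately show ?thesis
    by (simp add: sobolev_space_def fourier_coeff_diff[OF L2[THEN integrable_torus_L2]])
qed

lemma sobolev_space_cmult:
  assumes f: "sobolev_space m f"
  shows "sobolev_space m (\<lambda>x. c * f x)"
proof -
  have L2: "torus_L2 f" using f by (simp add: sobolev_space_def)
  then have "torus_L2 (\<lambda>x. c * f x)"
    using torus_periodic_comp[of f "(*) c"] by (auto simp: torus_L2_def power_mult_distrib)
  moreover have "(\<lambda>k. c\<^sup>2 * ((1 + (norm (freq k))\<^sup>2) ^ m * (cmod (fourier_coeff f k))\<^sup>2)) summable_on UNIV"
    using f by (intro summable_on_cmult_right) (simp add: sobolev_space_def)
  ultimately show ?thesis
    by (simp add: sobolev_space_def fourier_coeff_cmult norm_mult power_mult_distrib ac_simps)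
qed

lemma sobolev_space_mono:
  assumes f: "sobolev_space m f" and l: "l \<le> m"
  shows "sobolev_space l f"
proof -
  have "(\<lambda>k. (1 + (norm (freq k))\<^sup>2) ^ l * (cmod (fourier_coeff f k))\<^sup>2) summable_on UNIV"
  proof (rule summable_on_comparison_test)
    show "(\<lambda>k. (1 + (norm (freq k))\<^sup>2) ^ m * (cmod (fourier_coeff f k))\<^sup>2) summable_on UNIV"
      using f by (simp add: sobolev_space_def)
    show "(1 + (norm (freq k))\<^sup>2) ^ l * (cmod (fourier_coeff f k))\<^sup>2 \<le> (1 + (norm (freq k))\<^sup>2) ^ m * (cmod (fourier_coeff f k))\<^sup>2" for k
      using l by (intro mult_right_mono power_increasing) auto
  qed simp
  then show ?thesis using f by (simp add: sobolev_space_def)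
qed

lemma wiener_sobolev_pairing_abs:
  assumes a: "wiener a" and h: "sobolev_space l h"
  shows "\<bar>LINT x|torus. a x * h x\<bar> \<le> L2_norm a * sobolev_norm l h"
proof -
  have "sobolev_norm l (\<lambda>x. - 1 * h x) = sobolev_norm l h"
    unfolding sobolev_norm_def fourier_coeff_cmult by (simp add: norm_mult)
  then show ?thesis
    using wiener_sobolev_pairing_bound[OF a h] wiener_sobolev_pairing_bound[OF a sobolev_space_cmult[OF h, of "- 1"]]
    by (simp add: abs_le_iff)
qed

lemma L2_norm_le:
  fixes a :: "real ^ 'n \<Rightarrow> real"
  assumes a: "continuous_on UNIV a" "\<And>x. \<bar>a x\<bar> \<le> c"
  shows "L2_norm a \<le> sqrt ((2 * pi) ^ CARD('n)) * c"
proof -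
  have c: "0 \<le> c" using a(2)[of 0] by linarith
  have "(LINT x|torus. (a x)\<^sup>2) \<le> (LINT x|(torus :: (real^'n) measure). c\<^sup>2)"
  proof (rule integral_mono)
    show "integrable torus (\<lambda>x. (a x)\<^sup>2)" by (intro integrable_continuous_torus continuous_on_power a)
    show "(a x)\<^sup>2 \<le> c\<^sup>2" for x using a(2)[of x] by (metis abs_ge_zero power2_abs power_mono)
  qed simp
  also have "\<dots> = (2 * pi) ^ CARD('n) * c\<^sup>2" by (simp add: measure_torus)
  finally show ?thesis
    unfolding L2_norm_def using c by (metis abs_of_nonneg real_sqrt_abs real_sqrt_le_mono real_sqrt_mult)
qed

text \<open>The part of \<open>u \<in> C(H\<^sup>m) \<inter> C\<^sup>1(H\<^sup>m\<^sup>-\<^sup>1)\<close> that the energy method uses; it involves the time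
  derivative \<open>V\<close> only through its integrals against Wiener functions, and so is insensitive to null sets.\<close>

definition weak_time_derivative :: "(real \<Rightarrow> real ^ 'n \<Rightarrow> real) \<Rightarrow> (real \<Rightarrow> real ^ 'n \<Rightarrow> real) \<Rightarrow> bool" where
  "weak_time_derivative U V \<longleftrightarrow> (\<forall>t\<ge>0. wiener (U t) \<and> integrable torus (V t) \<and>
     ((\<lambda>\<tau>. wiener_norm (\<lambda>x. U \<tau> x - U t x)) \<longlongrightarrow> 0) (at t within {0..}) \<and>
     (\<exists>\<eta>. (\<eta> \<longlongrightarrow> 0) (at t within {0..}) \<and>
       (\<forall>\<tau>\<ge>0. \<tau> \<noteq> t \<longrightarrow> (\<forall>a. wiener a \<longrightarrow>
          \<bar>LINT x|torus. a x * ((U \<tau> x - U t x) / (\<tau> - t) - V t x)\<bar> \<le> L2_norm a * \<eta> \<tau>))))"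

lemma weak_time_derivativeE:
  fixes U V :: "real \<Rightarrow> real ^ 'n \<Rightarrow> real"
  assumes "weak_time_derivative U V" "t \<ge> 0"
  obtains \<eta> where "(\<eta> \<longlongrightarrow> 0) (at t within {0..})"
    "\<And>\<tau> a. \<tau> \<ge> 0 \<Longrightarrow> \<tau> \<noteq> t \<Longrightarrow> wiener a \<Longrightarrow>
       \<bar>LINT x|torus. a x * ((U \<tau> x - U t x) / (\<tau> - t) - V t x)\<bar> \<le> L2_norm a * \<eta> \<tau>"
proof -
  have "\<exists>\<eta>. (\<eta> \<longlongrightarrow> 0) (at t within {0..}) \<and>
       (\<forall>\<tau>\<ge>0. \<tau> \<noteq> t \<longrightarrow> (\<forall>a. wiener a \<longrightarrow>
          \<bar>LINT x|torus. a x * ((U \<tau> x - U t x) / (\<tau> - t) - V t x)\<bar> \<le> L2_norm a * \<eta> \<tau>))"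
    using assms unfolding weak_time_derivative_def by (elim allE impE conjE) assumption+
  then show ?thesis using that by blast
qed

text \<open>The difference of squares factors into a = U \<tau> + U t and d = U \<tau> - U t. The
  weak derivative is tested with a, whose norm stays bounded; then a is replaced by 2 U t at a cost
  governed by the uniform size of d.\<close>

lemma energy_derivative:
  fixes U V :: "real \<Rightarrow> real ^ 'n \<Rightarrow> real"
  assumes UV: "weak_time_derivative U V" and t: "t \<ge> 0"
  shows "((\<lambda>\<tau>. (L2_norm (U \<tau>))\<^sup>2) has_real_derivative 2 * (LINT x|torus. U t x * V t x)) (at t within {0..})"
  unfolding has_field_derivative_iff
proof (rule LIM_zero_cancel)
  have U: "wiener (U \<tau>)" if "\<tau> \<ge> 0" for \<tau> using UV that by (simp add: weak_time_derivative_def)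
  have Vi: "integrable torus (V t)" using UV t by (simp add: weak_time_derivative_def)
  define W where "W \<tau> = wiener_norm (\<lambda>x. U \<tau> x - U t x)" for \<tau>
  have W: "(W \<longlongrightarrow> 0) (at t within {0..})" using UV t by (simp add: weak_time_derivative_def W_def[abs_def])
  obtain \<eta> where \<eta>: "(\<eta> \<longlongrightarrow> 0) (at t within {0..})"
    "\<And>\<tau> a. \<tau> \<ge> 0 \<Longrightarrow> \<tau> \<noteq> t \<Longrightarrow> wiener a \<Longrightarrow>
       \<bar>LINT x|torus. a x * ((U \<tau> x - U t x) / (\<tau> - t) - V t x)\<bar> \<le> L2_norm a * \<eta> \<tau>"
    using weak_time_derivativeE[OF UV t] by blast
  let ?q = "sqrt ((2 * pi) ^ CARD('n))"
  define NV where "NV = (LINT x|torus. \<bar>V t x\<bar>)"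
  let ?B = "\<lambda>\<tau>. ?q * (2 * wiener_norm (U t) + W \<tau>) * \<bar>\<eta> \<tau>\<bar> + W \<tau> * NV"
  let ?Q = "\<lambda>\<tau>. ((L2_norm (U \<tau>))\<^sup>2 - (L2_norm (U t))\<^sup>2) / (\<tau> - t) - 2 * (LINT x|torus. U t x * V t x)"
  have "(?B \<longlongrightarrow> ?q * (2 * wiener_norm (U t) + 0) * \<bar>0\<bar> + 0 * NV) (at t within {0..})"
    by (intro tendsto_intros W \<eta>)
  then have B: "(?B \<longlongrightarrow> 0) (at t within {0..})" by simp
  have le: "\<bar>?Q \<tau>\<bar> \<le> ?B \<tau>" if \<tau>: "\<tau> \<ge> 0" "\<tau> \<noteq> t" for \<tau>
  proof -
    define a where "a x = U \<tau> x + U t x" for x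
    define d where "d x = U \<tau> x - U t x" for x
    have a: "wiener a" and d: "wiener d"
      unfolding a_def d_def by (intro wiener_add_diff U \<tau> t)+
    note ac = wiener_continuous[OF a] and dc = wiener_continuous[OF d]
    note Uc = wiener_continuous[OF U]
    have dle: "\<bar>d x\<bar> \<le> W \<tau>" for x using wiener_bound[OF d, of x] by (simp add: W_def d_def[abs_def])
    have ale: "\<bar>a x\<bar> \<le> 2 * wiener_norm (U t) + W \<tau>" for x
    proof -
      have "a x = 2 * U t x + d x" by (simp add: a_def d_def)
      then show ?thesis using wiener_bound[OF U[OF t], of x] dle[of x] by linarith
    qed
    have W0: "W \<tau> \<ge> 0" by (simp add: W_def wiener_norm_nonneg)
    have i1: "integrable torus (\<lambda>x. a x * ((1 / (\<tau> - t)) * d x))" by (intro integrable_continuous_torus continuous_on_mult continuous_on_const ac dc)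
    have i2: "integrable torus (\<lambda>x. a x * V t x)" "integrable torus (\<lambda>x. d x * V t x)" "integrable torus (\<lambda>x. U t x * V t x)"
      by (intro integrable_mult_continuous_torus Vi ac dc Uc t)+
    have "((L2_norm (U \<tau>))\<^sup>2 - (L2_norm (U t))\<^sup>2) / (\<tau> - t) = (LINT x|torus. (U \<tau> x)\<^sup>2 - (U t x)\<^sup>2) / (\<tau> - t)"
      unfolding L2_norm_square
      by (subst Bochner_Integration.integral_diff) (auto intro!: integrable_continuous_torus continuous_on_power Uc \<tau> t)
    also have "\<dots> = (LINT x|torus. (1 / (\<tau> - t)) * ((U \<tau> x)\<^sup>2 - (U t x)\<^sup>2))"
      by (simp only: integral_mult_right_zero) simp
    also have "\<dots> = (LINT x|torus. a x * ((1 / (\<tau> - t)) * d x))"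
      by (intro Bochner_Integration.integral_cong refl) (simp add: a_def d_def power2_eq_square field_simps)
    finally have e: "?Q \<tau> = ((LINT x|torus. a x * ((1 / (\<tau> - t)) * d x)) - (LINT x|torus. a x * V t x)) + ((LINT x|torus. a x * V t x) - 2 * (LINT x|torus. U t x * V t x))"
      by simp
    have "(LINT x|torus. a x * ((1 / (\<tau> - t)) * d x)) - (LINT x|torus. a x * V t x) = (LINT x|torus. a x * ((1 / (\<tau> - t)) * d x) - a x * V t x)"
      by (rule Bochner_Integration.integral_diff[OF i1 i2(1), symmetric])
    also have "\<dots> = (LINT x|torus. a x * ((U \<tau> x - U t x) / (\<tau> - t) - V t x))"
      by (intro Bochner_Integration.integral_cong refl) (simp add: d_def algebra_simps diff_divide_distrib add_divide_distrib)
    also have "\<bar>\<dots>\<bar> \<le> L2_norm a * \<eta> \<tau>" by (rule \<eta>(2)[OF \<tau> a])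
    also have "\<dots> \<le> L2_norm a * \<bar>\<eta> \<tau>\<bar>"
      using L2_norm_nonneg[of a] by (intro mult_left_mono abs_ge_self)
    also have "\<dots> \<le> (?q * (2 * wiener_norm (U t) + W \<tau>)) * \<bar>\<eta> \<tau>\<bar>"
      by (intro mult_right_mono L2_norm_le[OF ac ale]) simp
    finally have p1: "\<bar>(LINT x|torus. a x * ((1 / (\<tau> - t)) * d x)) - (LINT x|torus. a x * V t x)\<bar> \<le> ?q * (2 * wiener_norm (U t) + W \<tau>) * \<bar>\<eta> \<tau>\<bar>" .
    have "(LINT x|torus. a x * V t x) = (LINT x|torus. d x * V t x + 2 * (U t x * V t x))"
      by (intro Bochner_Integration.integral_cong refl) (simp add: a_def d_def algebra_simps)
    also have "\<dots> = (LINT x|torus. d x * V t x) + 2 * (LINT x|torus. U t x * V t x)"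
      using i2 by simp
    finally have "(LINT x|torus. a x * V t x) - 2 * (LINT x|torus. U t x * V t x) = (LINT x|torus. d x * V t x)" by simp
    also have "\<bar>\<dots>\<bar> \<le> (LINT x|torus. \<bar>d x * V t x\<bar>)" by (rule integral_abs_bound)
    also have "\<dots> \<le> (LINT x|torus. W \<tau> * \<bar>V t x\<bar>)"
    proof (rule integral_mono)
      show "integrable torus (\<lambda>x. \<bar>d x * V t x\<bar>)" "integrable torus (\<lambda>x. W \<tau> * \<bar>V t x\<bar>)" using i2 Vi by auto
      show "\<bar>d x * V t x\<bar> \<le> W \<tau> * \<bar>V t x\<bar>" for x
        unfolding abs_mult by (intro mult_right_mono dle) auto
    qed
    also have "\<dots> = W \<tau> * NV" by (simp add: NV_def)
    finally show ?thesis using p1 unfolding e by linarith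
  qed
  show "(?Q \<longlongrightarrow> 0) (at t within {0..})"
  proof (rule Lim_null_comparison[OF _ B])
    show "\<forall>\<^sub>F \<tau> in at t within {0..}. norm (?Q \<tau>) \<le> ?B \<tau>"
      using le by (simp add: eventually_at_filter)
  qed
qed

lemma weak_time_derivative_diff:
  fixes U1 V1 U2 V2 :: "real \<Rightarrow> real ^ 'n \<Rightarrow> real"
  assumes 1: "weak_time_derivative U1 V1" and 2: "weak_time_derivative U2 V2"
  shows "weak_time_derivative (\<lambda>t x. U1 t x - U2 t x) (\<lambda>t x. V1 t x - V2 t x)"
  unfolding weak_time_derivative_def
proof (intro allI impI conjI)
  fix t :: real assume t: "t \<ge> 0"
  have U: "wiener (U1 \<tau>)" "wiener (U2 \<tau>)" if "\<tau> \<ge> 0" for \<tau>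
    using 1 2 that by (simp_all add: weak_time_derivative_def)
  show "wiener (\<lambda>x. U1 t x - U2 t x)" by (intro wiener_add_diff U t)
  have V: "integrable torus (V1 t)" "integrable torus (V2 t)" using 1 2 t by (simp_all add: weak_time_derivative_def)
  then show "integrable torus (\<lambda>x. V1 t x - V2 t x)" by simp
  show "((\<lambda>\<tau>. wiener_norm (\<lambda>x. U1 \<tau> x - U2 \<tau> x - (U1 t x - U2 t x))) \<longlongrightarrow> 0) (at t within {0..})"
  proof (rule Lim_null_comparison)
    have "((\<lambda>\<tau>. wiener_norm (\<lambda>x. U1 \<tau> x - U1 t x) + wiener_norm (\<lambda>x. U2 \<tau> x - U2 t x)) \<longlongrightarrow> 0 + 0) (at t within {0..})"
      using 1 2 t by (intro tendsto_add) (auto simp: weak_time_derivative_def)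
    then show "((\<lambda>\<tau>. wiener_norm (\<lambda>x. U1 \<tau> x - U1 t x) + wiener_norm (\<lambda>x. U2 \<tau> x - U2 t x)) \<longlongrightarrow> 0) (at t within {0..})"
      by simp
    have "wiener_norm (\<lambda>x. U1 \<tau> x - U2 \<tau> x - (U1 t x - U2 t x)) \<le> wiener_norm (\<lambda>x. U1 \<tau> x - U1 t x) + wiener_norm (\<lambda>x. U2 \<tau> x - U2 t x)" if "\<tau> \<ge> 0" for \<tau>
    proof -
      have "(\<lambda>x. U1 \<tau> x - U2 \<tau> x - (U1 t x - U2 t x)) = (\<lambda>x. (U1 \<tau> x - U1 t x) - (U2 \<tau> x - U2 t x))"
        by (simp add: fun_eq_iff)
      then show ?thesis
        using wiener_add_diff(3)[OF wiener_add_diff(2)[OF U(1)[OF that] U(1)[OF t]] wiener_add_diff(2)[OF U(2)[OF that] U(2)[OF t]]] by simp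
    qed
    then show "\<forall>\<^sub>F \<tau> in at t within {0..}. norm (wiener_norm (\<lambda>x. U1 \<tau> x - U2 \<tau> x - (U1 t x - U2 t x))) \<le> wiener_norm (\<lambda>x. U1 \<tau> x - U1 t x) + wiener_norm (\<lambda>x. U2 \<tau> x - U2 t x)"
      by (simp add: eventually_at_filter wiener_norm_nonneg)
  qed
  obtain \<eta>1 where \<eta>1: "(\<eta>1 \<longlongrightarrow> 0) (at t within {0..})"
    "\<And>\<tau> a. \<tau> \<ge> 0 \<Longrightarrow> \<tau> \<noteq> t \<Longrightarrow> wiener a \<Longrightarrow>
       \<bar>LINT x|torus. a x * ((U1 \<tau> x - U1 t x) / (\<tau> - t) - V1 t x)\<bar> \<le> L2_norm a * \<eta>1 \<tau>"
    using weak_time_derivativeE[OF 1 t] by blast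
  obtain \<eta>2 where \<eta>2: "(\<eta>2 \<longlongrightarrow> 0) (at t within {0..})"
    "\<And>\<tau> a. \<tau> \<ge> 0 \<Longrightarrow> \<tau> \<noteq> t \<Longrightarrow> wiener a \<Longrightarrow>
       \<bar>LINT x|torus. a x * ((U2 \<tau> x - U2 t x) / (\<tau> - t) - V2 t x)\<bar> \<le> L2_norm a * \<eta>2 \<tau>"
    using weak_time_derivativeE[OF 2 t] by blast
  show "\<exists>\<eta>. (\<eta> \<longlongrightarrow> 0) (at t within {0..}) \<and> (\<forall>\<tau>\<ge>0. \<tau> \<noteq> t \<longrightarrow> (\<forall>a. wiener a \<longrightarrow>
      \<bar>LINT x|torus. a x * ((U1 \<tau> x - U2 \<tau> x - (U1 t x - U2 t x)) / (\<tau> - t) - (V1 t x - V2 t x))\<bar> \<le> L2_norm a * \<eta> \<tau>))"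
  proof (intro exI[of _ "\<lambda>\<tau>. \<eta>1 \<tau> + \<eta>2 \<tau>"] conjI allI impI)
    show "((\<lambda>\<tau>. \<eta>1 \<tau> + \<eta>2 \<tau>) \<longlongrightarrow> 0) (at t within {0..})"
      using tendsto_add[OF \<eta>1(1) \<eta>2(1)] by simp
    fix \<tau> :: real and a :: "real ^ 'n \<Rightarrow> real" assume \<tau>: "\<tau> \<ge> 0" "\<tau> \<noteq> t" and a: "wiener a"
    have int: "integrable torus (\<lambda>x. a x * ((1 / (\<tau> - t)) * (U \<tau> x - U t x) - V t x))"
      if "wiener (U \<tau>)" "wiener (U t)" "integrable torus (V t)" for U V :: "real \<Rightarrow> real ^ 'n \<Rightarrow> real"
      by (intro integrable_mult_continuous_torus wiener_continuous a Bochner_Integration.integrable_diff that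
        integrable_continuous_torus continuous_on_mult continuous_on_const continuous_on_diff)
    have "(LINT x|torus. a x * ((U1 \<tau> x - U2 \<tau> x - (U1 t x - U2 t x)) / (\<tau> - t) - (V1 t x - V2 t x))) =
        (LINT x|torus. a x * ((1 / (\<tau> - t)) * (U1 \<tau> x - U1 t x) - V1 t x) - a x * ((1 / (\<tau> - t)) * (U2 \<tau> x - U2 t x) - V2 t x))"
      by (intro Bochner_Integration.integral_cong refl) (simp add: diff_divide_distrib add_divide_distrib algebra_simps)
    also have "\<dots> = (LINT x|torus. a x * ((U1 \<tau> x - U1 t x) / (\<tau> - t) - V1 t x)) - (LINT x|torus. a x * ((U2 \<tau> x - U2 t x) / (\<tau> - t) - V2 t x))"
      by (subst Bochner_Integration.integral_diff[OF int[of U1 V1] int[of U2 V2]]) (use U \<tau> t V in auto)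
    finally show "\<bar>LINT x|torus. a x * ((U1 \<tau> x - U2 \<tau> x - (U1 t x - U2 t x)) / (\<tau> - t) - (V1 t x - V2 t x))\<bar> \<le> L2_norm a * (\<eta>1 \<tau> + \<eta>2 \<tau>)"
      using \<eta>1(2)[OF \<tau> a] \<eta>2(2)[OF \<tau> a] unfolding distrib_left by linarith
  qed
qed

text \<open>The equation tested with \<open>a\<close>, the multiplier on u F(u) having been moved to
  \<open>a\<close>. The representatives p and q are gone, and for solutions the right-hand integrand
  is continuous.\<close>

definition weak_equation :: "real \<Rightarrow> (real \<Rightarrow> real) \<Rightarrow> (real \<Rightarrow> real ^ 'n \<Rightarrow> real) \<Rightarrow> (real \<Rightarrow> real ^ 'n \<Rightarrow> real) \<Rightarrow> bool" where
  "weak_equation s F u v \<longleftrightarrow> (\<forall>t\<ge>0. \<forall>a. wiener a \<longrightarrow> (LINT x|torus. a x * v t x) =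
     (LINT x|torus. a x * F (u t x) * frac_lap s (u t) x - frac_lap s a x * (u t x * F (u t x))))"

lemma solution_weak_time_derivative:
  fixes u :: "real \<Rightarrow> real ^ 'n \<Rightarrow> real"
  assumes m: "real m > real CARD('n) / 2 + 1" and s: "0 < s" "s \<le> 1" and F: "admissible F"
    and sol: "positive_global_solution m s F u0 u"
  obtains v where "weak_time_derivative u v" "weak_equation s F u v"
proof -
  obtain C where C: "C \<ge> 0" "\<And>f :: real ^ 'n \<Rightarrow> real. continuous_on UNIV f \<Longrightarrow> sobolev_space m f \<Longrightarrow> wiener f \<and> wiener_norm f \<le> C * sobolev_norm m f"
    using sobolev_imp_wiener[OF m] by metis
  obtain v where vc: "sobolev_continuous (m - 1) v" and vd: "sobolev_time_derivative (m - 1) u v"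
    and eq: "\<And>t. t \<ge> 0 \<Longrightarrow> \<exists>p q. has_frac_laplacian s (u t) p \<and> has_frac_laplacian s (\<lambda>x. u t x * F (u t x)) q \<and> (AE x in torus. v t x = F (u t x) * p x - q x)"
    using sol unfolding positive_global_solution_def by blast
  have uc: "continuous_on UNIV (u t)" and upos: "0 < u t x" and us: "sobolev_space m (u t)"
    and ut: "((\<lambda>\<tau>. sobolev_norm m (\<lambda>x. u \<tau> x - u t x)) \<longlongrightarrow> 0) (at t within {0..})" if "t \<ge> 0" for t x
    using sol that unfolding positive_global_solution_def sobolev_continuous_def by blast+
  have vs: "sobolev_space (m - 1) (v t)" if "t \<ge> 0" for t using vc that by (simp add: sobolev_continuous_def)
  have uw: "wiener (u t)" if "t \<ge> 0" for t using C(2)[OF uc us] that by blast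
  have "weak_time_derivative u v"
    unfolding weak_time_derivative_def
  proof (intro allI impI conjI)
    fix t :: real assume t: "t \<ge> 0"
    show "wiener (u t)" by (rule uw[OF t])
    show "integrable torus (v t)" using vs[OF t] by (simp add: sobolev_space_def integrable_torus_L2)
    show "((\<lambda>\<tau>. wiener_norm (\<lambda>x. u \<tau> x - u t x)) \<longlongrightarrow> 0) (at t within {0..})"
    proof (rule Lim_null_comparison)
      show "((\<lambda>\<tau>. C * sobolev_norm m (\<lambda>x. u \<tau> x - u t x)) \<longlongrightarrow> 0) (at t within {0..})"
        using ut[OF t] by (rule tendsto_mult_right_zero)
      have "wiener_norm (\<lambda>x. u \<tau> x - u t x) \<le> C * sobolev_norm m (\<lambda>x. u \<tau> x - u t x)" if "\<tau> \<ge> 0" for \<tau>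
        using C(2)[OF continuous_on_diff[OF uc[OF that] uc[OF t]] sobolev_space_diff[OF us[OF that] us[OF t]]] by blast
      then show "\<forall>\<^sub>F \<tau> in at t within {0..}. norm (wiener_norm (\<lambda>x. u \<tau> x - u t x)) \<le> C * sobolev_norm m (\<lambda>x. u \<tau> x - u t x)"
        by (simp add: eventually_at_filter wiener_norm_nonneg)
    qed
    show "\<exists>\<eta>. (\<eta> \<longlongrightarrow> 0) (at t within {0..}) \<and> (\<forall>\<tau>\<ge>0. \<tau> \<noteq> t \<longrightarrow> (\<forall>a. wiener a \<longrightarrow>
        \<bar>LINT x|torus. a x * ((u \<tau> x - u t x) / (\<tau> - t) - v t x)\<bar> \<le> L2_norm a * \<eta> \<tau>))"
    \<comment> \<open>The H^(m-1) norm of the quotient error itself serves as \<eta>.\<close>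
    proof (intro exI[of _ "\<lambda>\<tau>. sobolev_norm (m - 1) (\<lambda>x. (u \<tau> x - u t x) / (\<tau> - t) - v t x)"] conjI allI impI)
      show "((\<lambda>\<tau>. sobolev_norm (m - 1) (\<lambda>x. (u \<tau> x - u t x) / (\<tau> - t) - v t x)) \<longlongrightarrow> 0) (at t within {0..})"
        using vd t by (simp add: sobolev_time_derivative_def)
      fix \<tau> :: real and a :: "real ^ 'n \<Rightarrow> real" assume \<tau>: "\<tau> \<ge> 0" and a: "wiener a"
      have "sobolev_space (m - 1) (\<lambda>x. (1 / (\<tau> - t)) * (u \<tau> x - u t x) - v t x)"
        by (intro sobolev_space_diff sobolev_space_cmult sobolev_space_mono[OF us] vs t \<tau>) auto
      then show "\<bar>LINT x|torus. a x * ((u \<tau> x - u t x) / (\<tau> - t) - v t x)\<bar> \<le> L2_norm a * sobolev_norm (m - 1) (\<lambda>x. (u \<tau> x - u t x) / (\<tau> - t) - v t x)"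
        using wiener_sobolev_pairing_abs[OF a, of "m - 1" "\<lambda>x. (u \<tau> x - u t x) / (\<tau> - t) - v t x"] by simp
    qed
  qed
  moreover have "(LINT x|torus. a x * v t x) =
       (LINT x|torus. a x * F (u t x) * frac_lap s (u t) x - frac_lap s a x * (u t x * F (u t x)))"
    if t: "t \<ge> 0" and a: "wiener a" for t a
  proof -
    obtain p q where p: "has_frac_laplacian s (u t) p" and q: "has_frac_laplacian s (\<lambda>x. u t x * F (u t x)) q"
      and ae: "AE x in torus. v t x = F (u t x) * p x - q x"
      using eq[OF t] by blast
    note ac = wiener_continuous[OF a]
    \<comment> \<open>Positivity of u keeps the argument of F in {0..}, the set on which F is known
      to be continuous.\<close>
    have Fc: "continuous_on UNIV (\<lambda>x. F (u t x))"
      by (rule continuous_on_compose2[OF differentiable_imp_continuous_on[OF admissible_derivs(1)[OF F]] uc[OF t]])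
        (use upos[OF t] in \<open>auto simp: less_imp_le\<close>)
    have aFc: "continuous_on UNIV (\<lambda>x. a x * F (u t x))" by (intro continuous_on_mult ac Fc)
    have aFp: "torus_periodic (\<lambda>x. a x * F (u t x))"
      using torus_periodic_comp2[OF wiener_periodic[OF a] wiener_periodic[OF uw[OF t]], of "\<lambda>b c. b * F c"] .
    have pi: "integrable torus p" and qi: "integrable torus q"
      using p q by (simp_all add: has_frac_laplacian_def integrable_torus_L2)
    have i: "integrable torus (\<lambda>x. a x * F (u t x) * p x)" "integrable torus (\<lambda>x. a x * q x)"
      by (intro integrable_mult_continuous_torus aFc ac pi qi)+
    have "(LINT x|torus. a x * v t x) = (LINT x|torus. a x * F (u t x) * p x - a x * q x)"
    proof (rule integral_cong_AE)
      show "(\<lambda>x. a x * v t x) \<in> borel_measurable torus"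
        using continuous_measurable_torus[OF ac] vs[OF t] by (auto simp: sobolev_space_def torus_L2_def)
      show "(\<lambda>x. a x * F (u t x) * p x - a x * q x) \<in> borel_measurable torus" using i by auto
      show "AE x in torus. a x * v t x = a x * F (u t x) * p x - a x * q x"
        using ae by eventually_elim (simp only: right_diff_distrib mult.assoc)
    qed
    also have "\<dots> = (LINT x|torus. a x * F (u t x) * p x) - (LINT x|torus. a x * q x)"
      by (rule Bochner_Integration.integral_diff[OF i])
    also have "\<dots> = (LINT x|torus. a x * F (u t x) * frac_lap s (u t) x) - (LINT x|torus. frac_lap s a x * (u t x * F (u t x)))"
      by (simp only: has_frac_laplacian_integral[OF p uw[OF t] s aFc aFp] has_frac_laplacian_symmetric[OF q a s])
    also have "\<dots> = (LINT x|torus. a x * F (u t x) * frac_lap s (u t) x - frac_lap s a x * (u t x * F (u t x)))"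
      by (intro Bochner_Integration.integral_diff[symmetric] integrable_continuous_torus continuous_on_mult aFc Fc uc t
          frac_lap_continuous[OF s uw] frac_lap_continuous[OF s a])
    finally show ?thesis .
  qed
  then have "weak_equation s F u v" by (simp add: weak_equation_def)
  ultimately show ?thesis by (rule that)
qed

lemma solution_wiener:
  fixes u :: "real \<Rightarrow> real ^ 'n \<Rightarrow> real"
  assumes "weak_time_derivative u v" "t \<ge> 0"
  shows "wiener (u t)"
  using assms by (simp add: weak_time_derivative_def)

text \<open>Testing with a = u makes the two terms under the integral cancel pointwise, so the
  squared norm has zero derivative on the half-line.\<close>

lemma L2_norm_conserved:
  fixes u :: "real \<Rightarrow> real ^ 'n \<Rightarrow> real"
  assumes m: "real m > real CARD('n) / 2 + 1" and s: "0 < s" "s \<le> 1" and F: "admissible F"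
    and sol: "positive_global_solution m s F u0 u" and t: "t \<ge> 0"
  shows "L2_norm (u t) = L2_norm u0"
proof -
  obtain v where v: "weak_time_derivative u v" "weak_equation s F u v"
    using solution_weak_time_derivative[OF m s F sol] by blast
  have "((\<lambda>\<tau>. (L2_norm (u \<tau>))\<^sup>2) has_real_derivative 0) (at r within {0..})" if r: "r \<in> {0..}" for r
  proof -
    have "(LINT x|torus. u r x * v r x) = 0"
    proof -
      have "wiener (u r)" using r by (simp add: solution_wiener[OF v(1)])
      then have "(LINT x|torus. u r x * v r x) = (LINT x|torus. u r x * F (u r x) * frac_lap s (u r) x - frac_lap s (u r) x * (u r x * F (u r x)))"
        using v(2) r by (simp add: weak_equation_def)
      also have "\<dots> = (LINT x|(torus :: (real ^ 'n) measure). 0)" by (intro Bochner_Integration.integral_cong refl) simp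
      finally show ?thesis by simp
    qed
    then show ?thesis using energy_derivative[OF v(1), of r] r by simp
  qed
  then obtain c where "\<And>r. r \<in> {0..} \<Longrightarrow> (L2_norm (u r))\<^sup>2 = c"
    using has_field_derivative_zero_constant[of "{0..}" "\<lambda>\<tau>. (L2_norm (u \<tau>))\<^sup>2"] by (metis convex_real_interval(1))
  then have "(L2_norm (u t))\<^sup>2 = (L2_norm (u 0))\<^sup>2" using t by simp
  moreover have "u 0 = u0" using sol by (simp add: positive_global_solution_def)
  ultimately show ?thesis using L2_norm_nonneg by (metis power2_eq_imp_eq)
qed

text \<open>Formally y = sqrt E satisfies y' <= C (y + \<epsilon>), so (y + \<epsilon>) exp (- C t)
  does not increase. Working with the square root is what lets \<epsilon> stand beside the initial
  norm under one exponential.\<close>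

lemma gronwall_sqrt:
  fixes E E' :: "real \<Rightarrow> real"
  assumes T: "T > 0" and C: "C \<ge> 0" and eps: "\<epsilon> \<ge> 0"
    and d: "\<And>t. t \<in> {0..T} \<Longrightarrow> (E has_real_derivative E' t) (at t within {0..T})"
    and E0: "\<And>t. E t \<ge> 0"
    and le: "\<And>t. t \<in> {0..T} \<Longrightarrow> E' t \<le> 2 * C * (E t + \<epsilon> * sqrt (E t))"
  shows "sqrt (E T) \<le> (sqrt (E 0) + \<epsilon>) * exp (C * T)"
proof -
  have main: "sqrt (E T) \<le> (sqrt (E 0) + \<delta> + \<epsilon>) * exp (C * T)" if \<delta>: "\<delta> > 0" for \<delta>
  proof -
    \<comment> \<open>\<open>\<delta>\<close> removes the singularity of the square root where \<open>E\<close> vanishes\<close>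
    define y where "y t = sqrt (E t + \<delta>\<^sup>2)" for t
    have pos: "0 < E t + \<delta>\<^sup>2" for t using E0[of t] \<delta> by (simp add: add_nonneg_pos)
    have y0: "0 < y t" for t using pos[of t] by (simp add: y_def)
    define g where "g t = (y t + \<epsilon>) * exp (- C * t)" for t
    have g': "(g has_real_derivative (E' t / (2 * y t) - C * (y t + \<epsilon>)) * exp (- C * t)) (at t within {0..T})" if t: "t \<in> {0..T}" for t
      unfolding g_def y_def using d[OF t] pos[of t]
      by (auto intro!: derivative_eq_intros simp: field_simps)
    have "\<exists>t\<in>{0<..<T}. g T - g 0 = ((E' t / (2 * y t) - C * (y t + \<epsilon>)) * exp (- C * t)) * (T - 0)"
      by (rule mvt_simple[OF T]) (use g' in \<open>auto simp: has_field_derivative_def\<close>)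
    then obtain t where t: "t \<in> {0<..<T}" and gT: "g T - g 0 = ((E' t / (2 * y t) - C * (y t + \<epsilon>)) * exp (- C * t)) * (T - 0)"
      by blast
    have "E t + \<epsilon> * sqrt (E t) \<le> y t * (y t + \<epsilon>)"
    proof -
      have "sqrt (E t) \<le> y t" by (simp add: y_def)
      then have "\<epsilon> * sqrt (E t) \<le> \<epsilon> * y t" using eps by (rule mult_left_mono)
      moreover have "E t \<le> y t * y t" using pos[of t] by (simp add: y_def)
      ultimately show ?thesis by (simp add: algebra_simps)
    qed
    then have "2 * C * (E t + \<epsilon> * sqrt (E t)) \<le> 2 * C * (y t * (y t + \<epsilon>))" using C by (intro mult_left_mono) auto
    then have "E' t \<le> 2 * C * (y t * (y t + \<epsilon>))" using le[of t] t by simp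
    also have "\<dots> = C * (y t + \<epsilon>) * (2 * y t)" by simp
    finally have "E' t / (2 * y t) \<le> C * (y t + \<epsilon>)"
      using y0[of t] by (simp add: pos_divide_le_eq)
    then have "((E' t / (2 * y t) - C * (y t + \<epsilon>)) * exp (- C * t)) * (T - 0) \<le> 0"
      using T by (intro mult_nonpos_nonneg) auto
    then have "g T \<le> g 0" using gT by linarith
    then have "y T + \<epsilon> \<le> (y 0 + \<epsilon>) * exp (C * T)"
      by (simp add: g_def exp_minus field_simps)
    moreover have "sqrt (E T) \<le> y T" by (simp add: y_def)
    moreover have "y 0 \<le> sqrt (E 0) + \<delta>"
      using sqrt_add_le_add_sqrt[of "E 0" "\<delta>\<^sup>2"] E0 \<delta> by (simp add: y_def)
    then have "(y 0 + \<epsilon>) * exp (C * T) \<le> (sqrt (E 0) + \<delta> + \<epsilon>) * exp (C * T)"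
      by (intro mult_right_mono) auto
    ultimately show ?thesis using eps by linarith
  qed
  show ?thesis
  proof (rule field_le_epsilon)
    fix e :: real assume "e > 0"
    then have "sqrt (E T) \<le> (sqrt (E 0) + e / exp (C * T) + \<epsilon>) * exp (C * T)" by (intro main) simp
    also have "\<dots> = (sqrt (E 0) + \<epsilon>) * exp (C * T) + e" by (simp add: algebra_simps)
    finally show "sqrt (E T) \<le> (sqrt (E 0) + \<epsilon>) * exp (C * T) + e" .
  qed
qed

text \<open>Testing both equations with w gives the energy inequality; one bound \<open>R\<close>
  for both Wiener norms on {0..T} makes the Gronwall coefficient constant in time.\<close>

lemma L2_stability:
  fixes u1 u2 :: "real \<Rightarrow> real ^ 'n \<Rightarrow> real"
  assumes m: "real m > real CARD('n) / 2 + 1" and s: "0 < s" "s \<le> 1"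
    and F1: "admissible F1" and F2: "admissible F2" and N: "N \<ge> 0"
    and sol1: "positive_global_solution m s F1 u10 u1" and sol2: "positive_global_solution m s F2 u20 u2"
    and T: "T > 0"
    and R: "\<And>t. t \<in> {0..T} \<Longrightarrow> wiener_norm (u1 t) \<le> R" "\<And>t. t \<in> {0..T} \<Longrightarrow> wiener_norm (u2 t) \<le> R"
    and b1: "\<And>z. z \<in> {0..R} \<Longrightarrow> \<bar>half_deriv F1 z\<bar> \<le> N"
    and b2: "\<And>z. z \<in> {0..R} \<Longrightarrow> \<bar>half_deriv (half_deriv F1) z\<bar> \<le> N"
    and b3: "\<And>z. z \<in> {0..R} \<Longrightarrow> \<bar>half_deriv (half_deriv (half_deriv F1)) z\<bar> \<le> N"
    and eps: "\<And>z. z \<ge> 0 \<Longrightarrow> \<bar>half_deriv F1 z - half_deriv F2 z\<bar> \<le> \<epsilon>"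
  shows "L2_norm (\<lambda>x. u1 T x - u2 T x) \<le> (L2_norm (\<lambda>x. u10 x - u20 x) + \<epsilon>) * exp (stability_const CARD('n) N R * T)"
proof -
  obtain v1 where v1: "weak_time_derivative u1 v1" "weak_equation s F1 u1 v1"
    using solution_weak_time_derivative[OF m s F1 sol1] by blast
  obtain v2 where v2: "weak_time_derivative u2 v2" "weak_equation s F2 u2 v2"
    using solution_weak_time_derivative[OF m s F2 sol2] by blast
  define w where "w t x = u1 t x - u2 t x" for t x
  have w: "weak_time_derivative w (\<lambda>t x. v1 t x - v2 t x)"
    unfolding w_def by (rule weak_time_derivative_diff[OF v1(1) v2(1)])
  define E where "E t = (L2_norm (w t))\<^sup>2" for t
  have R0: "0 \<le> R" using R(1)[of 0] wiener_norm_nonneg[of "u1 0"] T by simp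
  have e0: "0 \<le> \<epsilon>" using eps[of 0] by linarith
  have C0: "0 \<le> stability_const CARD('n) N R"
    unfolding stability_const_def weight_const_def using N R0 by simp
  have pos: "0 < u1 t x" "0 < u2 t x" if "t \<ge> 0" for t x
    using sol1 sol2 that by (simp_all add: positive_global_solution_def)
  have id: "(LINT x|torus. w t x * (v1 t x - v2 t x)) =
     (LINT x|torus. (F1 (u1 t x) - F2 (u2 t x)) * (w t x * frac_lap s (u2 t) x - u2 t x * frac_lap s (w t) x))" if t: "t \<ge> 0" for t
  proof -
    note W = solution_wiener[OF w t] and U1 = solution_wiener[OF v1(1) t] and U2 = solution_wiener[OF v2(1) t]
    note Wc = wiener_continuous[OF W] and U1c = wiener_continuous[OF U1] and U2c = wiener_continuous[OF U2]
    have Fc: "continuous_on UNIV (\<lambda>x. F1 (u1 t x))" "continuous_on UNIV (\<lambda>x. F2 (u2 t x))"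
      using pos[OF t]
      by (auto intro!: continuous_on_compose2[OF differentiable_imp_continuous_on[OF admissible_derivs(1)[OF F1]] U1c]
        continuous_on_compose2[OF differentiable_imp_continuous_on[OF admissible_derivs(1)[OF F2]] U2c] simp: less_imp_le)
    have vi: "integrable torus (v1 t)" "integrable torus (v2 t)"
      using v1(1) v2(1) t by (simp_all add: weak_time_derivative_def)
    have "(LINT x|torus. w t x * (v1 t x - v2 t x)) = (LINT x|torus. w t x * v1 t x) - (LINT x|torus. w t x * v2 t x)"
      unfolding right_diff_distrib by (intro Bochner_Integration.integral_diff integrable_mult_continuous_torus Wc vi)
    also have "\<dots> = (LINT x|torus. w t x * F1 (u1 t x) * frac_lap s (u1 t) x - frac_lap s (w t) x * (u1 t x * F1 (u1 t x)))
       - (LINT x|torus. w t x * F2 (u2 t x) * frac_lap s (u2 t) x - frac_lap s (w t) x * (u2 t x * F2 (u2 t x)))"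
      using v1(2) v2(2) t W by (simp add: weak_equation_def)
    also have "\<dots> = (LINT x|torus. (w t x * F1 (u1 t x) * frac_lap s (u1 t) x - frac_lap s (w t) x * (u1 t x * F1 (u1 t x)))
       - (w t x * F2 (u2 t x) * frac_lap s (u2 t) x - frac_lap s (w t) x * (u2 t x * F2 (u2 t x))))"
      by (intro Bochner_Integration.integral_diff[symmetric] integrable_continuous_torus continuous_on_mult continuous_on_diff
        Wc U1c U2c Fc frac_lap_continuous[OF s W] frac_lap_continuous[OF s U1] frac_lap_continuous[OF s U2])
    also have "\<dots> = (LINT x|torus. (F1 (u1 t x) - F2 (u2 t x)) * (w t x * frac_lap s (u2 t) x - u2 t x * frac_lap s (w t) x))"
    proof (intro Bochner_Integration.integral_cong refl)
      fix x
      have "frac_lap s (w t) x = frac_lap s (u1 t) x - frac_lap s (u2 t) x"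
        unfolding w_def by (rule frac_lap_diff[OF s U1 U2])
      \<comment> \<open>Expressed through w and u2, the two occurrences of F1(u1) w
        \<open>|\<nabla>|^s\<close> w cancel, and what remains has the common factor F1(u1) -
        F2(u2).\<close>
      then have "frac_lap s (u1 t) x = frac_lap s (w t) x + frac_lap s (u2 t) x" "u1 t x = w t x + u2 t x" by (simp_all add: w_def)
      then show "(w t x * F1 (u1 t x) * frac_lap s (u1 t) x - frac_lap s (w t) x * (u1 t x * F1 (u1 t x)))
         - (w t x * F2 (u2 t x) * frac_lap s (u2 t) x - frac_lap s (w t) x * (u2 t x * F2 (u2 t x))) =
        (F1 (u1 t x) - F2 (u2 t x)) * (w t x * frac_lap s (u2 t) x - u2 t x * frac_lap s (w t) x)"
        by algebra
    qed
    finally show ?thesis .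
  qed
  have "sqrt (E T) \<le> (sqrt (E 0) + \<epsilon>) * exp (stability_const CARD('n) N R * T)"
  proof (rule gronwall_sqrt[OF T C0 e0])
    fix t assume t: "t \<in> {0..T}"
    then have t0: "t \<ge> 0" by simp
    show "(E has_real_derivative 2 * (LINT x|torus. w t x * (v1 t x - v2 t x))) (at t within {0..T})"
      unfolding E_def by (rule DERIV_subset[OF energy_derivative[OF w t0]]) auto
    have "(LINT x|torus. (F1 (u1 t x) - F2 (u2 t x)) * (w t x * frac_lap s (u2 t) x - u2 t x * frac_lap s (w t) x)) \<le>
        stability_const CARD('n) N R * ((L2_norm (w t))\<^sup>2 + \<epsilon> * L2_norm (w t))"
      by (rule nonlinear_estimate[OF s F1 F2 N solution_wiener[OF v1(1) t0] pos(1)[OF t0] R(1)[OF t]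
          solution_wiener[OF v2(1) t0] pos(2)[OF t0] R(2)[OF t] solution_wiener[OF w t0] _ b1 b2 b3 eps]) (simp_all add: w_def)
    then show "2 * (LINT x|torus. w t x * (v1 t x - v2 t x)) \<le> 2 * stability_const CARD('n) N R * (E t + \<epsilon> * sqrt (E t))"
      by (simp add: id[OF t0] E_def L2_norm_nonneg)
  qed (simp add: E_def)
  moreover have "u1 0 = u10" "u2 0 = u20" using sol1 sol2 by (simp_all add: positive_global_solution_def)
  ultimately show ?thesis by (simp add: E_def L2_norm_nonneg w_def[abs_def])
qed

section \<open>The uniform estimate and the theorem\<close>

lemma Linf_norm_nonneg:
  assumes "emeasure M (space M) \<noteq> 0"
  shows "0 \<le> Linf_norm M f"
proof -
  have "esssup M (\<lambda>x. 0 :: ereal) \<le> Linf_norm M f"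
    unfolding Linf_norm_def by (rule esssup_mono) auto
  then show ?thesis by (simp add: esssup_const[OF assms])
qed

text \<open>As u is positive, its quadratic mean lies between its minimum and its maximum over the
  cell. So u x is no further from that mean than from one of these extremes, and the cell has
  diameter 2 pi sqrt d.\<close>

lemma sup_deviation_from_mean:
  fixes u :: "real ^ 'n \<Rightarrow> real"
  assumes u: "wiener u" and pos: "\<And>x. 0 < u x"
    and B: "\<And>x. x \<in> cbox 0 (\<chi> j. 2 * pi) \<Longrightarrow> norm (gradient u x) \<le> B"
    and x: "x \<in> cbox 0 (\<chi> j. 2 * pi)"
  shows "\<bar>u x - L2_norm u / sqrt ((2 * pi) ^ CARD('n))\<bar> \<le> 2 * sqrt (real CARD('n)) * pi * B"
proof -
  let ?C = "cbox (0::real^'n) (\<chi> j. 2 * pi)" and ?V = "(2 * pi) ^ CARD('n) :: real"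
  define c where "c = L2_norm u / sqrt ?V"
  have V: "?V > 0" by simp
  have c0: "c \<ge> 0" by (simp add: c_def L2_norm_nonneg)
  have cV: "c\<^sup>2 * ?V = (LINT x|torus. (u x)\<^sup>2)"
    using V by (simp add: c_def power_divide L2_norm_square)
  note uc = wiener_continuous[OF u]
  have ne: "?C \<noteq> {}" using x by blast
  have int: "integrable torus (\<lambda>x. (u x)\<^sup>2)" by (intro integrable_continuous_torus continuous_on_power uc)
  have const: "(LINT x|(torus :: (real^'n) measure). r) = r * ?V" for r :: real by (simp add: measure_torus)
  obtain y where y: "y \<in> ?C" "\<And>z. z \<in> ?C \<Longrightarrow> u y \<le> u z"
    using continuous_attains_inf[OF compact_cbox ne uc] by blast
  obtain y' where y': "y' \<in> ?C" "\<And>z. z \<in> ?C \<Longrightarrow> u z \<le> u y'"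
    using continuous_attains_sup[OF compact_cbox ne uc] by blast
  have "(u y)\<^sup>2 * ?V \<le> (LINT x|torus. (u x)\<^sup>2)"
    unfolding const[symmetric]
    by (rule integral_mono_AE) (use int y pos in \<open>auto simp: space_torus less_imp_le intro!: AE_I2 power_mono\<close>)
  then have "(u y)\<^sup>2 \<le> c\<^sup>2" using V unfolding cV[symmetric] by (simp only: mult_le_cancel_right_pos)
  then have yc: "u y \<le> c" using c0 by (rule power2_le_imp_le)
  have "(LINT x|torus. (u x)\<^sup>2) \<le> (u y')\<^sup>2 * ?V"
    unfolding const[symmetric]
    by (rule integral_mono_AE) (use int y' pos in \<open>auto simp: space_torus less_imp_le intro!: AE_I2 power_mono\<close>)
  then have "c\<^sup>2 \<le> (u y')\<^sup>2" using V unfolding cV[symmetric] by (simp only: mult_le_cancel_right_pos)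
  then have y'c: "c \<le> u y'" using less_imp_le[OF pos] by (rule power2_le_imp_le)
  have B0: "0 \<le> B" by (rule order_trans[OF norm_ge_zero B[OF x]])
  have diam: "norm (x - z) \<le> 2 * sqrt (real CARD('n)) * pi" if "z \<in> ?C" for z
  proof -
    have "((x - z) $ j)\<^sup>2 \<le> (2 * pi)\<^sup>2" for j
    proof -
      have "\<bar>(x - z) $ j\<bar> \<le> \<bar>2 * pi\<bar>"
        using x that by (auto simp: mem_box_cart abs_le_iff) (smt (verit))+
      then show ?thesis by (rule abs_le_square_iff[THEN iffD1])
    qed
    then have "(\<Sum>j\<in>UNIV. ((x - z) $ j)\<^sup>2) \<le> (\<Sum>j\<in>(UNIV::'n set). (2 * pi)\<^sup>2)" by (intro sum_mono)
    also have "\<dots> = (2 * sqrt (real CARD('n)) * pi)\<^sup>2" by (simp add: power_mult_distrib)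
    finally have "(norm (x - z))\<^sup>2 \<le> (2 * sqrt (real CARD('n)) * pi)\<^sup>2"
      by (simp add: norm_eq_sqrt_inner inner_vec_def sum_nonneg power2_eq_square)
    then show ?thesis by (rule power2_le_imp_le) simp
  qed
  have lip: "\<bar>u x - u z\<bar> \<le> 2 * sqrt (real CARD('n)) * pi * B" if "z \<in> ?C" for z
  proof -
    have "\<bar>u x - u z\<bar> \<le> B * norm (x - z)"
      by (rule wiener_gradient_lipschitz[OF u that x convex_box(1) B])
    also have "\<dots> \<le> B * (2 * sqrt (real CARD('n)) * pi)" using diam[OF that] B0 by (rule mult_left_mono)
    finally show ?thesis by (simp add: mult.commute)
  qed
  show ?thesis
    using lip[OF y(1)] lip[OF y'(1)] yc y'c unfolding c_def[symmetric] by linarith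
qed

lemma gradient_bound_Linf:
  fixes u :: "real ^ 'n \<Rightarrow> real"
  assumes u: "wiener u" and b: "Linf_norm torus (gradient u) = ereal b" and x: "x \<in> cbox 0 (\<chi> j. 2 * pi)"
  shows "norm (gradient u x) \<le> b"
proof (rule AE_torus_continuous_le[OF _ _ x])
  show "continuous_on UNIV (\<lambda>x. norm (gradient u x))"
    unfolding gradient_eq_wiener_gradient[OF u] by (intro continuous_on_norm wiener_gradient_continuous u)
  show "AE x in torus. norm (gradient u x) \<le> b"
    using esssup_AE[where M=torus and f="\<lambda>x. ereal (norm (gradient u x))"] b by (simp add: Linf_norm_def)
qed

theorem theorem3p3:
  fixes m :: nat and F1 :: "real \<Rightarrow> real"
  assumes m: "real m > real CARD('n::finite) / 2 + 1"
    and F1: "admissible F1"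
  shows
    "(\<exists>C0 :: real \<Rightarrow> real \<Rightarrow> real.
        \<forall>s F2 u10 u20 (u1 :: real \<Rightarrow> real ^ 'n \<Rightarrow> real) u2 I.
          0 < s \<and> s \<le> 1 \<and> admissible F2 \<and>
          sobolev_space m u10 \<and> (\<forall>x. 0 < u10 x) \<and> sobolev_space m u20 \<and> (\<forall>x. 0 < u20 x) \<and>
          positive_global_solution m s F1 u10 u1 \<and> positive_global_solution m s F2 u20 u2 \<and>
          is_interval I \<and> 0 \<in> I \<and> I \<subseteq> {0..} \<and> sobolev_bounded m I u1 \<and> sobolev_bounded m I u2
          \<longrightarrow>
          (\<forall>t\<in>I. 0 < t \<longrightarrow>
             ereal (L2_norm (\<lambda>x. u1 t x - u2 t x)) \<le>
             (ereal (L2_norm (\<lambda>x. u10 x - u20 x))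
                + Linf_norm half_line (\<lambda>z. half_deriv F1 z - half_deriv F2 z))
             * ereal (exp (C0 (sobolev_sup_norm m I u1) (sobolev_sup_norm m I u2) * t))))
     \<and>
     (\<forall>s F2 u10 u20 (u1 :: real \<Rightarrow> real ^ 'n \<Rightarrow> real) u2.
        0 < s \<and> s \<le> 1 \<and> admissible F2 \<and>
        sobolev_space m u10 \<and> (\<forall>x. 0 < u10 x) \<and> sobolev_space m u20 \<and> (\<forall>x. 0 < u20 x) \<and>
        positive_global_solution m s F1 u10 u1 \<and> positive_global_solution m s F2 u20 u2
        \<longrightarrow>
        (\<forall>t>0.
           Linf_norm torus (\<lambda>x. u1 t x - u2 t x) \<le>
           ereal (2 * sqrt (real CARD('n)) * pi)
             * (Linf_norm torus (gradient (u1 t)) + Linf_norm torus (gradient (u2 t)))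
           + ereal (1 / sqrt ((2 * pi) ^ CARD('n)) * \<bar>L2_norm u10 - L2_norm u20\<bar>)))"
proof (intro conjI allI impI)
  obtain K where K: "K \<ge> 0" "\<And>f :: real ^ 'n \<Rightarrow> real. continuous_on UNIV f \<Longrightarrow> sobolev_space m f \<Longrightarrow> wiener f \<and> wiener_norm f \<le> K * sobolev_norm m f"
    using sobolev_imp_wiener[OF m] by metis
  \<comment> \<open>Bounds the Wiener norms of both solutions, and with them the range on which
    derivatives of F1 are evaluated.\<close>
  define R where "R M1 M2 = K * max M1 M2" for M1 M2 :: real
  define D where "D z = \<bar>half_deriv F1 z\<bar> + \<bar>half_deriv (half_deriv F1) z\<bar> + \<bar>half_deriv (half_deriv (half_deriv F1)) z\<bar>" for z
  have "\<exists>N\<ge>0. \<forall>z\<in>{0..r}. D z \<le> N" for r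
  proof -
    have "continuous_on {0..r} D"
      unfolding D_def
      by (intro continuous_on_add continuous_on_rabs continuous_on_subset[OF differentiable_imp_continuous_on[OF admissible_derivs(2)[OF F1]]]
          continuous_on_subset[OF differentiable_imp_continuous_on[OF admissible_derivs(3)[OF F1]]]
          continuous_on_subset[OF differentiable_imp_continuous_on[OF admissible_derivs(4)[OF F1]]]) auto
    then have "bounded (D ` {0..r})" by (intro compact_imp_bounded compact_continuous_image) auto
    then have "\<exists>N. \<forall>z\<in>{0..r}. \<bar>D z\<bar> \<le> N" by (auto simp: bounded_iff)
    then obtain N where "\<forall>z\<in>{0..r}. \<bar>D z\<bar> \<le> N" by blast
    then show ?thesis by (intro exI[of _ "max N 0"]) (auto intro: order_trans[OF abs_ge_self] simp: le_max_iff_disj)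
  qed
  \<comment> \<open>\<open>N\<close> is chosen as a function of the radius, from F1 alone; this
    keeps s, F2 and the solutions out of the witness for the constant.\<close>
  then obtain N where N: "\<And>r. N r \<ge> 0" "\<And>r z. z \<in> {0..r} \<Longrightarrow> D z \<le> N r" by metis
  show "\<exists>C0 :: real \<Rightarrow> real \<Rightarrow> real.
        \<forall>s F2 u10 u20 (u1 :: real \<Rightarrow> real ^ 'n \<Rightarrow> real) u2 I.
          0 < s \<and> s \<le> 1 \<and> admissible F2 \<and>
          sobolev_space m u10 \<and> (\<forall>x. 0 < u10 x) \<and> sobolev_space m u20 \<and> (\<forall>x. 0 < u20 x) \<and>
          positive_global_solution m s F1 u10 u1 \<and> positive_global_solution m s F2 u20 u2 \<and>
          is_interval I \<and> 0 \<in> I \<and> I \<subseteq> {0..} \<and> sobolev_bounded m I u1 \<and> sobolev_bounded m I u2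
          \<longrightarrow>
          (\<forall>t\<in>I. 0 < t \<longrightarrow>
             ereal (L2_norm (\<lambda>x. u1 t x - u2 t x)) \<le>
             (ereal (L2_norm (\<lambda>x. u10 x - u20 x))
                + Linf_norm half_line (\<lambda>z. half_deriv F1 z - half_deriv F2 z))
             * ereal (exp (C0 (sobolev_sup_norm m I u1) (sobolev_sup_norm m I u2) * t)))"
  proof (intro exI[of _ "\<lambda>M1 M2. stability_const CARD('n) (N (R M1 M2)) (R M1 M2)"] allI impI ballI, elim conjE)
    fix s F2 u10 u20 t and u1 u2 :: "real \<Rightarrow> real ^ 'n \<Rightarrow> real" and I
    assume s: "0 < s" "s \<le> 1" and F2: "admissible F2"
      and sol1: "positive_global_solution m s F1 u10 u1" and sol2: "positive_global_solution m s F2 u20 u2"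
      and I: "is_interval I" "0 \<in> I" "I \<subseteq> {0..}" and bd: "sobolev_bounded m I u1" "sobolev_bounded m I u2"
      and t: "t \<in> I" "0 < t"
    define r where "r = R (sobolev_sup_norm m I u1) (sobolev_sup_norm m I u2)"
    let ?L = "Linf_norm half_line (\<lambda>z. half_deriv F1 z - half_deriv F2 z)"
    have wle: "wiener_norm (u \<tau>) \<le> K * sobolev_sup_norm m I u"
      if "positive_global_solution m s F u0 u" "sobolev_bounded m I u" "\<tau> \<in> {0..t}" for F u0 \<tau> and u :: "real \<Rightarrow> real ^ 'n \<Rightarrow> real"
    proof -
      \<comment> \<open>An interval containing 0 and t contains all times between them, so the
        supremum over \<open>I\<close> controls the norm on {0..t}.\<close>
      have "\<tau> \<in> I" using that(3) mem_is_interval_1_I[OF I(1,2) t(1)] by auto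
      then have "sobolev_norm m (u \<tau>) \<le> sobolev_sup_norm m I u"
        unfolding sobolev_sup_norm_def using that(2) by (intro cSUP_upper) (auto simp: sobolev_bounded_def)
      moreover have "wiener_norm (u \<tau>) \<le> K * sobolev_norm m (u \<tau>)"
        using that(1,3) K(2)[of "u \<tau>"] by (auto simp: positive_global_solution_def sobolev_continuous_def)
      ultimately show ?thesis using mult_left_mono[OF _ K(1)] order_trans by blast
    qed
    have r: "wiener_norm (u1 \<tau>) \<le> r" "wiener_norm (u2 \<tau>) \<le> r" if "\<tau> \<in> {0..t}" for \<tau>
      using wle[OF sol1 bd(1) that] wle[OF sol2 bd(2) that] mult_left_mono[OF max.cobounded1 K(1)] mult_left_mono[OF max.cobounded2 K(1)]
      unfolding r_def R_def by (meson order_trans)+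
    have Nr: "\<bar>half_deriv F1 z\<bar> \<le> N r" "\<bar>half_deriv (half_deriv F1) z\<bar> \<le> N r" "\<bar>half_deriv (half_deriv (half_deriv F1)) z\<bar> \<le> N r" if "z \<in> {0..r}" for z
      using N(2)[OF that] unfolding D_def by linarith+
    \<comment> \<open>The essential supremum over a null space would be -\<infinity>; positive mass
      makes \<open>?L\<close> nonnegative and excludes the case \<open>MInf\<close> below.\<close>
    have "emeasure lborel {0..1::real} \<le> emeasure lborel {0::real..}" by (intro emeasure_mono) auto
    then have "emeasure half_line (space half_line) \<noteq> 0"
      unfolding half_line_def by (auto simp: space_restrict_space emeasure_restrict_space)
    then have L0: "0 \<le> ?L" by (rule Linf_norm_nonneg)
    show "ereal (L2_norm (\<lambda>x. u1 t x - u2 t x)) \<le> (ereal (L2_norm (\<lambda>x. u10 x - u20 x)) + ?L)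
        * ereal (exp (stability_const CARD('n) (N (R (sobolev_sup_norm m I u1) (sobolev_sup_norm m I u2))) (R (sobolev_sup_norm m I u1) (sobolev_sup_norm m I u2)) * t))"
      unfolding r_def[symmetric]
    proof (cases ?L)
      case (real \<epsilon>)
      have c: "continuous_on {0..} (\<lambda>z. \<bar>half_deriv F1 z - half_deriv F2 z\<bar>)"
        by (intro continuous_on_rabs continuous_on_diff differentiable_imp_continuous_on admissible_derivs F1 F2)
      have "AE z in half_line. \<bar>half_deriv F1 z - half_deriv F2 z\<bar> \<le> \<epsilon>"
        using esssup_AE[where M=half_line and f="\<lambda>z. ereal (norm (half_deriv F1 z - half_deriv F2 z))"] real by (simp add: Linf_norm_def)
      then have eps: "\<bar>half_deriv F1 z - half_deriv F2 z\<bar> \<le> \<epsilon>" if "z \<ge> 0" for z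
        using AE_half_line_continuous_le[OF c] that by blast
      show "ereal (L2_norm (\<lambda>x. u1 t x - u2 t x)) \<le> (ereal (L2_norm (\<lambda>x. u10 x - u20 x)) + ?L) * ereal (exp (stability_const CARD('n) (N r) r * t))"
        using L2_stability[OF m s F1 F2 N(1) sol1 sol2 t(2) r Nr eps] unfolding real by simp
    next
      case PInf
      then show "ereal (L2_norm (\<lambda>x. u1 t x - u2 t x)) \<le> (ereal (L2_norm (\<lambda>x. u10 x - u20 x)) + ?L) * ereal (exp (stability_const CARD('n) (N r) r * t))"
        by simp
    next
      case MInf
      then show "ereal (L2_norm (\<lambda>x. u1 t x - u2 t x)) \<le> (ereal (L2_norm (\<lambda>x. u10 x - u20 x)) + ?L) * ereal (exp (stability_const CARD('n) (N r) r * t))"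
        using L0 by simp
    qed
  qed
next
  fix s F2 u10 u20 t and u1 u2 :: "real \<Rightarrow> real ^ 'n \<Rightarrow> real"
  assume "0 < s \<and> s \<le> 1 \<and> admissible F2 \<and>
        sobolev_space m u10 \<and> (\<forall>x. 0 < u10 x) \<and> sobolev_space m u20 \<and> (\<forall>x. 0 < u20 x) \<and>
        positive_global_solution m s F1 u10 u1 \<and> positive_global_solution m s F2 u20 u2"
  then have s: "0 < s" "s \<le> 1" and F2: "admissible F2"
    and sol1: "positive_global_solution m s F1 u10 u1" and sol2: "positive_global_solution m s F2 u20 u2" by blast+
  assume t: "t > (0::real)"
  let ?G1 = "Linf_norm torus (gradient (u1 t))" and ?G2 = "Linf_norm torus (gradient (u2 t))"
  let ?d = "2 * sqrt (real CARD('n)) * pi" and ?q = "sqrt ((2 * pi) ^ CARD('n))"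
  obtain v1 where v1: "weak_time_derivative u1 v1"
    using solution_weak_time_derivative[OF m s F1 sol1] by blast
  obtain v2 where v2: "weak_time_derivative u2 v2"
    using solution_weak_time_derivative[OF m s F2 sol2] by blast
  have w: "wiener (u1 t)" "wiener (u2 t)"
    using t by (simp_all add: solution_wiener[OF v1] solution_wiener[OF v2])
  have pos: "0 < u1 t x" "0 < u2 t x" for x
    using sol1 sol2 t by (simp_all add: positive_global_solution_def)
  have cons: "L2_norm (u1 t) = L2_norm u10" "L2_norm (u2 t) = L2_norm u20"
    using L2_norm_conserved[OF m s F1 sol1] L2_norm_conserved[OF m s F2 sol2] t by simp_all
  have "emeasure (torus :: (real^'n) measure) (space torus) \<noteq> 0" by (simp add: emeasure_torus)
  then have G0: "0 \<le> ?G1" "0 \<le> ?G2" by (rule Linf_norm_nonneg)+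
  have d: "?d > 0" by simp
  show "Linf_norm torus (\<lambda>x. u1 t x - u2 t x) \<le> ereal ?d * (?G1 + ?G2) + ereal (1 / ?q * \<bar>L2_norm u10 - L2_norm u20\<bar>)"
  \<comment> \<open>Both norms are nonnegative by \<open>G0\<close>, so one infinite gradient norm
    makes the right-hand side infinite and the claim trivial.\<close>
  proof (cases "?G1 = \<infinity> \<or> ?G2 = \<infinity>")
    case True
    then have "?G1 + ?G2 = \<infinity>" using G0 by auto
    then have inf: "ereal ?d * (?G1 + ?G2) + ereal (1 / ?q * \<bar>L2_norm u10 - L2_norm u20\<bar>) = \<infinity>"
      using d by (simp only: ereal_mult_infty if_True) simp
    show ?thesis unfolding inf by simp
  next
    case False
    then obtain g1 g2 where g: "?G1 = ereal g1" "?G2 = ereal g2"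
      using G0 by (metis ereal_cases ereal_infty_less_eq(2) MInfty_neq_PInfty(1) ereal_less_eq(2) zero_ereal_def not_MInfty_nonneg)
    have "\<bar>u1 t x - u2 t x\<bar> \<le> ?d * (g1 + g2) + 1 / ?q * \<bar>L2_norm u10 - L2_norm u20\<bar>" if "x \<in> cbox 0 (\<chi> j. 2 * pi)" for x
    proof -
      have "\<bar>u1 t x - L2_norm u10 / ?q\<bar> \<le> ?d * g1"
        using sup_deviation_from_mean[OF w(1) pos(1) gradient_bound_Linf[OF w(1) g(1)] that] by (simp only: cons)
      moreover have "\<bar>u2 t x - L2_norm u20 / ?q\<bar> \<le> ?d * g2"
        using sup_deviation_from_mean[OF w(2) pos(2) gradient_bound_Linf[OF w(2) g(2)] that] by (simp only: cons)
      moreover have "1 / ?q * \<bar>L2_norm u10 - L2_norm u20\<bar> = \<bar>L2_norm u10 / ?q - L2_norm u20 / ?q\<bar>"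
        by (simp add: diff_divide_distrib[symmetric])
      ultimately show ?thesis unfolding distrib_left by linarith
    qed
    then have "AE x in torus. ereal (norm (u1 t x - u2 t x)) \<le> ereal (?d * (g1 + g2) + 1 / ?q * \<bar>L2_norm u10 - L2_norm u20\<bar>)"
      by (intro AE_I2) (simp add: space_torus)
    moreover have "(\<lambda>x. ereal (norm (u1 t x - u2 t x))) \<in> borel_measurable torus"
      by (intro borel_measurable_ereal continuous_measurable_torus continuous_on_norm continuous_on_diff wiener_continuous w)
    ultimately have "Linf_norm torus (\<lambda>x. u1 t x - u2 t x) \<le> ereal (?d * (g1 + g2) + 1 / ?q * \<bar>L2_norm u10 - L2_norm u20\<bar>)"
      unfolding Linf_norm_def by (rule esssup_I[rotated])
    then show ?thesis unfolding g by simp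
  qed
qed

end
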